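(* Let $G=(V,E,s)$ be a reducible flow graph with $n$ vertices and initially $m$ edges. The dominator tree of $G$ can be maintained through any sequence of edge deletions in $O(mn)$ total time.
   Context: A flow graph $G=(V,E,s)$ is a directed graph with a distinguished start vertex $s$. A vertex $w$ dominates $v$ if every path from $s$ to $v$ contains $w$; the dominator tree is the tree rooted at $s$ on the vertices reachable from $s$ in which the parent of each $v\neq s$ is its immediate dominator (the dominator of $v$ other than $v$ that is dominated by all other dominators of $v$ other than $v$). A flow graph is reducible if every strongly connected subgraph $S$ has a single entry vertex $v$ such that every path from $s$ to a vertex of $S$ contains $v$. *)

theory Defs
  imports "Graph_Theory.Graph_Theory"
begin

section \<open>Flow graphs and dominators\<close>

locale flow_graph = pair_fin_digraph G for G :: "'a pair_pre_digraph" +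
  fixes s :: 'a
  assumes start_in_verts: "s \<in> pverts G"

definition dominates :: "'a pair_pre_digraph \<Rightarrow> 'a \<Rightarrow> 'a \<Rightarrow> 'a \<Rightarrow> bool" where
  "dominates G s w v \<longleftrightarrow>
     (\<forall>p. pre_digraph.awalk (with_proj G) s p v \<longrightarrow>
          w \<in> set (pre_digraph.awalk_verts (with_proj G) s p))"

definition immediate_dominator :: "'a pair_pre_digraph \<Rightarrow> 'a \<Rightarrow> 'a \<Rightarrow> 'a \<Rightarrow> bool" where
  "immediate_dominator G s d v \<longleftrightarrow>
     dominates G s d v \<and> d \<noteq> v \<and>
     (\<forall>w. dominates G s w v \<and> w \<noteq> v \<and> w \<noteq> d \<longrightarrow> dominates G s w d)"

text \<open>Arcs of the dominator tree point from the parent to the child.\<close>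

definition dominator_tree :: "'a pair_pre_digraph \<Rightarrow> 'a \<Rightarrow> 'a pair_pre_digraph" where
  "dominator_tree G s =
     \<lparr> pverts = {v. s \<rightarrow>\<^sup>*\<^bsub>with_proj G\<^esub> v},
       parcs = {(d, v). s \<rightarrow>\<^sup>*\<^bsub>with_proj G\<^esub> v \<and> v \<noteq> s \<and> immediate_dominator G s d v} \<rparr>"

text \<open>The entry vertex has to belong to \<open>S\<close>; otherwise \<open>s\<close> would always qualify.\<close>

definition reducible :: "'a pair_pre_digraph \<Rightarrow> 'a \<Rightarrow> bool" where
  "reducible G s \<longleftrightarrow>
     (\<forall>S. subgraph S (with_proj G) \<and> strongly_connected S \<longrightarrow>
       (\<exists>v \<in> verts S. \<forall>u \<in> verts S. \<forall>p. pre_digraph.awalk (with_proj G) s p u \<longrightarrow>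
          v \<in> set (pre_digraph.awalk_verts (with_proj G) s p)))"

definition delete_edge :: "'a pair_pre_digraph \<Rightarrow> 'a \<times> 'a \<Rightarrow> 'a pair_pre_digraph" where
  "delete_edge G e = G\<lparr> parcs := parcs G - {e} \<rparr>"


section \<open>Random access machine\<close>

text \<open>
  A structured presentation of the word RAM. The memory consists of named, unbounded arrays of
  natural numbers, of which a program mentions only finitely many; a scalar variable is
  cell \<open>0\<close> of an array. Subtraction is truncated at \<open>0\<close>, and \<open>x div 0 = 0\<close>, \<open>x mod 0 = x\<close>.
\<close>

type_synonym vname = string
type_synonym state = "vname \<Rightarrow> nat \<Rightarrow> nat"

datatype binop = Plus | Minus | Times | Quot | Rem

datatype expr = Const nat | Cell vname expr | Bin binop expr expr

datatype cond = Less expr expr | Equal expr expr | Neg cond | Conj cond cond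

datatype com =
    Skip
  | Assign vname expr expr  \<comment> \<open>array, index, new value\<close>
  | Seq com com
  | If cond com com
  | While cond com

fun binop_val :: "binop \<Rightarrow> nat \<Rightarrow> nat \<Rightarrow> nat" where
  "binop_val Plus a b = a + b"
| "binop_val Minus a b = a - b"
| "binop_val Times a b = a * b"
| "binop_val Quot a b = a div b"
| "binop_val Rem a b = a mod b"

fun expr_val :: "expr \<Rightarrow> state \<Rightarrow> nat" where
  "expr_val (Const k) \<sigma> = k"
| "expr_val (Cell x e) \<sigma> = \<sigma> x (expr_val e \<sigma>)"
| "expr_val (Bin f a b) \<sigma> = binop_val f (expr_val a \<sigma>) (expr_val b \<sigma>)"

fun cond_val :: "cond \<Rightarrow> state \<Rightarrow> bool" where
  "cond_val (Less a b) \<sigma> \<longleftrightarrow> expr_val a \<sigma> < expr_val b \<sigma>"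
| "cond_val (Equal a b) \<sigma> \<longleftrightarrow> expr_val a \<sigma> = expr_val b \<sigma>"
| "cond_val (Neg b) \<sigma> \<longleftrightarrow> \<not> cond_val b \<sigma>"
| "cond_val (Conj b c) \<sigma> \<longleftrightarrow> cond_val b \<sigma> \<and> cond_val c \<sigma>"

text \<open>
  Every value that occurs during an evaluation, addresses included, has to fit into a machine
  word, that is, has to be smaller than \<open>W\<close>. An overflowing computation is stuck.
\<close>

fun expr_fits :: "nat \<Rightarrow> expr \<Rightarrow> state \<Rightarrow> bool" where
  "expr_fits W (Const k) \<sigma> \<longleftrightarrow> k < W"
| "expr_fits W (Cell x e) \<sigma> \<longleftrightarrow> expr_fits W e \<sigma> \<and> \<sigma> x (expr_val e \<sigma>) < W"
| "expr_fits W (Bin f a b) \<sigma> \<longleftrightarrow>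
     expr_fits W a \<sigma> \<and> expr_fits W b \<sigma> \<and> expr_val (Bin f a b) \<sigma> < W"

fun cond_fits :: "nat \<Rightarrow> cond \<Rightarrow> state \<Rightarrow> bool" where
  "cond_fits W (Less a b) \<sigma> \<longleftrightarrow> expr_fits W a \<sigma> \<and> expr_fits W b \<sigma>"
| "cond_fits W (Equal a b) \<sigma> \<longleftrightarrow> expr_fits W a \<sigma> \<and> expr_fits W b \<sigma>"
| "cond_fits W (Neg b) \<sigma> \<longleftrightarrow> cond_fits W b \<sigma>"
| "cond_fits W (Conj b c) \<sigma> \<longleftrightarrow> cond_fits W b \<sigma> \<and> cond_fits W c \<sigma>"

fun expr_cost :: "expr \<Rightarrow> nat" where
  "expr_cost (Const k) = 1"
| "expr_cost (Cell x e) = 1 + expr_cost e"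
| "expr_cost (Bin f a b) = 1 + expr_cost a + expr_cost b"

fun cond_cost :: "cond \<Rightarrow> nat" where
  "cond_cost (Less a b) = 1 + expr_cost a + expr_cost b"
| "cond_cost (Equal a b) = 1 + expr_cost a + expr_cost b"
| "cond_cost (Neg b) = 1 + cond_cost b"
| "cond_cost (Conj b c) = 1 + cond_cost b + cond_cost c"

definition store :: "state \<Rightarrow> vname \<Rightarrow> nat \<Rightarrow> nat \<Rightarrow> state" where
  "store \<sigma> x i k = \<sigma>(x := (\<sigma> x)(i := k))"

text \<open>\<open>exec W c \<sigma> t \<sigma>'\<close>: with word bound \<open>W\<close>, started in \<open>\<sigma>\<close>, \<open>c\<close> halts after \<open>t\<close> steps in \<open>\<sigma>'\<close>.\<close>

inductive exec :: "nat \<Rightarrow> com \<Rightarrow> state \<Rightarrow> nat \<Rightarrow> state \<Rightarrow> bool" for W :: nat where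
  Skip: "exec W Skip \<sigma> 1 \<sigma>"
| Assign: "\<lbrakk> expr_fits W i \<sigma>; expr_fits W e \<sigma> \<rbrakk> \<Longrightarrow>
    exec W (Assign x i e) \<sigma> (1 + expr_cost i + expr_cost e)
      (store \<sigma> x (expr_val i \<sigma>) (expr_val e \<sigma>))"
| Seq: "\<lbrakk> exec W c1 \<sigma> t1 \<sigma>1; exec W c2 \<sigma>1 t2 \<sigma>2 \<rbrakk> \<Longrightarrow> exec W (Seq c1 c2) \<sigma> (t1 + t2) \<sigma>2"
| IfTrue: "\<lbrakk> cond_fits W b \<sigma>; cond_val b \<sigma>; exec W c1 \<sigma> t \<sigma>' \<rbrakk> \<Longrightarrow>
    exec W (If b c1 c2) \<sigma> (1 + cond_cost b + t) \<sigma>'"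
| IfFalse: "\<lbrakk> cond_fits W b \<sigma>; \<not> cond_val b \<sigma>; exec W c2 \<sigma> t \<sigma>' \<rbrakk> \<Longrightarrow>
    exec W (If b c1 c2) \<sigma> (1 + cond_cost b + t) \<sigma>'"
| WhileFalse: "\<lbrakk> cond_fits W b \<sigma>; \<not> cond_val b \<sigma> \<rbrakk> \<Longrightarrow>
    exec W (While b c) \<sigma> (1 + cond_cost b) \<sigma>"
| WhileTrue: "\<lbrakk> cond_fits W b \<sigma>; cond_val b \<sigma>; exec W c \<sigma> t1 \<sigma>1; exec W (While b c) \<sigma>1 t2 \<sigma>2 \<rbrakk> \<Longrightarrow>
    exec W (While b c) \<sigma> (1 + cond_cost b + t1 + t2) \<sigma>2"

inductive_cases exec_elims:
  "exec W Skip \<sigma> t \<sigma>'"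
  "exec W (Assign x i e) \<sigma> t \<sigma>'"
  "exec W (Seq c1 c2) \<sigma> t \<sigma>'"
  "exec W (If b c1 c2) \<sigma> t \<sigma>'"

inductive_cases exec_WhileE: "exec W (While b c) \<sigma> t \<sigma>'"

lemma exec_deterministic:
  assumes "exec W c \<sigma> t \<sigma>'" and "exec W c \<sigma> u \<tau>"
  shows "u = t \<and> \<tau> = \<sigma>'"
  using assms
proof (induction arbitrary: u \<tau> rule: exec.induct)
  case (Seq c1 \<sigma> t1 \<sigma>1 c2 t2 \<sigma>2)
  then show ?case by (blast elim: exec_elims)
next
  case (WhileFalse b \<sigma> c)
  from WhileFalse.prems show ?case
    by (rule exec_WhileE) (use WhileFalse.hyps in auto)
next
  case (WhileTrue b \<sigma> c t1 \<sigma>1 t2 \<sigma>2)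
  from WhileTrue.prems obtain v1 \<tau>1 v2 where *: "u = 1 + cond_cost b + v1 + v2"
    "exec W c \<sigma> v1 \<tau>1" "exec W (While b c) \<tau>1 v2 \<tau>"
    by (rule exec_WhileE) (use WhileTrue.hyps in auto)
  with WhileTrue.IH(1) have "v1 = t1" "\<tau>1 = \<sigma>1" by blast+
  with * WhileTrue.IH(2) show ?case by blast
next
  case (IfTrue b \<sigma> c1 t \<sigma>' c2)
  from IfTrue.prems show ?case
    by (rule exec_elims(4)) (use IfTrue.hyps IfTrue.IH in \<open>metis plus_1_eq_Suc add_Suc\<close>)+
next
  case (IfFalse b \<sigma> c2 t \<sigma>' c1)
  from IfFalse.prems show ?case
    by (rule exec_elims(4)) (use IfFalse.hyps IfFalse.IH in \<open>metis plus_1_eq_Suc add_Suc\<close>)+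
next
  case (Skip \<sigma>)
  then show ?case by (rule exec_elims(1)) simp
next
  case (Assign i \<sigma> e x)
  from Assign.prems show ?case by (rule exec_elims(2)) simp
qed


section \<open>Maintaining a dominator tree under edge deletions\<close>

text \<open>
  The input graph is given on the vertices \<open>0, \<dots>, n - 1\<close> as a list of its edges. All cells that
  do not hold input are initially \<open>0\<close>.
\<close>

definition input_state :: "nat \<Rightarrow> nat \<Rightarrow> (nat \<times> nat) list \<Rightarrow> state" where
  "input_state n s as = (\<lambda>_ _. 0)
     (''n'' := (\<lambda>_. 0)(0 := n),
      ''m'' := (\<lambda>_. 0)(0 := length as),
      ''s'' := (\<lambda>_. 0)(0 := s),
      ''tail'' := (\<lambda>i. if i < length as then fst (as ! i) else 0),
      ''head'' := (\<lambda>i. if i < length as then snd (as ! i) else 0))"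

definition request :: "nat \<times> nat \<Rightarrow> state \<Rightarrow> state" where
  "request e \<sigma> = store (store \<sigma> ''del_tail'' 0 (fst e)) ''del_head'' 0 (snd e)"

definition stored_tree :: "nat \<Rightarrow> nat \<Rightarrow> state \<Rightarrow> nat pair_pre_digraph" where
  "stored_tree n s \<sigma> =
     \<lparr> pverts = {v. v < n \<and> \<sigma> ''in_tree'' v \<noteq> 0},
       parcs = {(\<sigma> ''parent'' v, v) |v. v < n \<and> \<sigma> ''in_tree'' v \<noteq> 0 \<and> v \<noteq> s} \<rparr>"

text \<open>
  \<open>maintains W upd n G s \<sigma> es t\<close>: in state \<open>\<sigma>\<close> the dominator tree of \<open>G\<close> is stored, and serving the
  deletions \<open>es\<close> one by one with \<open>upd\<close> takes \<open>t\<close> steps in total, the dominator tree of the current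
  graph being stored after each of them. The program sees a deletion only when its turn comes.
\<close>

fun maintains ::
  "nat \<Rightarrow> com \<Rightarrow> nat \<Rightarrow> nat pair_pre_digraph \<Rightarrow> nat \<Rightarrow> state \<Rightarrow> (nat \<times> nat) list \<Rightarrow> nat \<Rightarrow> bool"
where
  "maintains W upd n G s \<sigma> [] t \<longleftrightarrow> stored_tree n s \<sigma> = dominator_tree G s \<and> t = 0"
| "maintains W upd n G s \<sigma> (e # es) t \<longleftrightarrow>
     stored_tree n s \<sigma> = dominator_tree G s \<and>
     (\<exists>t1 \<sigma>' t2. exec W upd (request e \<sigma>) t1 \<sigma>' \<and>
        maintains W upd n (delete_edge G e) s \<sigma>' es t2 \<and> t = t1 + t2)"

end

theory Submission
  imports Defs "HOL-Library.Sublist"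
begin

text \<open>
  A vertex \<open>w\<close> dominates \<open>v\<close> iff \<open>v\<close> cannot be reached from \<open>s\<close> once \<open>w\<close> is removed, so it suffices to
  maintain, for each of the \<open>n\<close> vertices \<open>w\<close>, the set of vertices reachable in \<open>G - w\<close>, each within
  \<open>O(m)\<close> total time.

  Call an edge \<open>(u, v)\<close> forward if \<open>v\<close> does not dominate \<open>u\<close> in the initial graph. The other edges never
  matter for reachability in any \<open>G - w\<close>, now or after deletions, because a simple path from \<open>s\<close> cannot
  use them; and in a reducible graph the forward edges are acyclic. On an acyclic graph decremental
  reachability is easy: a vertex stays reachable as long as the number of its reachable predecessors,
  kept in a counter, is positive, and a vertex whose counter drops to \<open>0\<close> decrements the counters of its
  successors. Every vertex dies at most once per \<open>w\<close>, which pays for scanning its outgoing edges.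

  Deletions only enlarge the sets of dominators. The new parent of \<open>v\<close> is the deepest among the old parent
  and the vertices \<open>w\<close> in whose copy \<open>v\<close> has just died; depths are compared by asking whether the
  current candidate dominates \<open>w\<close>.
\<close>


section \<open>Timed Hoare triples\<close>

fun writes :: "com \<Rightarrow> vname set" where
  "writes Skip = {}"
| "writes (Assign x i e) = {x}"
| "writes (Seq c d) = writes c \<union> writes d"
| "writes (If b c d) = writes c \<union> writes d"
| "writes (While b c) = writes c"

definition agree :: "vname set \<Rightarrow> state \<Rightarrow> state \<Rightarrow> bool" where
  "agree X \<sigma> \<tau> \<longleftrightarrow> (\<forall>x. x \<notin> X \<longrightarrow> \<tau> x = \<sigma> x)"

definition bounded_state :: "nat \<Rightarrow> state \<Rightarrow> bool" where
  "bounded_state W \<sigma> \<longleftrightarrow> (\<forall>x i. \<sigma> x i < W)"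

definition triple :: "nat \<Rightarrow> (state \<Rightarrow> bool) \<Rightarrow> com \<Rightarrow> nat \<Rightarrow> (state \<Rightarrow> bool) \<Rightarrow> bool" where
  "triple W P c T Q \<longleftrightarrow>
     (\<forall>\<sigma>. bounded_state W \<sigma> \<longrightarrow> P \<sigma> \<longrightarrow> (\<exists>t \<tau>. exec W c \<sigma> t \<tau> \<and> t \<le> T \<and> Q \<tau>))"

lemma store_apply: "store \<sigma> x i k y = (if y = x then (\<sigma> x)(i := k) else \<sigma> y)"
  by (simp add: store_def)

lemma agree_store: "x \<in> X \<Longrightarrow> agree X \<sigma> (store \<sigma> x i k)"
  by (simp add: agree_def store_apply)

lemma agreeD: "agree X \<sigma> \<tau> \<Longrightarrow> x \<notin> X \<Longrightarrow> \<tau> x = \<sigma> x"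
  by (simp add: agree_def)

lemma agree_mono: "agree X \<sigma> \<tau> \<Longrightarrow> X \<subseteq> Y \<Longrightarrow> agree Y \<sigma> \<tau>"
  by (auto simp: agree_def)

lemma exec_agree: "exec W c \<sigma> t \<tau> \<Longrightarrow> agree (writes c) \<sigma> \<tau>"
  by (induction rule: exec.induct) (auto simp: agree_def store_apply)

lemma expr_val_less: "expr_fits W e \<sigma> \<Longrightarrow> expr_val e \<sigma> < W"
  by (cases e) auto

lemma bounded_stateD: "bounded_state W \<sigma> \<Longrightarrow> \<sigma> x i < W"
  by (simp add: bounded_state_def)

lemma bounded_state_store: "bounded_state W \<sigma> \<Longrightarrow> k < W \<Longrightarrow> bounded_state W (store \<sigma> x i k)"
  by (simp add: bounded_state_def store_apply)

lemma exec_bounded_state: "exec W c \<sigma> t \<tau> \<Longrightarrow> bounded_state W \<sigma> \<Longrightarrow> bounded_state W \<tau>"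
  by (induction rule: exec.induct) (auto intro: bounded_state_store expr_val_less)

lemma tripleE:
  assumes "triple W P c T Q" "bounded_state W \<sigma>" "P \<sigma>"
  obtains t \<tau> where "exec W c \<sigma> t \<tau>" "t \<le> T" "bounded_state W \<tau>" "agree (writes c) \<sigma> \<tau>" "Q \<tau>"
  using assms exec_bounded_state exec_agree unfolding triple_def by metis

lemma triple_conseq:
  assumes "triple W P c T Q"
    and "\<And>\<sigma>. bounded_state W \<sigma> \<Longrightarrow> P' \<sigma> \<Longrightarrow> P \<sigma>" "T \<le> T'"
    and "\<And>\<sigma>. bounded_state W \<sigma> \<Longrightarrow> Q \<sigma> \<Longrightarrow> Q' \<sigma>"
  shows "triple W P' c T' Q'"
  using assms exec_bounded_state unfolding triple_def by (meson le_trans)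

lemma triple_assume:
  "(\<And>\<sigma>. bounded_state W \<sigma> \<Longrightarrow> P \<sigma> \<Longrightarrow> p) \<Longrightarrow> (p \<Longrightarrow> triple W P c T Q) \<Longrightarrow> triple W P c T Q"
  unfolding triple_def by blast

lemma triple_Seq:
  assumes "triple W P c T Q" "triple W Q d U R"
  shows "triple W P (Seq c d) (T + U) R"
  unfolding triple_def
proof (intro allI impI)
  fix \<sigma> assume "bounded_state W \<sigma>" "P \<sigma>"
  with assms(1) obtain t \<rho> where c: "exec W c \<sigma> t \<rho>" "t \<le> T" "bounded_state W \<rho>" "Q \<rho>"
    by (rule tripleE)
  from assms(2) c(3,4) obtain u \<tau> where d: "exec W d \<rho> u \<tau>" "u \<le> U" "R \<tau>" by (rule tripleE)
  show "\<exists>t \<tau>. exec W (Seq c d) \<sigma> t \<tau> \<and> t \<le> T + U \<and> R \<tau>"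
    using exec.Seq[OF c(1) d(1)] add_mono[OF c(2) d(2)] d(3) by blast
qed

lemma triple_If:
  assumes fits: "\<And>\<sigma>. bounded_state W \<sigma> \<Longrightarrow> P \<sigma> \<Longrightarrow> cond_fits W b \<sigma>"
    and true: "triple W (\<lambda>\<sigma>. P \<sigma> \<and> cond_val b \<sigma>) c T Q"
    and false: "triple W (\<lambda>\<sigma>. P \<sigma> \<and> \<not> cond_val b \<sigma>) d T Q"
  shows "triple W P (If b c d) (1 + cond_cost b + T) Q"
  unfolding triple_def
proof (intro allI impI)
  fix \<sigma> assume \<sigma>: "bounded_state W \<sigma>" "P \<sigma>"
  show "\<exists>t \<tau>. exec W (If b c d) \<sigma> t \<tau> \<and> t \<le> 1 + cond_cost b + T \<and> Q \<tau>"
  proof (cases "cond_val b \<sigma>")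
    case True
    with true \<sigma> obtain t \<tau> where "exec W c \<sigma> t \<tau>" "t \<le> T" "Q \<tau>" by (blast elim: tripleE)
    with exec.IfTrue[OF fits[OF \<sigma>] True] show ?thesis by (meson add_left_mono)
  next
    case False
    with false \<sigma> obtain t \<tau> where "exec W d \<sigma> t \<tau>" "t \<le> T" "Q \<tau>" by (blast elim: tripleE)
    with exec.IfFalse[OF fits[OF \<sigma>] False] show ?thesis by (meson add_left_mono)
  qed
qed

lemma triple_While:
  fixes \<Phi> :: "state \<Rightarrow> nat"
  assumes fits: "\<And>\<sigma>. bounded_state W \<sigma> \<Longrightarrow> I \<sigma> \<Longrightarrow> cond_fits W b \<sigma>"
    and step: "\<And>\<sigma>. bounded_state W \<sigma> \<Longrightarrow> I \<sigma> \<Longrightarrow> cond_val b \<sigma> \<Longrightarrow>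
      \<exists>t. triple W ((=) \<sigma>) c t (\<lambda>\<tau>. I \<tau> \<and> 1 + cond_cost b + t + \<Phi> \<tau> \<le> \<Phi> \<sigma>)"
  shows "triple W (\<lambda>\<sigma>. I \<sigma> \<and> \<Phi> \<sigma> \<le> B) (While b c) (1 + cond_cost b + B) (\<lambda>\<tau>. I \<tau> \<and> \<not> cond_val b \<tau>)"
proof -
  have "\<exists>t \<tau>. exec W (While b c) \<sigma> t \<tau> \<and> t \<le> 1 + cond_cost b + \<Phi> \<sigma> \<and> I \<tau> \<and> \<not> cond_val b \<tau>"
    if "bounded_state W \<sigma>" "I \<sigma>" for \<sigma>
    using that
  proof (induction "\<Phi> \<sigma>" arbitrary: \<sigma> rule: less_induct)
    case less
    show ?case
    proof (cases "cond_val b \<sigma>")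
      case True
      from step[OF less.prems True] obtain t
        where "triple W ((=) \<sigma>) c t (\<lambda>\<tau>. I \<tau> \<and> 1 + cond_cost b + t + \<Phi> \<tau> \<le> \<Phi> \<sigma>)" ..
      then obtain t' \<rho> where body: "exec W c \<sigma> t' \<rho>" "t' \<le> t" "bounded_state W \<rho>" "I \<rho>"
        "1 + cond_cost b + t + \<Phi> \<rho> \<le> \<Phi> \<sigma>"
        using less.prems(1) by (rule tripleE) auto
      have "\<Phi> \<rho> < \<Phi> \<sigma>" using body(5) by linarith
      from less.hyps[OF this body(3,4)] obtain u \<tau> where rest: "exec W (While b c) \<rho> u \<tau>"
        "u \<le> 1 + cond_cost b + \<Phi> \<rho>" "I \<tau>" "\<not> cond_val b \<tau>" by blast
      have "1 + cond_cost b + t' + u \<le> 1 + cond_cost b + \<Phi> \<sigma>" using body(2,5) rest(2) by linarith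
      with exec.WhileTrue[OF fits[OF less.prems] True body(1) rest(1)] rest(3,4) show ?thesis by blast
    next
      case False
      with exec.WhileFalse[OF fits[OF less.prems] False] less.prems(2) show ?thesis
        by (meson le_add1)
    qed
  qed
  then show ?thesis unfolding triple_def by (meson add_left_mono le_trans)
qed


subsection \<open>Frames\<close>

definition preserved :: "vname set \<Rightarrow> (state \<Rightarrow> bool) \<Rightarrow> bool" where
  "preserved X P \<longleftrightarrow> (\<forall>\<sigma> \<tau>. P \<sigma> \<longrightarrow> agree X \<sigma> \<tau> \<longrightarrow> P \<tau>)"

named_theorems preserved_intros

lemma preservedD: "preserved X P \<Longrightarrow> P \<sigma> \<Longrightarrow> agree X \<sigma> \<tau> \<Longrightarrow> P \<tau>"
  by (auto simp: preserved_def)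

lemma preserved_mono: "preserved X P \<Longrightarrow> Y \<subseteq> X \<Longrightarrow> preserved Y P"
  unfolding preserved_def using agree_mono by blast

lemma preserved_conj [preserved_intros]: "preserved X P \<Longrightarrow> preserved X Q \<Longrightarrow> preserved X (\<lambda>\<sigma>. P \<sigma> \<and> Q \<sigma>)"
  by (auto simp: preserved_def)

lemma preserved_const [preserved_intros]: "preserved X (\<lambda>_. p)"
  by (simp add: preserved_def)

lemma preserved_cell [preserved_intros]: "x \<notin> X \<Longrightarrow> preserved X (\<lambda>\<sigma>. \<sigma> x i = k)"
  by (simp add: preserved_def agree_def)

lemma triple_frame:
  assumes "triple W P c T Q" "preserved (writes c) R"
    and "\<And>\<sigma>. P' \<sigma> \<Longrightarrow> P \<sigma> \<and> R \<sigma>" "\<And>\<sigma>. Q \<sigma> \<Longrightarrow> R \<sigma> \<Longrightarrow> Q' \<sigma>"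
  shows "triple W P' c T Q'"
  unfolding triple_def
proof (intro allI impI)
  fix \<sigma> assume \<sigma>: "bounded_state W \<sigma>" "P' \<sigma>"
  then obtain t \<tau> where "exec W c \<sigma> t \<tau>" "t \<le> T" "agree (writes c) \<sigma> \<tau>" "Q \<tau>"
    using assms(1,3) by (blast elim: tripleE)
  with assms(2-4) \<sigma>(2) show "\<exists>t \<tau>. exec W c \<sigma> t \<tau> \<and> t \<le> T \<and> Q' \<tau>" by (blast dest: preservedD)
qed


subsection \<open>Loop-free commands\<close>

text \<open>On commands with loops \<open>effect\<close> is junk; \<open>safe\<close> excludes them.\<close>

fun effect :: "com \<Rightarrow> state \<Rightarrow> state" where
  "effect Skip \<sigma> = \<sigma>"
| "effect (Assign x i e) \<sigma> = store \<sigma> x (expr_val i \<sigma>) (expr_val e \<sigma>)"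
| "effect (Seq c d) \<sigma> = effect d (effect c \<sigma>)"
| "effect (If b c d) \<sigma> = (if cond_val b \<sigma> then effect c \<sigma> else effect d \<sigma>)"
| "effect (While b c) \<sigma> = \<sigma>"

fun safe :: "nat \<Rightarrow> com \<Rightarrow> state \<Rightarrow> bool" where
  "safe W Skip \<sigma> \<longleftrightarrow> True"
| "safe W (Assign x i e) \<sigma> \<longleftrightarrow> expr_fits W i \<sigma> \<and> expr_fits W e \<sigma>"
| "safe W (Seq c d) \<sigma> \<longleftrightarrow> safe W c \<sigma> \<and> safe W d (effect c \<sigma>)"
| "safe W (If b c d) \<sigma> \<longleftrightarrow>
     cond_fits W b \<sigma> \<and> (if cond_val b \<sigma> then safe W c \<sigma> else safe W d \<sigma>)"
| "safe W (While b c) \<sigma> \<longleftrightarrow> False"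

fun cost :: "com \<Rightarrow> nat" where
  "cost Skip = 1"
| "cost (Assign x i e) = 1 + expr_cost i + expr_cost e"
| "cost (Seq c d) = cost c + cost d"
| "cost (If b c d) = 1 + cond_cost b + max (cost c) (cost d)"
| "cost (While b c) = 0"

lemma exec_effect:
  assumes "safe W c \<sigma>"
  obtains t where "exec W c \<sigma> t (effect c \<sigma>)" "t \<le> cost c"
  using assms
proof (induction c arbitrary: \<sigma> thesis)
  case Skip
  from exec.Skip[of W \<sigma>] show ?case by (intro Skip.prems(1)[of 1]) simp_all
next
  case (Assign x i e)
  from exec.Assign[of W i \<sigma> e x] Assign.prems(2) show ?case by (intro Assign.prems(1)) auto
next
  case (Seq c d)
  from Seq.prems(2) have safe: "safe W c \<sigma>" "safe W d (effect c \<sigma>)" by simp_all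
  obtain t where c: "exec W c \<sigma> t (effect c \<sigma>)" "t \<le> cost c" using Seq.IH(1) safe(1) by blast
  obtain u where d: "exec W d (effect c \<sigma>) u (effect d (effect c \<sigma>))" "u \<le> cost d"
    using Seq.IH(2) safe(2) by blast
  show ?case using exec.Seq[OF c(1) d(1)] c(2) d(2) by (intro Seq.prems(1)) auto
next
  case (If b c d)
  show ?case
  proof (cases "cond_val b \<sigma>")
    case True
    with If.prems(2) obtain t where c: "exec W c \<sigma> t (effect c \<sigma>)" "t \<le> cost c"
      using If.IH(1) by auto
    show ?thesis
      using exec.IfTrue[OF _ True c(1), of d] c(2) If.prems(2) True by (intro If.prems(1)) auto
  next
    case False
    with If.prems(2) obtain t where d: "exec W d \<sigma> t (effect d \<sigma>)" "t \<le> cost d"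
      using If.IH(2) by auto
    show ?thesis
      using exec.IfFalse[OF _ False d(1), of c] d(2) If.prems(2) False by (intro If.prems(1)) auto
  qed
qed simp

lemma triple_loop_free:
  assumes "\<And>\<sigma>. bounded_state W \<sigma> \<Longrightarrow> P \<sigma> \<Longrightarrow> safe W c \<sigma> \<and> Q (effect c \<sigma>)"
  shows "triple W P c (cost c) Q"
  unfolding triple_def using assms exec_effect by metis

lemma agree_effect: "agree (writes c) \<sigma> (effect c \<sigma>)"
proof (induction c arbitrary: \<sigma>)
  case (Seq c d)
  then show ?case unfolding agree_def by (metis UnCI effect.simps(3) writes.simps(3))
qed (auto simp: agree_def store_apply)


subsection \<open>Counting loops\<close>

abbreviation Var :: "vname \<Rightarrow> expr" where
  "Var x \<equiv> Cell x (Const 0)"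

abbreviation Put :: "vname \<Rightarrow> expr \<Rightarrow> com" where
  "Put x e \<equiv> Assign x (Const 0) e"

abbreviation Inc :: "vname \<Rightarrow> com" where
  "Inc x \<equiv> Put x (Bin Plus (Var x) (Const 1))"

definition For :: "vname \<Rightarrow> expr \<Rightarrow> com \<Rightarrow> com" where
  "For i e c = Seq (Put i (Const 0)) (While (Less (Var i) e) (Seq c (Inc i)))"

lemma writes_For [simp]: "writes (For i e c) = insert i (writes c)"
  by (simp add: For_def)

lemma triple_Put_Const:
  assumes "0 < W" "k < W" "preserved {x} R"
  shows "triple W R (Put x (Const k)) 3 (\<lambda>\<sigma>. R \<sigma> \<and> \<sigma> x 0 = k)"
proof -
  have "R (store \<sigma> x 0 k)" if "R \<sigma>" for \<sigma>
    using assms(3) that agree_store[of x "{x}" \<sigma> 0 k] by (auto dest: preservedD)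
  then have "triple W R (Put x (Const k)) (cost (Put x (Const k))) (\<lambda>\<sigma>. R \<sigma> \<and> \<sigma> x 0 = k)"
    using assms(1,2) by (intro triple_loop_free) (simp add: store_apply)
  then show ?thesis by (simp add: numeral_eq_Suc)
qed

lemma triple_Inc:
  assumes "Suc k < W" "preserved {x} R"
  shows "triple W (\<lambda>\<sigma>. R \<sigma> \<and> \<sigma> x 0 = k) (Inc x) 6 (\<lambda>\<sigma>. R \<sigma> \<and> \<sigma> x 0 = Suc k)"
proof -
  have "R (store \<sigma> x 0 (Suc k))" if "R \<sigma>" for \<sigma>
    using assms(2) that agree_store[of x "{x}" \<sigma> 0 "Suc k"] by (auto dest: preservedD)
  then have "triple W (\<lambda>\<sigma>. R \<sigma> \<and> \<sigma> x 0 = k) (Inc x) (cost (Inc x)) (\<lambda>\<sigma>. R \<sigma> \<and> \<sigma> x 0 = Suc k)"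
    using assms(1) by (intro triple_loop_free) (simp add: store_apply)
  then show ?thesis by (simp add: numeral_eq_Suc)
qed

lemma triple_For_body:
  assumes "Suc k < W" and i: "i \<notin> writes c"
    and R: "preserved (insert i (writes c)) R" and I: "preserved {i} (I (Suc k))"
    and step: "triple W (\<lambda>\<sigma>. R \<sigma> \<and> I k \<sigma> \<and> \<sigma> i 0 = k) c T (I (Suc k))"
  shows "triple W (\<lambda>\<sigma>. R \<sigma> \<and> I k \<sigma> \<and> \<sigma> i 0 = k) (Seq c (Inc i)) (T + 6)
    (\<lambda>\<sigma>. (R \<sigma> \<and> I (Suc k) \<sigma>) \<and> \<sigma> i 0 = Suc k)"
proof (rule triple_Seq)
  show "triple W (\<lambda>\<sigma>. R \<sigma> \<and> I k \<sigma> \<and> \<sigma> i 0 = k) c T (\<lambda>\<sigma>. (R \<sigma> \<and> I (Suc k) \<sigma>) \<and> \<sigma> i 0 = k)"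
    using step by (rule triple_frame[where R = "\<lambda>\<sigma>. R \<sigma> \<and> \<sigma> i 0 = k"])
      (use i preserved_mono[OF R] in \<open>auto intro!: preserved_intros\<close>)
  have "preserved {i} R" by (rule preserved_mono[OF R]) simp
  then show "triple W (\<lambda>\<sigma>. (R \<sigma> \<and> I (Suc k) \<sigma>) \<and> \<sigma> i 0 = k) (Inc i) 6
      (\<lambda>\<sigma>. (R \<sigma> \<and> I (Suc k) \<sigma>) \<and> \<sigma> i 0 = Suc k)"
    using assms(1) I by (intro triple_Inc preserved_intros)
qed

lemma triple_For:
  fixes B :: "nat \<Rightarrow> nat"
  assumes W: "N < W" "1 < W" and i: "i \<notin> writes c"
    and R: "preserved (insert i (writes c)) R" and I: "\<And>k. preserved {i} (I k)"
    and limit: "\<And>\<sigma>. bounded_state W \<sigma> \<Longrightarrow> R \<sigma> \<Longrightarrow> expr_fits W e \<sigma> \<and> expr_val e \<sigma> = N"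
    and step: "\<And>k. k < N \<Longrightarrow> triple W (\<lambda>\<sigma>. R \<sigma> \<and> I k \<sigma> \<and> \<sigma> i 0 = k) c (B k) (I (Suc k))"
  shows "triple W (\<lambda>\<sigma>. R \<sigma> \<and> I 0 \<sigma>) (For i e c)
    ((\<Sum>k<N. B k + expr_cost e + 10) + expr_cost e + 10) (\<lambda>\<sigma>. R \<sigma> \<and> I N \<sigma>)"
proof -
  define b where "b = Less (Var i) e"
  define \<Phi> where "\<Phi> \<sigma> = (\<Sum>k\<in>{\<sigma> i 0..<N}. B k + expr_cost e + 10)" for \<sigma> :: state
  define J where "J \<sigma> \<longleftrightarrow> R \<sigma> \<and> I (\<sigma> i 0) \<sigma> \<and> \<sigma> i 0 \<le> N" for \<sigma>
  have "preserved {i} (\<lambda>\<sigma>. R \<sigma> \<and> I 0 \<sigma>)" using I preserved_mono[OF R] by (intro preserved_intros) auto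
  with W have "triple W (\<lambda>\<sigma>. R \<sigma> \<and> I 0 \<sigma>) (Put i (Const 0)) 3 (\<lambda>\<sigma>. (R \<sigma> \<and> I 0 \<sigma>) \<and> \<sigma> i 0 = 0)"
    by (intro triple_Put_Const) simp_all
  then have start: "triple W (\<lambda>\<sigma>. R \<sigma> \<and> I 0 \<sigma>) (Put i (Const 0)) 3
      (\<lambda>\<sigma>. J \<sigma> \<and> \<Phi> \<sigma> \<le> (\<Sum>k<N. B k + expr_cost e + 10))"
    by (rule triple_conseq) (auto simp: J_def \<Phi>_def atLeast0LessThan)
  have loop: "triple W (\<lambda>\<sigma>. J \<sigma> \<and> \<Phi> \<sigma> \<le> (\<Sum>k<N. B k + expr_cost e + 10)) (While b (Seq c (Inc i)))
      (1 + cond_cost b + (\<Sum>k<N. B k + expr_cost e + 10)) (\<lambda>\<sigma>. J \<sigma> \<and> \<not> cond_val b \<sigma>)"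
  proof (rule triple_While)
    fix \<sigma> assume \<sigma>: "bounded_state W \<sigma>" "J \<sigma>"
    then show "cond_fits W b \<sigma>" using limit W by (simp add: b_def J_def)
    assume "cond_val b \<sigma>"
    with \<sigma> have k: "\<sigma> i 0 < N" using limit by (simp add: b_def J_def)
    then have \<Phi>: "\<Phi> \<sigma> = B (\<sigma> i 0) + expr_cost e + 10 + \<Phi> \<tau>" if "\<tau> i 0 = Suc (\<sigma> i 0)" for \<tau>
      using that by (simp add: \<Phi>_def sum.atLeast_Suc_lessThan)
    have "Suc (\<sigma> i 0) < W" using k W by simp
    then have "triple W ((=) \<sigma>) (Seq c (Inc i)) (B (\<sigma> i 0) + 6)
        (\<lambda>\<tau>. J \<tau> \<and> 1 + cond_cost b + (B (\<sigma> i 0) + 6) + \<Phi> \<tau> \<le> \<Phi> \<sigma>)"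
      using \<sigma>(2) k by (intro triple_conseq[OF triple_For_body[OF _ i R I step[OF k]]])
        (auto simp: J_def b_def dest!: \<Phi>)
    then show "\<exists>t. triple W ((=) \<sigma>) (Seq c (Inc i)) t
        (\<lambda>\<tau>. J \<tau> \<and> 1 + cond_cost b + t + \<Phi> \<tau> \<le> \<Phi> \<sigma>)" ..
  qed
  show ?thesis
    unfolding For_def b_def[symmetric]
  proof (rule triple_conseq[OF triple_Seq[OF start loop]])
    fix \<sigma> assume "bounded_state W \<sigma>" "J \<sigma> \<and> \<not> cond_val b \<sigma>"
    then show "R \<sigma> \<and> I N \<sigma>" using limit by (auto simp: J_def b_def)
  qed (simp_all add: b_def)
qed

lemma triple_For_loop_free:
  assumes W: "N < W" "1 < W" and i: "i \<notin> writes c"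
    and R: "preserved (insert i (writes c)) R" and I: "\<And>k. preserved {i} (I k)"
    and limit: "\<And>\<sigma>. bounded_state W \<sigma> \<Longrightarrow> R \<sigma> \<Longrightarrow> expr_fits W e \<sigma> \<and> expr_val e \<sigma> = N"
    and step: "\<And>k \<sigma>. k < N \<Longrightarrow> bounded_state W \<sigma> \<Longrightarrow> R \<sigma> \<Longrightarrow> I k \<sigma> \<Longrightarrow> \<sigma> i 0 = k \<Longrightarrow>
      safe W c \<sigma> \<and> I (Suc k) (effect c \<sigma>)"
  shows "triple W (\<lambda>\<sigma>. R \<sigma> \<and> I 0 \<sigma>) (For i e c) ((cost c + expr_cost e + 10) * (N + 1))
    (\<lambda>\<sigma>. R \<sigma> \<and> I N \<sigma>)"
proof -
  have "triple W (\<lambda>\<sigma>. R \<sigma> \<and> I k \<sigma> \<and> \<sigma> i 0 = k) c (cost c) (I (Suc k))" if "k < N" for k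
    using step that by (intro triple_loop_free) blast
  from triple_For[OF W i R I limit this] show ?thesis
    by (rule triple_conseq) (simp_all add: algebra_simps)
qed


section \<open>Reachability avoiding a vertex\<close>

text \<open>False for all \<open>v\<close> if \<open>w = s\<close>.\<close>

definition avoids :: "'a \<Rightarrow> 'a rel \<Rightarrow> 'a \<Rightarrow> 'a \<Rightarrow> bool" where
  "avoids s E w v \<longleftrightarrow> w \<noteq> s \<and> (s, v) \<in> {e \<in> E. snd e \<noteq> w}\<^sup>*"

lemma avoids_start [simp]: "avoids s E w s \<longleftrightarrow> w \<noteq> s"
  by (simp add: avoids_def)

lemma avoids_step: "avoids s E w x \<Longrightarrow> (x, y) \<in> E \<Longrightarrow> y \<noteq> w \<Longrightarrow> avoids s E w y"
  unfolding avoids_def by (auto intro: rtrancl_into_rtrancl)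

lemma avoids_induct [consumes 1, case_names start step]:
  assumes "avoids s E w v"
    and "w \<noteq> s \<Longrightarrow> P s"
    and "\<And>x y. avoids s E w x \<Longrightarrow> P x \<Longrightarrow> (x, y) \<in> E \<Longrightarrow> y \<noteq> w \<Longrightarrow> P y"
  shows "P v"
proof -
  from assms(1) have "w \<noteq> s" and "(s, v) \<in> {e \<in> E. snd e \<noteq> w}\<^sup>*"
    by (auto simp: avoids_def)
  from this(2,1) show ?thesis
  proof (induction rule: rtrancl_induct)
    case (step x y)
    then show ?case using assms(3)[of x y] by (simp add: avoids_def)
  qed (rule assms(2))
qed

lemma avoids_rec:
  "avoids s E w y \<longleftrightarrow> y \<noteq> w \<and> (y = s \<or> (\<exists>x. (x, y) \<in> E \<and> avoids s E w x))"
proof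
  assume "avoids s E w y"
  then show "y \<noteq> w \<and> (y = s \<or> (\<exists>x. (x, y) \<in> E \<and> avoids s E w x))"
    by (induction rule: avoids_induct) auto
qed (auto intro: avoids_step)

lemma not_avoids_self [simp]: "\<not> avoids s E w w"
  using avoids_rec[of s E w w] by simp

lemma avoids_mono: "avoids s E w v \<Longrightarrow> E \<subseteq> E' \<Longrightarrow> avoids s E' w v"
  by (induction rule: avoids_induct) (auto intro: avoids_step)

lemma avoids_split: "avoids s E a c \<Longrightarrow> avoids s E a b \<or> avoids s E b c"
  by (induction rule: avoids_induct) (auto intro: avoids_step)

lemma avoids_iff_reachable:
  assumes "w \<noteq> s" "w \<notin> Range E"
  shows "avoids s E w v \<longleftrightarrow> (s, v) \<in> E\<^sup>*"
proof -
  have "{e \<in> E. snd e \<noteq> w} = E" using assms(2) by (auto simp: Range_iff)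
  then show ?thesis using assms(1) by (simp add: avoids_def)
qed

lemma avoids_unique:
  assumes "wf E" and rec: "\<And>y. P y \<longleftrightarrow> y \<noteq> w \<and> (y = s \<or> (\<exists>x. (x, y) \<in> E \<and> P x))"
  shows "P y \<longleftrightarrow> avoids s E w y"
  using \<open>wf E\<close>
proof (induction y rule: wf_induct_rule)
  case (less y)
  then show ?case by (subst rec, subst avoids_rec) blast
qed

lemma avoids_either:
  assumes "(s, v) \<in> E\<^sup>*" "a \<noteq> b"
    and enter_a: "\<And>x. avoids s E a x \<Longrightarrow> (x, a) \<in> E \<Longrightarrow> avoids s E b a"
    and enter_b: "\<And>x. avoids s E b x \<Longrightarrow> (x, b) \<in> E \<Longrightarrow> avoids s E a b"
  shows "avoids s E a v \<or> avoids s E b v"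
  using assms(1)
proof (induction rule: rtrancl_induct)
  case base
  show ?case using assms(2) by auto
next
  case (step x y)
  then show ?case using enter_a enter_b by (metis avoids_step)
qed

lemma dominator_reachable: "(s, v) \<in> E\<^sup>* \<Longrightarrow> \<not> avoids s E w v \<Longrightarrow> (s, w) \<in> E\<^sup>*"
proof (induction rule: rtrancl_induct)
  case (step x y)
  then show ?case by (metis avoids_step rtrancl.rtrancl_into_rtrancl)
qed simp

lemma dominators_antisym:
  assumes "(s, b) \<in> E\<^sup>*" "\<not> avoids s E a b" "\<not> avoids s E b a"
  shows "a = b"
proof (rule ccontr)
  assume "a \<noteq> b"
  have "avoids s E b a" if "avoids s E a x" "(x, a) \<in> E" for x
    using that assms(2) \<open>a \<noteq> b\<close> by (metis avoids_split avoids_step)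
  moreover have "avoids s E a b" if "avoids s E b x" "(x, b) \<in> E" for x
    using that assms(3) \<open>a \<noteq> b\<close> by (metis avoids_split avoids_step)
  ultimately have "avoids s E a b \<or> avoids s E b b"
    using avoids_either[OF assms(1) \<open>a \<noteq> b\<close>] by blast
  with assms(2) show False by simp
qed

lemma dominators_linear:
  assumes "(s, v) \<in> E\<^sup>*" "\<not> avoids s E a v" "\<not> avoids s E b v"
  shows "\<not> avoids s E a b \<or> \<not> avoids s E b a"
proof (rule ccontr)
  assume "\<not> ?thesis"
  then have "avoids s E a b" "avoids s E b a" by auto
  moreover from this have "a \<noteq> b" by auto
  ultimately have "avoids s E a v \<or> avoids s E b v" using avoids_either[OF assms(1)] by blast
  with assms(2,3) show False by simp
qed


subsection \<open>Forward edges\<close>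

definition forward_edges :: "'a \<Rightarrow> 'a rel \<Rightarrow> 'a rel" where
  "forward_edges s E = {(u, v) \<in> E. avoids s E v u}"

lemma forward_edges_subset: "forward_edges s E \<subseteq> E"
  by (auto simp: forward_edges_def)

lemma forward_edges_neq: "(u, v) \<in> forward_edges s E \<Longrightarrow> v \<noteq> s \<and> u \<noteq> v"
  by (auto simp: forward_edges_def) (simp add: avoids_def)

lemma avoids_Int_forward_edges:
  assumes "E \<subseteq> E0"
  shows "avoids s (E \<inter> forward_edges s E0) w v \<longleftrightarrow> avoids s E w v"
proof
  assume "avoids s E w v"
  then show "avoids s (E \<inter> forward_edges s E0) w v"
  proof (induction rule: avoids_induct)
    case (step x y)
    show ?case
    proof (cases "avoids s E0 y x")
      case True
      with step.hyps assms have "(x, y) \<in> E \<inter> forward_edges s E0"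
        by (auto simp: forward_edges_def)
      with step.IH step.hyps show ?thesis by (blast intro: avoids_step)
    next
      case False
      then have "\<not> avoids s (E \<inter> forward_edges s E0) y x"
        using assms by (blast dest: avoids_mono)
      with avoids_split[OF step.IH, of y] show ?thesis by blast
    qed
  qed simp
qed (blast intro: avoids_mono)

lemma (in flow_graph) flow_graph_delete_edge: "flow_graph (delete_edge G e) s"
  using start_in_verts pair_finite_verts pair_finite_arcs arc_fst_in_verts arc_snd_in_verts
  by unfold_locales (simp_all add: delete_edge_def)

lemma (in flow_graph) avoiding_walk:
  assumes "avoids s (parcs G) w v"
  obtains p where "awalk s p v" "w \<notin> set (awalk_verts s p)"
proof -
  from assms have "\<exists>p. awalk s p v \<and> w \<notin> set (awalk_verts s p)"
  proof (induction rule: avoids_induct)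
    case start
    then show ?case using start_in_verts by (intro exI[of _ "[]"]) (auto simp: awalk_Nil_iff)
  next
    case (step x y)
    then obtain p where p: "awalk s p x" "w \<notin> set (awalk_verts s p)" by blast
    have edge: "awalk x [(x, y)] y"
      using step.hyps by (simp add: awalk_Cons_iff awalk_Nil_iff in_arcsD2)
    have "awalk s (p @ [(x, y)]) y" using awalk_appendI[OF p(1) edge] .
    moreover from this have "w \<notin> set (awalk_verts s (p @ [(x, y)]))"
      using p step.hyps awalk_verts_append edge by auto
    ultimately show ?case by blast
  qed
  with that show thesis by blast
qed

lemma (in flow_graph) awalk_avoids:
  assumes "awalk s p v" "w \<notin> set (awalk_verts s p)"
  shows "avoids s (parcs G) w v"
  using assms
proof (induction p arbitrary: v rule: rev_induct)
  case Nil
  then show ?case by (auto simp: awalk_Nil_iff)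
next
  case (snoc e p)
  then obtain x where x: "awalk s p x" "e = (x, v)" "e \<in> parcs G"
    by (cases e) (auto simp: awalk_append_iff awalk_Cons_iff awalk_Nil_iff)
  then have "w \<notin> set (awalk_verts s p)" "v \<noteq> w"
    using snoc.prems by (auto simp: awalk_verts_append awalk_Cons_iff)
  with snoc.IH[OF x(1)] x show ?case by (auto intro: avoids_step)
qed

lemma (in flow_graph) dominates_iff_not_avoids:
  "dominates G s w v \<longleftrightarrow> \<not> avoids s (parcs G) w v"
  unfolding dominates_def awalk_verts_with_proj_eq using awalk_avoids avoiding_walk by metis

lemma (in flow_graph) reachable_iff_rtrancl: "s \<rightarrow>\<^sup>*\<^bsub>with_proj G\<^esub> v \<longleftrightarrow> (s, v) \<in> (parcs G)\<^sup>*"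
proof -
  have "v \<in> pverts G" if "(s, v) \<in> (parcs G)\<^sup>*"
    using that by (induction rule: rtrancl_induct) (auto intro: start_in_verts in_arcsD2)
  then show ?thesis using start_in_verts by (auto simp: reachable_conv)
qed

lemma (in flow_graph) reducible_entry:
  assumes "reducible G s" "F \<subseteq> parcs G" "x \<in> pverts G"
  obtains v where "(x, v) \<in> F\<^sup>*" "(v, x) \<in> F\<^sup>*"
    and "\<And>u. (x, u) \<in> F\<^sup>* \<Longrightarrow> (u, x) \<in> F\<^sup>* \<Longrightarrow> dominates G s v u"
proof -
  define H where "H = \<lparr>pverts = pverts G, parcs = F\<rparr>"
  have H: "pverts H = pverts G" "parcs H = F" by (simp_all add: H_def)
  interpret H: pair_wf_digraph H
    by unfold_locales
      (simp_all add: H arc_fst_in_verts arc_snd_in_verts subsetD[OF assms(2)])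
  define C where "C = H.scc_of x"
  have "y \<in> pverts G" if "(x, y) \<in> F\<^sup>*" for y
    using that
  proof (induction rule: rtrancl_induct)
    case (step y z)
    with assms(2) have "(y, z) \<in> parcs G" by blast
    then show ?case by (rule in_arcsD2)
  qed (rule assms(3))
  then have C: "y \<in> C \<longleftrightarrow> (x, y) \<in> F\<^sup>* \<and> (y, x) \<in> F\<^sup>*" for y
    using assms(3) by (auto simp: C_def H.scc_of_def H.reachable_conv H)
  have "C \<in> H.sccs_verts"
    unfolding C_def using assms(3) by (intro H.scc_of_in_sccs_verts) (simp add: H)
  then have scc: "with_proj H \<restriction> C \<in> H.sccs" by (rule H.in_verts_sccsD_sccs)
  have "subgraph (with_proj H) (with_proj G)"
    using assms(2) H.wf_digraph_axioms wf_digraph_axioms by (intro subgraphI) (auto simp: H)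
  then have "subgraph (with_proj H \<restriction> C) (with_proj G)"
    using H.in_sccs_imp_induced[OF scc] induced_imp_subgraph subgraph_trans by blast
  moreover have "strongly_connected (with_proj H \<restriction> C)" using scc by (rule H.in_sccsE)
  ultimately have "\<exists>v\<in>verts (with_proj H \<restriction> C). \<forall>u\<in>verts (with_proj H \<restriction> C). dominates G s v u"
    using assms(1)[unfolded reducible_def, rule_format] unfolding dominates_def by blast
  then obtain v where "v \<in> C" "\<And>u. u \<in> C \<Longrightarrow> dominates G s v u" by auto
  with C show thesis by (intro that[of v]) simp_all
qed

lemma (in flow_graph) acyclic_forward_edges:
  assumes "reducible G s"
  shows "acyclic (forward_edges s (parcs G))"
proof (rule acyclicI, rule allI, rule notI)
  define F where "F = forward_edges s (parcs G)"
  have F: "F \<subseteq> parcs G" by (simp add: F_def forward_edges_subset)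
  fix x assume "(x, x) \<in> (forward_edges s (parcs G))\<^sup>+"
  then have cycle: "(x, x) \<in> F\<^sup>+" by (simp add: F_def)
  then obtain y where "(x, y) \<in> parcs G" using F by (blast dest: tranclD)
  then have "x \<in> pverts G" by (rule in_arcsD1)
  with assms F obtain v where v: "(x, v) \<in> F\<^sup>*" "(v, x) \<in> F\<^sup>*"
    and entry: "\<And>u. (x, u) \<in> F\<^sup>* \<Longrightarrow> (u, x) \<in> F\<^sup>* \<Longrightarrow> dominates G s v u"
    by (rule reducible_entry) blast
  have "(v, v) \<in> F\<^sup>+" using v(2) trancl_rtrancl_trancl[OF cycle v(1)] by (rule rtrancl_trancl_trancl)
  then obtain u where u: "(v, u) \<in> F\<^sup>*" "(u, v) \<in> F" by (meson tranclD2)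
  have "dominates G s v u"
    using rtrancl_trans[OF v(1) u(1)] converse_rtrancl_into_rtrancl[OF u(2) v(2)] by (rule entry)
  with u(2) show False by (simp add: dominates_iff_not_avoids F_def forward_edges_def)
qed


section \<open>Immediate dominators\<close>

text \<open>\<open>p\<close> is the immediate dominator of \<open>v\<close> as far as competitors in \<open>S\<close> are concerned.\<close>

definition idom_among :: "'a \<Rightarrow> 'a rel \<Rightarrow> 'a set \<Rightarrow> 'a \<Rightarrow> 'a \<Rightarrow> bool" where
  "idom_among s E S p v \<longleftrightarrow> p \<noteq> v \<and> \<not> avoids s E p v \<and>
     (\<forall>w\<in>S. w \<noteq> v \<and> \<not> avoids s E w v \<longrightarrow> \<not> avoids s E w p)"

lemma idom_among_empty: "v \<noteq> s \<Longrightarrow> idom_among s E {} s v"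
  by (simp add: idom_among_def avoids_def)

lemma idom_among_insert_trivial:
  "idom_among s E S p v \<Longrightarrow> w = v \<or> avoids s E w v \<Longrightarrow> idom_among s E (insert w S) p v"
  by (auto simp: idom_among_def)

lemma idom_among_insert:
  assumes p: "idom_among s E S p v" and v: "(s, v) \<in> E\<^sup>*" and w: "w \<noteq> v" "\<not> avoids s E w v"
  shows "idom_among s E (insert w S) (if avoids s E p w then p else w) v"
proof (cases "avoids s E p w")
  case True
  then have "\<not> avoids s E w p"
    using dominators_linear[OF v w(2), of p] p by (auto simp: idom_among_def)
  with p True show ?thesis by (auto simp: idom_among_def)
next
  case False
  have "\<not> avoids s E u w" if "u \<in> S" "u \<noteq> v" "\<not> avoids s E u v" for u
    using that p False avoids_split[of s E u w p] by (auto simp: idom_among_def)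
  with False w show ?thesis by (auto simp: idom_among_def)
qed

lemma idom_among_antimono:
  assumes "idom_among s E S p v" "E' \<subseteq> E" "\<And>w. w \<in> S' \<Longrightarrow> w \<in> S \<and> (w = v \<or> \<not> avoids s E w v)"
  shows "idom_among s E' S' p v"
proof -
  have "\<not> avoids s E' w u" if "\<not> avoids s E w u" for w u
    using that avoids_mono[OF _ assms(2)] by blast
  with assms(1,3) show ?thesis unfolding idom_among_def by blast
qed

lemma (in flow_graph) immediate_dominator_iff:
  assumes v: "(s, v) \<in> (parcs G)\<^sup>*" "v \<noteq> s" and p: "idom_among s (parcs G) (pverts G) p v"
  shows "immediate_dominator G s d v \<longleftrightarrow> d = p"
proof -
  have above: "\<not> avoids s (parcs G) w p" if w: "\<not> avoids s (parcs G) w v" "w \<noteq> v" for w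
  proof -
    have "w \<in> pverts G"
      using dominator_reachable[OF v(1) w(1)] reachable_in_verts(2) reachable_iff_rtrancl by blast
    with p w show ?thesis by (simp add: idom_among_def)
  qed
  have p_dom: "\<not> avoids s (parcs G) p v" "p \<noteq> v" using p by (simp_all add: idom_among_def)
  show ?thesis
  proof
    assume "d = p"
    with p_dom above show "immediate_dominator G s d v"
      by (simp add: immediate_dominator_def dominates_iff_not_avoids)
  next
    assume d: "immediate_dominator G s d v"
    then have d_dom: "\<not> avoids s (parcs G) d v" "d \<noteq> v"
      by (simp_all add: immediate_dominator_def dominates_iff_not_avoids)
    show "d = p"
    proof (rule ccontr)
      assume "d \<noteq> p"
      with d p_dom have "\<not> avoids s (parcs G) p d"
        by (simp add: immediate_dominator_def dominates_iff_not_avoids)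
      moreover have "\<not> avoids s (parcs G) d p" using above d_dom .
      ultimately have "p = d" using dominators_antisym[OF dominator_reachable[OF v(1) d_dom(1)]] by simp
      with \<open>d \<noteq> p\<close> show False by simp
    qed
  qed
qed

lemma (in flow_graph) dominator_tree_eqI:
  assumes "\<And>v. v \<in> A \<longleftrightarrow> (s, v) \<in> (parcs G)\<^sup>*"
    and "\<And>v. v \<in> A \<Longrightarrow> v \<noteq> s \<Longrightarrow> idom_among s (parcs G) (pverts G) (p v) v"
  shows "dominator_tree G s = \<lparr>pverts = A, parcs = {(p v, v) |v. v \<in> A \<and> v \<noteq> s}\<rparr>"
proof -
  have "{v. (s, v) \<in> (parcs G)\<^sup>*} = A" using assms(1) by blast
  moreover have "{(d, v). (s, v) \<in> (parcs G)\<^sup>* \<and> v \<noteq> s \<and> immediate_dominator G s d v} =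
      {(p v, v) |v. v \<in> A \<and> v \<noteq> s}"
  proof -
    have "(s, v) \<in> (parcs G)\<^sup>* \<and> v \<noteq> s \<and> immediate_dominator G s d v \<longleftrightarrow> v \<in> A \<and> v \<noteq> s \<and> d = p v" for d v
      using assms immediate_dominator_iff[of v "p v" d] by auto
    then show ?thesis by auto
  qed
  ultimately show ?thesis unfolding dominator_tree_def reachable_iff_rtrancl by simp
qed


section \<open>Counting predecessors in the copies\<close>

lemma code_eq_iff:
  fixes u v u' v' k :: nat
  assumes "v < k" "v' < k"
  shows "u * k + v = u' * k + v' \<longleftrightarrow> u = u' \<and> v = v'"
proof
  assume eq: "u * k + v = u' * k + v'"
  have "(u * k + v) div k = u" "(u' * k + v') div k = u'" using assms by auto
  then show "u = u' \<and> v = v'" using eq by auto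
qed simp

definition successors :: "('a \<times> 'b) list \<Rightarrow> 'a \<Rightarrow> 'b list" where
  "successors es u = map snd (filter (\<lambda>e. fst e = u) es)"

lemma successors_Nil [simp]: "successors [] u = []"
  by (simp add: successors_def)

lemma successors_append [simp]: "successors (es @ fs) u = successors es u @ successors fs u"
  by (simp add: successors_def)

lemma successors_Cons [simp]:
  "successors (e # es) u = (if fst e = u then [snd e] else []) @ successors es u"
  by (simp add: successors_def)

lemma set_successors: "set (successors es u) = {v. (u, v) \<in> set es}"
  by (force simp: successors_def)

lemma distinct_successors: "distinct es \<Longrightarrow> distinct (successors es u)"
  by (auto simp: successors_def distinct_map inj_on_def)

lemma length_successors_le: "length (successors es u) \<le> length es"
  using length_filter_le[of "\<lambda>e. fst e = u" es] by (simp add: successors_def)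

lemma sum_length_successors_le:
  "finite A \<Longrightarrow> (\<Sum>u\<in>A. length (successors es u)) \<le> length es"
proof (induction es)
  case (Cons e es)
  have "(\<Sum>u\<in>A. length (successors (e # es) u)) =
      (\<Sum>u\<in>A. if fst e = u then 1 else 0) + (\<Sum>u\<in>A. length (successors es u))"
    unfolding sum.distrib[symmetric] by (rule sum.cong) auto
  also have "(\<Sum>u\<in>A. if fst e = u then 1 else 0) \<le> (1 :: nat)" using Cons.prems by simp
  finally show ?case using Cons by simp
qed simp

locale flow_graph_input =
  fixes n m s W :: nat and as :: "(nat \<times> nat) list"
  assumes start: "s < n" and length_edges: "length as = m"
    and edges_bounded: "set as \<subseteq> {..<n} \<times> {..<n}" and distinct_edges: "distinct as"
    and acyclic_forward: "acyclic (forward_edges s (set as))"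
    and word_size: "(n + 2) * (n + m + 2) < W"
begin

lemma index_less_W:
  "u \<le> n \<Longrightarrow> v \<le> n \<Longrightarrow> u * n + v < W"
  "u \<le> n \<Longrightarrow> u * n < W"
  "u \<le> n \<Longrightarrow> j \<le> m \<Longrightarrow> u * m + j < W"
  "u \<le> n \<Longrightarrow> u * m < W"
  "u \<le> n + 1 \<Longrightarrow> u < W"
  "j \<le> m \<Longrightarrow> j < W"
  "(n + 1) * n + 1 < W"
proof -
  have W: "n * n + n * m + 4 * n + 2 * m + 4 < W" using word_size by (simp add: algebra_simps)
  have rows: "u * n \<le> n * n" "u * m \<le> n * m" if "u \<le> n" using that by simp_all
  show "u * n + v < W" if "u \<le> n" "v \<le> n" using W rows(1)[OF that(1)] that(2) by linarith
  show "u * n < W" if "u \<le> n" using W rows(1)[OF that] by linarith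
  show "u * m + j < W" if "u \<le> n" "j \<le> m" using W rows(2)[OF that(1)] that(2) by linarith
  show "u * m < W" if "u \<le> n" using W rows(2)[OF that] by linarith
  show "u < W" if "u \<le> n + 1" using W that by linarith
  show "j < W" if "j \<le> m" using W that by linarith
  show "(n + 1) * n + 1 < W" using W by (simp add: algebra_simps)
qed

lemma const_less_W [simp]: "0 < W" "Suc 0 < W" "1 < W" "n < W" "m < W" "s < W" "Suc n < W"
  using start by (auto intro: index_less_W)

lemma edge_bounded: "(x, y) \<in> set as \<Longrightarrow> x < n \<and> y < n"
  using edges_bounded by auto

lemma length_successors: "length (successors as u) \<le> m"
  using length_successors_le[of as u] by (simp add: length_edges)

abbreviation F0 :: "nat rel" where
  "F0 \<equiv> forward_edges s (set as)"

lemma F0_subset: "F0 \<subseteq> set as"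
  by (rule forward_edges_subset)

lemma F0_edge: "(x, y) \<in> F0 \<Longrightarrow> x < n \<and> y < n \<and> y \<noteq> s"
  using subsetD[OF F0_subset] edge_bounded[of x y] forward_edges_neq[of x y s] by blast

text \<open>
  The copies \<open>G - w\<close> are numbered \<open>0, \<dots>, n\<close>; since \<open>n\<close> is not a vertex, copy \<open>n\<close> is \<open>G\<close> itself.
  A triple \<open>(w, x, y)\<close> stands for the edge \<open>(x, y)\<close> in copy \<open>w\<close>.
\<close>

definition alive :: "nat rel \<Rightarrow> (nat \<times> nat) set" where
  "alive E = {(w, x). w \<le> n \<and> x < n \<and> avoids s E w x}"

definition alive_edges :: "nat rel \<Rightarrow> (nat \<times> nat \<times> nat) set" where
  "alive_edges E = {(w, x, y). (w, x) \<in> alive E \<and> (x, y) \<in> E}"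

lemma alive_bounds: "(w, x) \<in> alive E \<Longrightarrow> w \<le> n \<and> x < n"
  by (simp add: alive_def)

lemma alive_subset: "alive E \<subseteq> {..n} \<times> {..<n}"
  by (auto simp: alive_def)

lemma finite_alive [simp]: "finite (alive E)"
  using alive_subset by (rule finite_subset) simp

lemma alive_mono: "E' \<subseteq> E \<Longrightarrow> alive E' \<subseteq> alive E"
  by (auto simp: alive_def intro: avoids_mono)

lemma alive_Int_F0: "E \<subseteq> set as \<Longrightarrow> alive (E \<inter> F0) = alive E"
  by (simp add: alive_def avoids_Int_forward_edges)

lemma alive_step: "(w, x) \<in> alive E \<Longrightarrow> (x, y) \<in> E \<Longrightarrow> y < n \<Longrightarrow> y \<noteq> w \<Longrightarrow> (w, y) \<in> alive E"
  by (auto simp: alive_def intro: avoids_step)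

lemma reachable_iff_alive: "E \<subseteq> set as \<Longrightarrow> v < n \<Longrightarrow> (s, v) \<in> E\<^sup>* \<longleftrightarrow> (n, v) \<in> alive E"
  using start edges_bounded avoids_iff_reachable[of n s E v] by (auto simp: alive_def)

lemma alive_edges_mono: "E' \<subseteq> E \<Longrightarrow> alive_edges E' \<subseteq> alive_edges E"
  using alive_mono by (auto simp: alive_edges_def)

lemma finite_alive_edges [simp]: "E \<subseteq> set as \<Longrightarrow> finite (alive_edges E)"
proof (rule finite_subset)
  show "alive_edges E \<subseteq> {..n} \<times> E" by (auto simp: alive_edges_def alive_def)
qed (auto intro: finite_subset)

text \<open>
  The counter of the removed vertex is \<open>0\<close> and that of \<open>s\<close> is \<open>1\<close>, so that in every copy the positive
  counters mark the reachable vertices.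
\<close>

definition in_count :: "(nat \<times> nat \<times> nat) set \<Rightarrow> nat \<Rightarrow> nat \<Rightarrow> nat" where
  "in_count P w y = (if y = w then 0 else if y = s then 1 else card {x. (w, x, y) \<in> P})"

lemma finite_predecessors: "finite P \<Longrightarrow> finite {x. (w, x, y) \<in> P}"
  by (rule finite_subset[of _ "(fst \<circ> snd) ` P"]) force+

lemma in_count_pos_iff:
  "finite P \<Longrightarrow> in_count P w y > 0 \<longleftrightarrow> y \<noteq> w \<and> (y = s \<or> (\<exists>x. (w, x, y) \<in> P))"
  using finite_predecessors[of P w y] by (auto simp: in_count_def card_gt_0_iff)

lemma in_count_insert:
  assumes "finite P" "(w, x, y) \<notin> P" "y \<noteq> s"
  shows "in_count (insert (w, x, y) P) w' y' =
    (if w' = w \<and> y' = y \<and> y \<noteq> w then Suc (in_count P w y) else in_count P w' y')"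
proof (cases "w' = w \<and> y' = y")
  case True
  have "{x'. (w, x', y) \<in> insert (w, x, y) P} = insert x {x'. (w, x', y) \<in> P}" by auto
  with True assms finite_predecessors[OF assms(1), of w y] show ?thesis by (simp add: in_count_def)
next
  case False
  then have "{x'. (w', x', y') \<in> insert (w, x, y) P} = {x'. (w', x', y') \<in> P}" by auto
  with False show ?thesis by (auto simp: in_count_def)
qed

lemma in_count_remove:
  assumes "finite P" "(w, x, y) \<in> P" "y \<noteq> s"
  shows "in_count (P - {(w, x, y)}) w' y' =
    (if w' = w \<and> y' = y then in_count P w y - 1 else in_count P w' y')"
proof (cases "y = w")
  case True
  then have "w' = w \<and> y' = y \<or> y' = w' \<or> {x'. (w', x', y') \<in> P - {(w, x, y)}} = {x'. (w', x', y') \<in> P}"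
    by auto
  with True show ?thesis by (auto simp: in_count_def)
next
  case False
  obtain P' where P': "P = insert (w, x, y) P'" "(w, x, y) \<notin> P'"
    using assms(2) by (rule Set.set_insert)
  with assms(1) have "finite P'" by simp
  from in_count_insert[OF this P'(2) assms(3)] P' False show ?thesis by simp
qed

lemma in_count_le:
  assumes "P \<subseteq> {..n} \<times> {..<n} \<times> UNIV"
  shows "in_count P w y \<le> n"
proof -
  have "card {x. (w, x, y) \<in> P} \<le> card {..<n}" by (rule card_mono) (use assms in auto)
  then show ?thesis using start by (auto simp: in_count_def)
qed

lemma in_count_alive_edges:
  assumes "E \<subseteq> set as" "w \<le> n" "y < n"
  shows "in_count (alive_edges E) w y > 0 \<longleftrightarrow> (w, y) \<in> alive E"
proof -
  have "(w, x, y) \<in> alive_edges E \<longleftrightarrow> (x, y) \<in> E \<and> avoids s E w x" for x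
    using assms edge_bounded[of x y] by (auto simp: alive_edges_def alive_def)
  then show ?thesis
    using in_count_pos_iff[of "alive_edges E" w y] avoids_rec[of s E w y] assms
    by (auto simp: alive_def)
qed

definition counts :: "(nat \<times> nat \<times> nat) set \<Rightarrow> state \<Rightarrow> bool" where
  "counts P \<sigma> \<longleftrightarrow> (\<forall>w\<le>n. \<forall>y<n. \<sigma> ''count'' (w * n + y) = in_count P w y)"

definition counters_mark :: "(nat \<times> nat) set \<Rightarrow> state \<Rightarrow> bool" where
  "counters_mark A \<sigma> \<longleftrightarrow> (\<forall>w\<le>n. \<forall>y<n. \<sigma> ''count'' (w * n + y) > 0 \<longleftrightarrow> (w, y) \<in> A)"

lemma counters_mark_zero:
  "counters_mark A \<sigma> \<Longrightarrow> w \<le> n \<Longrightarrow> y < n \<Longrightarrow> \<sigma> ''count'' (w * n + y) = 0 \<longleftrightarrow> (w, y) \<notin> A"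
  by (metis counters_mark_def neq0_conv)

lemma preserved_counts [preserved_intros]: "''count'' \<notin> X \<Longrightarrow> preserved X (counts P)"
  by (simp add: preserved_def agree_def counts_def)

lemma preserved_counters_mark [preserved_intros]:
  "''count'' \<notin> X \<Longrightarrow> preserved X (counters_mark A)"
  by (simp add: preserved_def agree_def counters_mark_def)

lemma counts_alive_edges:
  "E \<subseteq> set as \<Longrightarrow> counts (alive_edges E) \<sigma> \<Longrightarrow> counters_mark (alive E) \<sigma>"
  by (simp add: counts_def counters_mark_def in_count_alive_edges)

text \<open>Self-consistent counters are correct because the forward edges are acyclic.\<close>

lemma counters_mark_alive:
  assumes "F \<subseteq> F0"
    and counts: "counts {(w, x, y). w \<le> n \<and> (x, y) \<in> F \<and> \<sigma> ''count'' (w * n + x) > 0} \<sigma>"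
  shows "counters_mark (alive F) \<sigma>"
  unfolding counters_mark_def
proof (intro allI impI)
  fix w y assume w: "w \<le> n" and "y < n"
  define P where "P = {(w, x, y). w \<le> n \<and> (x, y) \<in> F \<and> \<sigma> ''count'' (w * n + x) > 0}"
  have bounded: "x < n" "y < n" if "(x, y) \<in> F" for x y
    using F0_edge[of x y] that assms(1) by blast+
  have "finite F" using assms(1) F0_subset by (meson finite_set finite_subset)
  then have "finite P" by (intro finite_subset[of P "{..n} \<times> F"]) (auto simp: P_def)
  have "wf F"
    using \<open>finite F\<close> acyclic_subset[OF acyclic_forward assms(1)] by (rule finite_acyclic_wf)
  moreover have "y < n \<and> \<sigma> ''count'' (w * n + y) > 0 \<longleftrightarrow>
      y \<noteq> w \<and> (y = s \<or> (\<exists>x. (x, y) \<in> F \<and> x < n \<and> \<sigma> ''count'' (w * n + x) > 0))" for y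
  proof (cases "y < n")
    case True
    then have "\<sigma> ''count'' (w * n + y) = in_count P w y" using counts w by (simp add: counts_def P_def)
    with True w show ?thesis
      using in_count_pos_iff[OF \<open>finite P\<close>, of w y] bounded by (auto simp: P_def)
  next
    case False
    then show ?thesis using start bounded by blast
  qed
  ultimately have "y < n \<and> \<sigma> ''count'' (w * n + y) > 0 \<longleftrightarrow> avoids s F w y"
    by (rule avoids_unique)
  with w \<open>y < n\<close> show "\<sigma> ''count'' (w * n + y) > 0 \<longleftrightarrow> (w, y) \<in> alive F"
    by (simp add: alive_def)
qed

definition bit_matrix :: "vname \<Rightarrow> (nat \<times> nat) set \<Rightarrow> state \<Rightarrow> bool" where
  "bit_matrix x A \<sigma> \<longleftrightarrow> (\<forall>u\<le>n. \<forall>v<n. \<sigma> x (u * n + v) = of_bool ((u, v) \<in> A))"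

lemma preserved_bit_matrix [preserved_intros]: "x \<notin> X \<Longrightarrow> preserved X (bit_matrix x A)"
  by (simp add: preserved_def agree_def bit_matrix_def)

lemma bit_matrix_insert:
  assumes "bit_matrix x A \<sigma>" "\<tau> x = (\<sigma> x)(u * n + v := 1)" "v < n"
  shows "bit_matrix x (insert (u, v) A) \<tau>"
  using assms code_eq_iff[OF _ assms(3)] by (auto simp: bit_matrix_def)

lemma bit_matrix_remove:
  assumes "bit_matrix x A \<sigma>" "\<tau> x = (\<sigma> x)(u * n + v := 0)" "v < n"
  shows "bit_matrix x (A - {(u, v)}) \<tau>"
  using assms code_eq_iff[OF _ assms(3)] by (auto simp: bit_matrix_def)


subsection \<open>Time bounds\<close>

definition weight :: "nat \<Rightarrow> nat \<times> nat \<Rightarrow> nat" where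
  "weight B p = (B + 60) * (length (successors as (snd p)) + 1)"

lemma card_avoids_le:
  assumes "E \<subseteq> set as"
  shows "card {x. x < n \<and> avoids s E w x} \<le> m + 1"
proof -
  have "{x. x < n \<and> avoids s E w x} \<subseteq> insert s (snd ` set as)"
  proof
    fix x assume "x \<in> {x. x < n \<and> avoids s E w x}"
    then consider "x = s" | y where "(y, x) \<in> E" using avoids_rec[of s E w x] by blast
    then show "x \<in> insert s (snd ` set as)" using assms by cases force+
  qed
  then have "card {x. x < n \<and> avoids s E w x} \<le> card (insert s (snd ` set as))"
    by (rule card_mono[rotated]) simp
  also have "\<dots> \<le> Suc (card (snd ` set as))" by (rule card_insert_le_m1) simp_all
  also have "card (snd ` set as) \<le> m"
    using card_image_le[of "set as" snd] card_length[of as] length_edges by simp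
  finally show ?thesis by simp
qed

lemma sum_weight_alive_le:
  assumes "E \<subseteq> set as"
  shows "(\<Sum>p\<in>alive E. weight B p + c) \<le> (2 * B + 120 + c) * ((n + 1) * (m + 1))"
proof -
  have row: "(\<Sum>x\<in>{x. x < n \<and> avoids s E w x}. weight B (w, x) + c) \<le> (2 * B + 120 + c) * (m + 1)" for w
  proof -
    define X where "X = {x. x < n \<and> avoids s E w x}"
    have "finite X" by (simp add: X_def)
    have "(\<Sum>x\<in>X. weight B (w, x) + c) =
        (B + 60) * (\<Sum>x\<in>X. length (successors as x)) + (B + 60 + c) * card X"
      by (simp add: weight_def sum.distrib algebra_simps flip: sum_distrib_left sum_distrib_right)
    also have "\<dots> \<le> (B + 60) * m + (B + 60 + c) * (m + 1)"
      using card_avoids_le[OF assms, of w] sum_length_successors_le[OF \<open>finite X\<close>, of as]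
      by (intro add_mono mult_le_mono2) (simp_all add: X_def length_edges)
    also have "\<dots> \<le> (2 * B + 120 + c) * (m + 1)" by (simp add: algebra_simps)
    finally show ?thesis by (simp add: X_def)
  qed
  have "alive E = Sigma {..n} (\<lambda>w. {x. x < n \<and> avoids s E w x})" by (auto simp: alive_def)
  then have "(\<Sum>p\<in>alive E. weight B p + c) =
      (\<Sum>w\<le>n. \<Sum>x\<in>{x. x < n \<and> avoids s E w x}. weight B (w, x) + c)"
    by (simp add: sum.Sigma)
  also have "\<dots> \<le> (\<Sum>w\<le>n. (2 * B + 120 + c) * (m + 1))" by (rule sum_mono) (rule row)
  finally show ?thesis by (simp add: algebra_simps)
qed


subsection \<open>Memory layout\<close>

definition header :: "state \<Rightarrow> bool" where
  "header \<sigma> \<longleftrightarrow> \<sigma> ''n'' 0 = n \<and> \<sigma> ''m'' 0 = m \<and> \<sigma> ''s'' 0 = s"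

definition edge_arrays :: "state \<Rightarrow> bool" where
  "edge_arrays \<sigma> \<longleftrightarrow> (\<forall>i<m. (\<sigma> ''tail'' i, \<sigma> ''head'' i) = as ! i)"

definition adjacency :: "(nat \<times> nat) list \<Rightarrow> state \<Rightarrow> bool" where
  "adjacency es \<sigma> \<longleftrightarrow> (\<forall>u<n. \<sigma> ''deg'' u = length (successors es u) \<and>
     (\<forall>j<length (successors es u). \<sigma> ''adj'' (u * m + j) = successors es u ! j))"

lemma preserved_header [preserved_intros]:
  "''n'' \<notin> X \<Longrightarrow> ''m'' \<notin> X \<Longrightarrow> ''s'' \<notin> X \<Longrightarrow> preserved X header"
  by (simp add: preserved_def agree_def header_def)

lemma preserved_edge_arrays [preserved_intros]:
  "''tail'' \<notin> X \<Longrightarrow> ''head'' \<notin> X \<Longrightarrow> preserved X edge_arrays"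
  by (simp add: preserved_def agree_def edge_arrays_def)

lemma preserved_adjacency [preserved_intros]:
  "''deg'' \<notin> X \<Longrightarrow> ''adj'' \<notin> X \<Longrightarrow> preserved X (adjacency es)"
  by (simp add: preserved_def agree_def adjacency_def)

end


section \<open>A work list over pairs of vertices\<close>

text \<open>An entry \<open>(w, x)\<close> says that the status of \<open>x\<close> in the copy \<open>G - w\<close> has changed.\<close>

definition queue :: "state \<Rightarrow> (nat \<times> nat) list" where
  "queue \<sigma> = map (\<lambda>i. (\<sigma> ''queue_copy'' i, \<sigma> ''queue_vertex'' i)) [0..<\<sigma> ''queue_len'' 0]"

definition push :: com where
  "push =
     Seq (Assign ''queue_copy'' (Var ''queue_len'') (Var ''w''))
    (Seq (Assign ''queue_vertex'' (Var ''queue_len'') (Var ''y''))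
         (Inc ''queue_len''))"

definition pop :: com where
  "pop =
     Seq (Put ''w'' (Cell ''queue_copy'' (Var ''queue_pos'')))
    (Seq (Put ''x'' (Cell ''queue_vertex'' (Var ''queue_pos'')))
         (Inc ''queue_pos''))"

definition load_successor :: com where
  "load_successor =
     Put ''y'' (Cell ''adj'' (Bin Plus (Bin Times (Var ''x'') (Var ''m'')) (Var ''j'')))"

definition scan :: "com \<Rightarrow> com" where
  "scan body = For ''j'' (Cell ''deg'' (Var ''x'')) (Seq load_successor body)"

definition pending :: cond where
  "pending = Less (Var ''queue_pos'') (Var ''queue_len'')"

definition worklist :: "com \<Rightarrow> com" where
  "worklist body = Seq (Put ''queue_pos'' (Const 0)) (While pending (Seq pop (scan body)))"

definition worklist_control :: "vname set" where
  "worklist_control = {''queue_pos'', ''j'', ''w'', ''x'', ''y''}"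

lemma length_queue [simp]: "length (queue \<sigma>) = \<sigma> ''queue_len'' 0"
  by (simp add: queue_def)

lemma nth_queue: "i < \<sigma> ''queue_len'' 0 \<Longrightarrow> queue \<sigma> ! i = (\<sigma> ''queue_copy'' i, \<sigma> ''queue_vertex'' i)"
  by (simp add: queue_def)

lemma queue_cong:
  assumes "agree X \<sigma> \<tau>" "''queue_copy'' \<notin> X" "''queue_vertex'' \<notin> X" "''queue_len'' \<notin> X"
  shows "queue \<tau> = queue \<sigma>"
  using assms by (simp add: agree_def queue_def)

lemma preserved_queue [preserved_intros]:
  "''queue_copy'' \<notin> X \<Longrightarrow> ''queue_vertex'' \<notin> X \<Longrightarrow> ''queue_len'' \<notin> X \<Longrightarrow>
    preserved X (\<lambda>\<sigma>. queue \<sigma> = q)"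
  by (simp add: preserved_def queue_cong)

lemma preserved_prefix_queue [preserved_intros]:
  "''queue_copy'' \<notin> X \<Longrightarrow> ''queue_vertex'' \<notin> X \<Longrightarrow> ''queue_len'' \<notin> X \<Longrightarrow>
    preserved X (\<lambda>\<sigma>. prefix q (queue \<sigma>))"
  by (simp add: preserved_def queue_cong)

lemma queue_push: "queue (effect push \<sigma>) = queue \<sigma> @ [(\<sigma> ''w'' 0, \<sigma> ''y'' 0)]"
  by (simp add: queue_def push_def store_apply)

lemma writes_push [simp]: "writes push = {''queue_copy'', ''queue_vertex'', ''queue_len''}"
  by (auto simp: push_def)

lemma safe_push: "bounded_state W \<sigma> \<Longrightarrow> \<sigma> ''queue_len'' 0 + 1 < W \<Longrightarrow> safe W push \<sigma>"
  by (simp add: push_def store_apply bounded_stateD)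

lemma writes_worklist: "writes (worklist body) = worklist_control \<union> writes body"
  by (auto simp: worklist_def scan_def pop_def load_successor_def worklist_control_def)

context flow_graph_input
begin

lemma queue_len_less:
  assumes "distinct (queue \<sigma>)" "set (queue \<sigma>) \<subseteq> {..n} \<times> {..<n}"
  shows "\<sigma> ''queue_len'' 0 + 1 < W"
proof -
  have "\<sigma> ''queue_len'' 0 = card (set (queue \<sigma>))" using distinct_card[OF assms(1)] by simp
  also have "\<dots> \<le> card ({..n} \<times> {..<n})" using assms(2) by (intro card_mono) auto
  also have "\<dots> = (n + 1) * n" by (simp add: card_cartesian_product)
  finally show ?thesis using index_less_W(7) by linarith
qed

definition out_edges :: "(nat \<times> nat) set \<Rightarrow> (nat \<times> nat \<times> nat) set" where
  "out_edges Q = {(w, x, y). (w, x) \<in> Q \<and> (x, y) \<in> set as}"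

lemma out_edges_empty [simp]: "out_edges {} = {}"
  by (simp add: out_edges_def)

end

locale worklist_invariant = flow_graph_input +
  fixes body :: com and U :: "(nat \<times> nat) set"
    and R :: "state \<Rightarrow> bool" and Inv :: "(nat \<times> nat \<times> nat) set \<Rightarrow> state \<Rightarrow> bool"
  assumes body_control: "writes body \<inter> worklist_control = {}"
    and domain: "U \<subseteq> {..n} \<times> {..<n}"
    and context_layout: "R \<sigma> \<Longrightarrow> header \<sigma> \<and> adjacency as \<sigma>"
    and context_preserved: "preserved (worklist_control \<union> writes body) R"
    and inv_preserved: "preserved worklist_control (Inv D)"
    and inv_queue: "Inv D \<sigma> \<Longrightarrow> distinct (queue \<sigma>) \<and> set (queue \<sigma>) \<subseteq> U"
    and body_correct: "bounded_state W \<sigma> \<Longrightarrow> R \<sigma> \<Longrightarrow> Inv D \<sigma> \<Longrightarrow>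
      \<sigma> ''w'' 0 = w \<Longrightarrow> \<sigma> ''x'' 0 = x \<Longrightarrow> \<sigma> ''y'' 0 = y \<Longrightarrow>
      (w, x) \<in> set (queue \<sigma>) \<Longrightarrow> (x, y) \<in> set as \<Longrightarrow> (w, x, y) \<notin> D \<Longrightarrow>
      safe W body \<sigma> \<and> prefix (queue \<sigma>) (queue (effect body \<sigma>)) \<and>
        Inv (insert (w, x, y) D) (effect body \<sigma>)"
begin

definition partial_out_edges :: "(nat \<times> nat) set \<Rightarrow> nat \<Rightarrow> nat \<Rightarrow> nat \<Rightarrow> (nat \<times> nat \<times> nat) set" where
  "partial_out_edges Q w x j = out_edges Q \<union> {(w, x, y) |y. y \<in> set (take j (successors as x))}"

lemma partial_out_edges_0: "partial_out_edges Q w x 0 = out_edges Q"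
  by (simp add: partial_out_edges_def)

lemma partial_out_edges_Suc:
  "j < length (successors as x) \<Longrightarrow>
    partial_out_edges Q w x (Suc j) = insert (w, x, successors as x ! j) (partial_out_edges Q w x j)"
  by (auto simp: partial_out_edges_def take_Suc_conv_app_nth)

lemma partial_out_edges_all:
  "partial_out_edges Q w x (length (successors as x)) = out_edges (insert (w, x) Q)"
  by (auto simp: partial_out_edges_def out_edges_def set_successors)

lemma next_edge_new:
  assumes "(w, x) \<notin> Q" "j < length (successors as x)"
  shows "(w, x, successors as x ! j) \<notin> partial_out_edges Q w x j"
proof -
  have "successors as x ! j \<notin> set (take j (successors as x))"
    using assms(2) nth_eq_iff_index_eq[OF distinct_successors[OF distinct_edges, of x]]
    by (auto simp: in_set_conv_nth)
  with assms(1) show ?thesis by (auto simp: partial_out_edges_def out_edges_def)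
qed

lemma scan_step:
  assumes "(w, x) \<in> set q" "(w, x) \<notin> Q" "x < n" "j < length (successors as x)"
    and \<sigma>: "bounded_state W \<sigma>" "R \<sigma>" "\<sigma> ''w'' 0 = w" "\<sigma> ''x'' 0 = x" "\<sigma> ''j'' 0 = j"
    and inv: "Inv (partial_out_edges Q w x j) \<sigma>" "prefix q (queue \<sigma>)"
  defines "c \<equiv> Seq load_successor body"
  shows "safe W c \<sigma> \<and> Inv (partial_out_edges Q w x (Suc j)) (effect c \<sigma>) \<and> prefix q (queue (effect c \<sigma>))"
proof -
  define y where "y = successors as x ! j"
  define \<tau> where "\<tau> = store \<sigma> ''y'' 0 y"
  have "j < m" using assms(4) length_successors[of x] by simp
  have adj: "\<sigma> ''adj'' (x * m + j) = y" and m: "\<sigma> ''m'' 0 = m"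
    using context_layout[OF \<sigma>(2)] assms(3,4) by (simp_all add: adjacency_def header_def y_def)
  have "(x, y) \<in> set as" using set_successors[of as x] nth_mem[OF assms(4)] by (simp add: y_def)
  then have "y < n" using edge_bounded by simp
  have load: "effect load_successor \<sigma> = \<tau>" "safe W load_successor \<sigma>"
    using adj m \<sigma>(4,5) \<open>j < m\<close> \<open>x < n\<close> \<open>y < n\<close>
    by (simp_all add: load_successor_def \<tau>_def index_less_W)
  have agree: "agree {''y''} \<sigma> \<tau>" unfolding \<tau>_def by (simp add: agree_store)
  then have queue: "queue \<tau> = queue \<sigma>" by (rule queue_cong) simp_all
  have "agree worklist_control \<sigma> \<tau>" "agree (worklist_control \<union> writes body) \<sigma> \<tau>"
    using agree by (auto intro: agree_mono simp: worklist_control_def)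
  then have "Inv (partial_out_edges Q w x j) \<tau>" "R \<tau>"
    using inv_preserved context_preserved inv(1) \<sigma>(2) by (blast dest: preservedD)+
  moreover have "bounded_state W \<tau>"
    using \<sigma>(1) \<open>y < n\<close> unfolding \<tau>_def by (intro bounded_state_store) (auto intro: index_less_W)
  moreover have "(w, x) \<in> set (queue \<tau>)" using assms(1) inv(2) queue set_mono_prefix by fastforce
  ultimately have "safe W body \<tau> \<and> prefix (queue \<tau>) (queue (effect body \<tau>)) \<and>
      Inv (insert (w, x, y) (partial_out_edges Q w x j)) (effect body \<tau>)"
    using \<sigma>(3,4) \<open>(x, y) \<in> set as\<close> next_edge_new[OF assms(2,4)]
    by (intro body_correct) (simp_all add: \<tau>_def store_apply y_def)
  then show ?thesis
    using load inv(2) queue partial_out_edges_Suc[OF assms(4), of Q w]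
    by (auto simp: c_def y_def intro: prefix_order.trans)
qed

lemma scan_correct:
  assumes "(w, x) \<in> set q" "(w, x) \<notin> Q" "x < n"
  shows "triple W
    (\<lambda>\<sigma>. R \<sigma> \<and> \<sigma> ''w'' 0 = w \<and> \<sigma> ''x'' 0 = x \<and> Inv (out_edges Q) \<sigma> \<and> prefix q (queue \<sigma>))
    (scan body) ((cost body + 24) * (length (successors as x) + 1))
    (\<lambda>\<sigma>. R \<sigma> \<and> Inv (out_edges (insert (w, x) Q)) \<sigma> \<and> prefix q (queue \<sigma>))"
proof -
  define R' where "R' \<sigma> \<longleftrightarrow> R \<sigma> \<and> \<sigma> ''w'' 0 = w \<and> \<sigma> ''x'' 0 = x" for \<sigma>
  define I where "I j \<sigma> \<longleftrightarrow> Inv (partial_out_edges Q w x j) \<sigma> \<and> prefix q (queue \<sigma>)" for j \<sigma>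
  have "triple W (\<lambda>\<sigma>. R' \<sigma> \<and> I 0 \<sigma>) (scan body)
      ((cost (Seq load_successor body) + expr_cost (Cell ''deg'' (Var ''x'')) + 10) *
        (length (successors as x) + 1))
      (\<lambda>\<sigma>. R' \<sigma> \<and> I (length (successors as x)) \<sigma>)"
    unfolding scan_def
  proof (rule triple_For_loop_free)
    show "length (successors as x) < W" using length_successors[of x] by (intro index_less_W)
    show "''j'' \<notin> writes (Seq load_successor body)"
      using body_control by (auto simp: load_successor_def worklist_control_def)
    show "preserved (insert ''j'' (writes (Seq load_successor body))) R'"
      unfolding R'_def using body_control
      by (intro preserved_intros preserved_mono[OF context_preserved])
        (auto simp: load_successor_def worklist_control_def)
    show "preserved {''j''} (I k)" for k
      unfolding I_def
      by (intro preserved_intros preserved_mono[OF inv_preserved]) (simp_all add: worklist_control_def)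
  next
    fix \<sigma> assume "bounded_state W \<sigma>" "R' \<sigma>"
    then show "expr_fits W (Cell ''deg'' (Var ''x'')) \<sigma> \<and>
        expr_val (Cell ''deg'' (Var ''x'')) \<sigma> = length (successors as x)"
      using assms(3) context_layout[of \<sigma>] length_successors[of x]
      by (simp add: R'_def adjacency_def index_less_W)
  next
    fix j \<sigma>
    assume "j < length (successors as x)" "bounded_state W \<sigma>" "R' \<sigma>" "I j \<sigma>" "\<sigma> ''j'' 0 = j"
    then show "safe W (Seq load_successor body) \<sigma> \<and> I (Suc j) (effect (Seq load_successor body) \<sigma>)"
      unfolding R'_def I_def using scan_step[OF assms] by blast
  qed simp
  then show ?thesis
    by (rule triple_conseq)
      (auto simp: R'_def I_def partial_out_edges_0 partial_out_edges_all load_successor_def)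
qed

lemma pop_correct:
  assumes "bounded_state W \<sigma>" "R \<sigma>" "Inv D \<sigma>" "\<sigma> ''queue_pos'' 0 < \<sigma> ''queue_len'' 0"
    and "queue \<sigma> ! \<sigma> ''queue_pos'' 0 = (w, x)"
  shows "triple W ((=) \<sigma>) pop (cost pop) (\<lambda>\<tau>. (R \<tau> \<and> \<tau> ''w'' 0 = w \<and> \<tau> ''x'' 0 = x \<and> Inv D \<tau> \<and>
    prefix (queue \<sigma>) (queue \<tau>)) \<and> \<tau> ''queue_pos'' 0 = Suc (\<sigma> ''queue_pos'' 0))"
proof (rule triple_loop_free, elim subst)
  have wx: "\<sigma> ''queue_copy'' (\<sigma> ''queue_pos'' 0) = w" "\<sigma> ''queue_vertex'' (\<sigma> ''queue_pos'' 0) = x"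
    using assms(4,5) by (simp_all add: nth_queue)
  have "Suc (\<sigma> ''queue_pos'' 0) < W"
    using assms(4) bounded_stateD[OF assms(1), of "''queue_len''" 0] by simp
  then have "safe W pop \<sigma>" using assms(1) by (simp add: pop_def store_apply bounded_stateD)
  moreover have agree: "agree {''w'', ''x'', ''queue_pos''} \<sigma> (effect pop \<sigma>)"
    using agree_effect[of pop \<sigma>] by (simp add: pop_def insert_commute)
  then have "agree worklist_control \<sigma> (effect pop \<sigma>)"
    "agree (worklist_control \<union> writes body) \<sigma> (effect pop \<sigma>)"
    by (auto intro: agree_mono simp: worklist_control_def)
  then have "R (effect pop \<sigma>)" "Inv D (effect pop \<sigma>)"
    using inv_preserved context_preserved assms(2,3) by (blast dest: preservedD)+
  moreover have "queue (effect pop \<sigma>) = queue \<sigma>" using agree by (rule queue_cong) simp_all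
  ultimately show "safe W pop \<sigma> \<and> (R (effect pop \<sigma>) \<and> effect pop \<sigma> ''w'' 0 = w \<and>
      effect pop \<sigma> ''x'' 0 = x \<and> Inv D (effect pop \<sigma>) \<and> prefix (queue \<sigma>) (queue (effect pop \<sigma>))) \<and>
      effect pop \<sigma> ''queue_pos'' 0 = Suc (\<sigma> ''queue_pos'' 0)"
    using wx by (simp add: pop_def store_apply)
qed

definition popped :: "state \<Rightarrow> (nat \<times> nat) set" where
  "popped \<sigma> = set (take (\<sigma> ''queue_pos'' 0) (queue \<sigma>))"

definition loop_inv :: "state \<Rightarrow> bool" where
  "loop_inv \<sigma> \<longleftrightarrow> R \<sigma> \<and> Inv (out_edges (popped \<sigma>)) \<sigma> \<and> \<sigma> ''queue_pos'' 0 \<le> \<sigma> ''queue_len'' 0"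

definition pending_weight :: "state \<Rightarrow> nat" where
  "pending_weight \<sigma> = sum (weight (cost body)) (U - popped \<sigma>)"

lemma next_entry:
  assumes "loop_inv \<sigma>" "cond_val pending \<sigma>"
  obtains w x where "queue \<sigma> ! \<sigma> ''queue_pos'' 0 = (w, x)" "(w, x) \<in> set (queue \<sigma>)"
    "(w, x) \<in> U" "(w, x) \<notin> popped \<sigma>"
proof -
  define k where "k = \<sigma> ''queue_pos'' 0"
  obtain w x where wx: "queue \<sigma> ! k = (w, x)" by fastforce
  have queue: "distinct (queue \<sigma>)" "set (queue \<sigma>) \<subseteq> U"
    using inv_queue assms(1) by (auto simp: loop_inv_def)
  have k: "k < length (queue \<sigma>)" using assms(2) by (simp add: pending_def k_def)
  then have "(w, x) \<in> set (queue \<sigma>)" using wx nth_mem by metis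
  moreover have "(w, x) \<notin> popped \<sigma>"
  proof
    assume "(w, x) \<in> popped \<sigma>"
    then obtain i where "i < k" "queue \<sigma> ! i = (w, x)"
      by (auto simp: popped_def k_def in_set_conv_nth)
    with k wx nth_eq_iff_index_eq[OF queue(1), of i k] show False by simp
  qed
  ultimately show thesis using that wx queue(2) unfolding k_def by blast
qed

lemma popped_Suc:
  assumes "prefix (queue \<sigma>) (queue \<tau>)" "\<tau> ''queue_pos'' 0 = Suc (\<sigma> ''queue_pos'' 0)"
    and "cond_val pending \<sigma>" "queue \<sigma> ! \<sigma> ''queue_pos'' 0 = p"
  shows "popped \<tau> = insert p (popped \<sigma>) \<and> \<tau> ''queue_pos'' 0 \<le> \<tau> ''queue_len'' 0"
proof -
  define k where "k = \<sigma> ''queue_pos'' 0"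
  have k: "k < length (queue \<sigma>)" using assms(3) by (simp add: pending_def k_def)
  obtain r where r: "queue \<tau> = queue \<sigma> @ r" using assms(1) by (rule prefixE)
  have "take (Suc k) (queue \<tau>) = take k (queue \<sigma>) @ [p]"
    using k assms(4) by (simp add: r k_def take_Suc_conv_app_nth)
  moreover have "Suc k \<le> length (queue \<tau>)" using k by (simp add: r del: length_queue)
  ultimately show ?thesis using assms(2) by (simp add: popped_def k_def)
qed

lemma pop_scan_correct:
  assumes "bounded_state W \<sigma>" "loop_inv \<sigma>" "cond_val pending \<sigma>"
    and wx: "queue \<sigma> ! \<sigma> ''queue_pos'' 0 = (w, x)" "(w, x) \<in> set (queue \<sigma>)"
      "(w, x) \<in> U" "(w, x) \<notin> popped \<sigma>"
  shows "triple W ((=) \<sigma>) (Seq pop (scan body))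
    (cost pop + (cost body + 24) * (length (successors as x) + 1))
    (\<lambda>\<tau>. (R \<tau> \<and> Inv (out_edges (insert (w, x) (popped \<sigma>))) \<tau> \<and> prefix (queue \<sigma>) (queue \<tau>)) \<and>
      \<tau> ''queue_pos'' 0 = Suc (\<sigma> ''queue_pos'' 0))"
proof (rule triple_Seq)
  define k where "k = \<sigma> ''queue_pos'' 0"
  show "triple W ((=) \<sigma>) pop (cost pop) (\<lambda>\<tau>. (R \<tau> \<and> \<tau> ''w'' 0 = w \<and> \<tau> ''x'' 0 = x \<and>
      Inv (out_edges (popped \<sigma>)) \<tau> \<and> prefix (queue \<sigma>) (queue \<tau>)) \<and> \<tau> ''queue_pos'' 0 = Suc k)"
    using pop_correct[OF assms(1) _ _ _ wx(1)] assms(2,3)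
    by (simp add: loop_inv_def pending_def k_def)
  have "x < n" using wx(3) domain by auto
  have "preserved (writes (scan body)) (\<lambda>\<tau>. \<tau> ''queue_pos'' 0 = Suc k)"
    using body_control
    by (intro preserved_intros) (auto simp: scan_def load_successor_def worklist_control_def)
  with scan_correct[OF wx(2,4) \<open>x < n\<close>]
  show "triple W (\<lambda>\<tau>. (R \<tau> \<and> \<tau> ''w'' 0 = w \<and> \<tau> ''x'' 0 = x \<and> Inv (out_edges (popped \<sigma>)) \<tau> \<and>
      prefix (queue \<sigma>) (queue \<tau>)) \<and> \<tau> ''queue_pos'' 0 = Suc k) (scan body)
    ((cost body + 24) * (length (successors as x) + 1))
    (\<lambda>\<tau>. (R \<tau> \<and> Inv (out_edges (insert (w, x) (popped \<sigma>))) \<tau> \<and> prefix (queue \<sigma>) (queue \<tau>)) \<and>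
      \<tau> ''queue_pos'' 0 = Suc (\<sigma> ''queue_pos'' 0))"
    by (rule triple_frame) (auto simp: k_def)
qed

lemma loop_step:
  assumes "bounded_state W \<sigma>" "loop_inv \<sigma>" "cond_val pending \<sigma>"
  shows "\<exists>t. triple W ((=) \<sigma>) (Seq pop (scan body)) t
    (\<lambda>\<tau>. loop_inv \<tau> \<and> 1 + cond_cost pending + t + pending_weight \<tau> \<le> pending_weight \<sigma>)"
proof -
  obtain w x where wx: "queue \<sigma> ! \<sigma> ''queue_pos'' 0 = (w, x)" "(w, x) \<in> set (queue \<sigma>)"
    "(w, x) \<in> U" "(w, x) \<notin> popped \<sigma>"
    using assms(2,3) by (rule next_entry)
  define T where "T = cost pop + (cost body + 24) * (length (successors as x) + 1)"
  have "finite U" using domain by (rule finite_subset) simp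
  have "loop_inv \<tau> \<and> 1 + cond_cost pending + T + pending_weight \<tau> \<le> pending_weight \<sigma>"
    if \<tau>: "(R \<tau> \<and> Inv (out_edges (insert (w, x) (popped \<sigma>))) \<tau> \<and> prefix (queue \<sigma>) (queue \<tau>)) \<and>
      \<tau> ''queue_pos'' 0 = Suc (\<sigma> ''queue_pos'' 0)" for \<tau>
  proof
    have popped: "popped \<tau> = insert (w, x) (popped \<sigma>)" and "\<tau> ''queue_pos'' 0 \<le> \<tau> ''queue_len'' 0"
      using popped_Suc[OF _ _ assms(3) wx(1)] \<tau> by simp_all
    with \<tau> show "loop_inv \<tau>" by (simp add: loop_inv_def)
    have "pending_weight \<sigma> = weight (cost body) (w, x) + pending_weight \<tau>"
      unfolding pending_weight_def popped using \<open>finite U\<close> wx(3,4)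
      by (subst sum.remove[of _ "(w, x)"]) (auto intro: arg_cong2[where f = sum])
    then show "1 + cond_cost pending + T + pending_weight \<tau> \<le> pending_weight \<sigma>"
      by (simp add: weight_def T_def pop_def pending_def add_mult_distrib)
  qed
  then have "triple W ((=) \<sigma>) (Seq pop (scan body)) T
      (\<lambda>\<tau>. loop_inv \<tau> \<and> 1 + cond_cost pending + T + pending_weight \<tau> \<le> pending_weight \<sigma>)"
    by (intro triple_conseq[OF pop_scan_correct[OF assms wx]]) (simp_all add: T_def)
  then show ?thesis ..
qed

lemma worklist_correct:
  "triple W (\<lambda>\<sigma>. R \<sigma> \<and> Inv {} \<sigma>) (worklist body) (9 + sum (weight (cost body)) U)
    (\<lambda>\<sigma>. R \<sigma> \<and> Inv (out_edges (set (queue \<sigma>))) \<sigma>)"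
proof -
  define B where "B = sum (weight (cost body)) U"
  have "preserved {''queue_pos''} (\<lambda>\<sigma>. R \<sigma> \<and> Inv {} \<sigma>)"
    by (intro preserved_conj preserved_mono[OF context_preserved] preserved_mono[OF inv_preserved])
      (simp_all add: worklist_control_def)
  then have "triple W (\<lambda>\<sigma>. R \<sigma> \<and> Inv {} \<sigma>) (Put ''queue_pos'' (Const 0)) 3
      (\<lambda>\<sigma>. (R \<sigma> \<and> Inv {} \<sigma>) \<and> \<sigma> ''queue_pos'' 0 = 0)"
    by (intro triple_Put_Const) simp_all
  then have start: "triple W (\<lambda>\<sigma>. R \<sigma> \<and> Inv {} \<sigma>) (Put ''queue_pos'' (Const 0)) 3
      (\<lambda>\<sigma>. loop_inv \<sigma> \<and> pending_weight \<sigma> \<le> B)"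
    by (rule triple_conseq) (simp_all add: loop_inv_def popped_def pending_weight_def B_def)
  have loop: "triple W (\<lambda>\<sigma>. loop_inv \<sigma> \<and> pending_weight \<sigma> \<le> B) (While pending (Seq pop (scan body)))
      (1 + cond_cost pending + B) (\<lambda>\<sigma>. loop_inv \<sigma> \<and> \<not> cond_val pending \<sigma>)"
    using loop_step by (intro triple_While) (simp_all add: pending_def bounded_stateD)
  show ?thesis
    unfolding worklist_def
  proof (rule triple_conseq[OF triple_Seq[OF start loop]])
    fix \<sigma> assume \<sigma>: "loop_inv \<sigma> \<and> \<not> cond_val pending \<sigma>"
    then have "\<sigma> ''queue_pos'' 0 = \<sigma> ''queue_len'' 0" by (simp add: loop_inv_def pending_def)
    with \<sigma> show "R \<sigma> \<and> Inv (out_edges (set (queue \<sigma>))) \<sigma>" by (simp add: loop_inv_def popped_def)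
  qed (simp_all add: pending_def B_def)
qed

end


section \<open>Deleting an edge\<close>

abbreviation index :: "expr \<Rightarrow> expr \<Rightarrow> expr" where
  "index a b \<equiv> Bin Plus (Bin Times a (Var ''n'')) b"

abbreviation copies :: expr where
  "copies \<equiv> Bin Plus (Var ''n'') (Const 1)"

definition decrement :: com where
  "decrement =
     If (Neg (Equal (Cell ''count'' (index (Var ''w'') (Var ''y''))) (Const 0)))
       (Seq (Assign ''count'' (index (Var ''w'') (Var ''y''))
              (Bin Minus (Cell ''count'' (index (Var ''w'') (Var ''y''))) (Const 1)))
         (If (Equal (Cell ''count'' (index (Var ''w'') (Var ''y''))) (Const 0)) push Skip))
       Skip"

definition seed_step :: com where
  "seed_step =
     If (Neg (Equal (Cell ''count'' (index (Var ''w'') (Var ''del_tail''))) (Const 0))) decrement Skip"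

definition seed :: com where
  "seed = For ''w'' copies seed_step"

definition cascade_step :: com where
  "cascade_step = If (Equal (Cell ''forward'' (index (Var ''x'') (Var ''y''))) (Const 1)) decrement Skip"

definition cascade :: com where
  "cascade = worklist cascade_step"

definition reparent :: com where
  "reparent =
     If (Equal (Cell ''count'' (index (Cell ''parent'' (Var ''x'')) (Var ''w''))) (Const 0))
       (Assign ''parent'' (Var ''x'') (Var ''w'')) Skip"

definition reattach_step :: com where
  "reattach_step =
     Seq (Put ''w'' (Cell ''queue_copy'' (Var ''i'')))
    (Seq (Put ''x'' (Cell ''queue_vertex'' (Var ''i'')))
         (If (Equal (Var ''w'') (Var ''n'')) (Assign ''in_tree'' (Var ''x'') (Const 0)) reparent))"

definition reattach :: com where
  "reattach = For ''i'' (Var ''queue_len'') reattach_step"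

definition marked_forward :: cond where
  "marked_forward = Equal (Cell ''forward'' (index (Var ''del_tail'') (Var ''del_head''))) (Const 1)"

definition unmark :: com where
  "unmark =
     Seq (Assign ''forward'' (index (Var ''del_tail'') (Var ''del_head'')) (Const 0))
         (Put ''y'' (Var ''del_head''))"

definition update :: com where
  "update =
     Seq (Put ''queue_len'' (Const 0))
         (If marked_forward (Seq unmark (Seq seed (Seq cascade reattach))) Skip)"

lemma writes_decrement [simp]: "writes decrement = {''count'', ''queue_copy'', ''queue_vertex'', ''queue_len''}"
  by (auto simp: decrement_def)

lemma writes_update_steps [simp]:
  "writes seed_step = writes decrement"
  "writes cascade_step = writes decrement"
  "writes reparent = {''parent''}"
  "writes reattach_step = {''w'', ''x'', ''in_tree'', ''parent''}"
  by (auto simp: seed_step_def cascade_step_def reparent_def reattach_step_def)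

definition update_cost :: nat where
  "update_cost = 2 * cost seed_step + cost reattach_step + 120"

context flow_graph_input
begin

subsection \<open>Propagating deaths\<close>

definition cascade_inv :: "nat rel \<Rightarrow> (nat \<times> nat \<times> nat) set \<Rightarrow> state \<Rightarrow> bool" where
  "cascade_inv F P \<sigma> \<longleftrightarrow> P \<subseteq> alive_edges F \<and> counts P \<sigma> \<and> distinct (queue \<sigma>) \<and>
     set (queue \<sigma>) = {(w, y) \<in> alive F. \<sigma> ''count'' (w * n + y) = 0}"

lemma preserved_cascade_inv [preserved_intros]:
  assumes "''count'' \<notin> X" "''queue_copy'' \<notin> X" "''queue_vertex'' \<notin> X" "''queue_len'' \<notin> X"
  shows "preserved X (cascade_inv F P)"
  unfolding preserved_def
proof (intro allI impI)
  fix \<sigma> \<tau> assume inv: "cascade_inv F P \<sigma>" and agree: "agree X \<sigma> \<tau>"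
  have "queue \<tau> = queue \<sigma>" "\<tau> ''count'' = \<sigma> ''count''"
    using queue_cong[OF agree] agreeD[OF agree] assms by simp_all
  with inv show "cascade_inv F P \<tau>" by (simp add: cascade_inv_def counts_def)
qed

lemma cascade_inv_count:
  "cascade_inv F P \<sigma> \<Longrightarrow> w \<le> n \<Longrightarrow> y < n \<Longrightarrow> \<sigma> ''count'' (w * n + y) = in_count P w y"
  by (simp add: cascade_inv_def counts_def)

lemma cascade_inv_finite: "cascade_inv F P \<sigma> \<Longrightarrow> F \<subseteq> F0 \<Longrightarrow> finite P"
  using F0_subset by (meson cascade_inv_def finite_alive_edges finite_subset subset_trans)

lemma cascade_inv_init:
  assumes "F \<subseteq> F0" "counts (alive_edges F) \<sigma>" "\<sigma> ''queue_len'' 0 = 0"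
  shows "cascade_inv F (alive_edges F) \<sigma>"
proof -
  have "counters_mark (alive F) \<sigma>" using assms(1,2) F0_subset by (intro counts_alive_edges) auto
  then have "{(w, y) \<in> alive F. \<sigma> ''count'' (w * n + y) = 0} = {}"
    using alive_subset[of F] by (auto simp: counters_mark_def)
  moreover have "queue \<sigma> = []" using assms(3) by (simp add: queue_def)
  ultimately show ?thesis using assms(2) by (simp add: cascade_inv_def)
qed

lemma cascade_inv_alive:
  assumes "cascade_inv F P \<sigma>" "F \<subseteq> F0" "w \<le> n" "y < n" "\<sigma> ''count'' (w * n + y) > 0"
  shows "(w, y) \<in> alive F"
proof -
  have "in_count P w y > 0" using assms by (simp add: cascade_inv_count)
  then have "y \<noteq> w" and "y = s \<or> (\<exists>x. (w, x, y) \<in> P)"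
    using in_count_pos_iff[OF cascade_inv_finite[OF assms(1,2)]] by auto
  then consider "y = s" "w \<noteq> s" | x where "(w, x, y) \<in> alive_edges F"
    using assms(1) by (auto simp: cascade_inv_def)
  then show ?thesis
  proof cases
    case 1
    then show ?thesis using assms(3,4) by (simp add: alive_def)
  next
    case 2
    then show ?thesis using alive_step \<open>y \<noteq> w\<close> assms(4) by (auto simp: alive_edges_def)
  qed
qed

lemma cascade_inv_queue_dead:
  assumes inv: "cascade_inv F P \<sigma>" and "F \<subseteq> F0" "F' \<subseteq> F" "alive_edges F' \<subseteq> P"
  shows "set (queue \<sigma>) \<subseteq> alive F - alive F'"
proof
  fix p assume p: "p \<in> set (queue \<sigma>)"
  obtain w y where wy: "p = (w, y)" by fastforce
  with p inv have alive: "(w, y) \<in> alive F" and zero: "\<sigma> ''count'' (w * n + y) = 0"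
    by (auto simp: cascade_inv_def)
  then have bounds: "w \<le> n" "y < n" by (auto simp: alive_def)
  have "F' \<subseteq> set as" using assms(2,3) F0_subset by (meson subset_trans)
  have "(w, y) \<notin> alive F'"
  proof
    assume "(w, y) \<in> alive F'"
    then have "in_count (alive_edges F') w y > 0"
      using in_count_alive_edges[OF \<open>F' \<subseteq> set as\<close>] bounds by simp
    then have "in_count P w y > 0"
      using in_count_pos_iff[OF finite_alive_edges[OF \<open>F' \<subseteq> set as\<close>]] assms(4)
        in_count_pos_iff[OF cascade_inv_finite[OF inv assms(2)]] by blast
    with zero inv bounds show False by (simp add: cascade_inv_count)
  qed
  with alive wy show "p \<in> alive F - alive F'" by simp
qed

lemma effect_decrement:
  assumes "header \<sigma>" "\<sigma> ''w'' 0 = w" "\<sigma> ''y'' 0 = y" "\<sigma> ''count'' (w * n + y) = k"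
  shows "effect decrement \<sigma> ''count'' = (\<sigma> ''count'')(w * n + y := k - 1)"
    and "queue (effect decrement \<sigma>) = queue \<sigma> @ (if k = 1 then [(w, y)] else [])"
proof -
  define \<rho> where "\<rho> = store \<sigma> ''count'' (w * n + y) (k - 1)"
  have effect: "effect decrement \<sigma> = (if k = 0 then \<sigma> else if k = 1 then effect push \<rho> else \<rho>)"
    using assms by (auto simp: decrement_def header_def \<rho>_def store_apply)
  have "agree {''count''} \<sigma> \<rho>" by (simp add: \<rho>_def agree_store)
  then have "queue \<rho> = queue \<sigma>" by (rule queue_cong) simp_all
  moreover have "\<rho> ''w'' 0 = w" "\<rho> ''y'' 0 = y" using assms(2,3) by (simp_all add: \<rho>_def store_apply)
  ultimately show "queue (effect decrement \<sigma>) = queue \<sigma> @ (if k = 1 then [(w, y)] else [])"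
    by (simp add: effect queue_push)
  have "effect push \<rho> ''count'' = \<rho> ''count''" by (rule agreeD[OF agree_effect]) simp
  then show "effect decrement \<sigma> ''count'' = (\<sigma> ''count'')(w * n + y := k - 1)"
    using assms(4) by (auto simp: effect \<rho>_def store_apply)
qed

lemma safe_decrement:
  assumes "bounded_state W \<sigma>" "header \<sigma>" "\<sigma> ''w'' 0 \<le> n" "\<sigma> ''y'' 0 < n"
    and "distinct (queue \<sigma>)" "set (queue \<sigma>) \<subseteq> {..n} \<times> {..<n}"
  shows "safe W decrement \<sigma>"
proof -
  have "safe W push (store \<sigma> ''count'' i k)" if "k < W" for i k
    using that assms(1) queue_len_less[OF assms(5,6)]
    by (intro safe_push bounded_state_store) (simp_all add: store_apply)
  then show ?thesis
    using assms(1-4) by (simp add: decrement_def header_def index_less_W bounded_stateD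
        less_imp_diff_less store_apply)
qed

lemma decrement_correct:
  assumes F: "F \<subseteq> F0" and \<sigma>: "bounded_state W \<sigma>" "header \<sigma>" "\<sigma> ''w'' 0 = w" "\<sigma> ''y'' 0 = y"
    and inv: "cascade_inv F P \<sigma>" and edge: "(w, x, y) \<in> P"
  shows "safe W decrement \<sigma> \<and> prefix (queue \<sigma>) (queue (effect decrement \<sigma>)) \<and>
    cascade_inv F (P - {(w, x, y)}) (effect decrement \<sigma>)"
proof -
  have alive: "(w, x) \<in> alive F" "(x, y) \<in> F" using inv edge by (auto simp: cascade_inv_def alive_edges_def)
  then have bounds: "w \<le> n" "y < n" "y \<noteq> s" using F F0_edge by (auto simp: alive_def)
  define k where "k = \<sigma> ''count'' (w * n + y)"
  define \<tau> where "\<tau> = effect decrement \<sigma>"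
  have count_k: "\<tau> ''count'' = (\<sigma> ''count'')(w * n + y := k - 1)"
    and queue: "queue \<tau> = queue \<sigma> @ (if k = 1 then [(w, y)] else [])"
    unfolding \<tau>_def using effect_decrement[OF \<sigma>(2-4)] by (simp_all add: k_def)
  have count: "\<tau> ''count'' (w' * n + y') =
      (if w' = w \<and> y' = y then k - 1 else \<sigma> ''count'' (w' * n + y'))" if "y' < n" for w' y'
    using count_k code_eq_iff[OF that bounds(2)] by simp
  have counts: "counts (P - {(w, x, y)}) \<tau>"
    using in_count_remove[OF cascade_inv_finite[OF inv F] edge bounds(3)] bounds
    by (simp add: counts_def count cascade_inv_count[OF inv] k_def)
  have k: "k \<noteq> 0 \<Longrightarrow> (w, y) \<in> alive F"
    using cascade_inv_alive[OF inv F bounds(1,2)] by (simp add: k_def)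
  have old_queue: "distinct (queue \<sigma>)" "set (queue \<sigma>) = {(w, y) \<in> alive F. \<sigma> ''count'' (w * n + y) = 0}"
    using inv by (simp_all add: cascade_inv_def)
  have "{(w', y') \<in> alive F. \<tau> ''count'' (w' * n + y') = 0} =
      {(w', y') \<in> alive F. \<sigma> ''count'' (w' * n + y') = 0} \<union> (if k = 1 then {(w, y)} else {})"
    using k by (auto simp: count alive_def k_def split: if_splits)
  then have "distinct (queue \<tau>)" "set (queue \<tau>) = {(w, y) \<in> alive F. \<tau> ''count'' (w * n + y) = 0}"
    using old_queue by (auto simp: queue k_def)
  with counts inv have "cascade_inv F (P - {(w, x, y)}) \<tau>" by (auto simp: cascade_inv_def)
  moreover have "safe W decrement \<sigma>"
    using \<sigma> bounds old_queue alive_subset by (intro safe_decrement) auto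
  ultimately show ?thesis using queue by (simp add: \<tau>_def)
qed

lemma seed_step_correct:
  assumes F: "F \<subseteq> F0" and uv: "(u, v) \<in> F" and w: "w \<le> n" "\<sigma> ''w'' 0 = w"
    and \<sigma>: "bounded_state W \<sigma>" "header \<sigma>" "\<sigma> ''del_tail'' 0 = u" "\<sigma> ''y'' 0 = v"
    and inv: "cascade_inv F (alive_edges F - {..<w} \<times> {(u, v)}) \<sigma>"
  shows "safe W seed_step \<sigma> \<and>
    cascade_inv F (alive_edges F - {..<Suc w} \<times> {(u, v)}) (effect seed_step \<sigma>)"
proof -
  define P where "P k = alive_edges F - {..<k} \<times> {(u, v)}" for k
  define live where "live \<longleftrightarrow> (w, u) \<in> alive F"
  have uv_bounds: "u < n" "v < n" using F uv F0_edge by blast+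
  have "F \<subseteq> set as" using F F0_subset by blast
  have "in_count (P w) w u = in_count (alive_edges F) w u" by (simp add: in_count_def P_def)
  then have count_u: "\<sigma> ''count'' (w * n + u) = 0 \<longleftrightarrow> \<not> live"
    using in_count_alive_edges[OF \<open>F \<subseteq> set as\<close>, of w u] cascade_inv_count[OF inv] w uv_bounds
    by (auto simp: live_def P_def)
  have step: "effect seed_step \<sigma> = (if live then effect decrement \<sigma> else \<sigma>)"
    "safe W seed_step \<sigma> \<longleftrightarrow> live \<longrightarrow> safe W decrement \<sigma>"
    using \<sigma> w uv_bounds count_u by (simp_all add: seed_step_def header_def index_less_W bounded_stateD)
  show ?thesis
  proof (cases live)
    case True
    then have "(w, u, v) \<in> P w" using uv by (simp add: P_def live_def alive_edges_def)
    then have "safe W decrement \<sigma> \<and> cascade_inv F (P w - {(w, u, v)}) (effect decrement \<sigma>)"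
      using decrement_correct[of F \<sigma> w v "P w" u] F \<sigma> w inv by (simp add: P_def)
    moreover have "P (Suc w) = P w - {(w, u, v)}" by (auto simp: P_def)
    ultimately show ?thesis using True step by (simp add: P_def)
  next
    case False
    then have "P (Suc w) = P w" by (auto simp: P_def live_def alive_edges_def less_Suc_eq)
    with False inv step show ?thesis by (simp add: P_def)
  qed
qed

lemma seed_correct:
  assumes F: "F \<subseteq> F0" and uv: "(u, v) \<in> F"
  shows "triple W
    (\<lambda>\<sigma>. (header \<sigma> \<and> \<sigma> ''del_tail'' 0 = u \<and> \<sigma> ''y'' 0 = v) \<and> cascade_inv F (alive_edges F) \<sigma>)
    seed ((cost seed_step + 14) * (n + 2))
    (cascade_inv F (alive_edges F \<inter> UNIV \<times> (F - {(u, v)})))"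
proof -
  define R where "R \<sigma> \<longleftrightarrow> header \<sigma> \<and> \<sigma> ''del_tail'' 0 = u \<and> \<sigma> ''y'' 0 = v" for \<sigma>
  define P where "P k = alive_edges F - {..<k} \<times> {(u, v)}" for k
  have loop: "triple W (\<lambda>\<sigma>. R \<sigma> \<and> cascade_inv F (P 0) \<sigma>) seed
      ((cost seed_step + expr_cost copies + 10) * ((n + 1) + 1))
      (\<lambda>\<sigma>. R \<sigma> \<and> cascade_inv F (P (n + 1)) \<sigma>)"
    unfolding seed_def
  proof (rule triple_For_loop_free)
    show "preserved (insert ''w'' (writes seed_step)) R"
      unfolding R_def by (intro preserved_intros) simp_all
    show "preserved {''w''} (cascade_inv F (P k))" for k by (intro preserved_intros) simp_all
    show "expr_fits W copies \<sigma> \<and> expr_val copies \<sigma> = n + 1" if "R \<sigma>" for \<sigma>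
      using that by (simp add: R_def header_def)
    show "safe W seed_step \<sigma> \<and> cascade_inv F (P (Suc w)) (effect seed_step \<sigma>)"
      if "w < n + 1" "bounded_state W \<sigma>" "R \<sigma>" "cascade_inv F (P w) \<sigma>" "\<sigma> ''w'' 0 = w" for w \<sigma>
      using that seed_step_correct[OF F uv, of w \<sigma>] by (simp add: R_def P_def)
  qed simp_all
  have "P 0 = alive_edges F" "P (n + 1) = alive_edges F \<inter> UNIV \<times> (F - {(u, v)})"
    by (auto simp: P_def alive_edges_def alive_def)
  then show ?thesis by (intro triple_conseq[OF loop]) (simp_all add: R_def)
qed

lemma cascade_inv_end:
  assumes F: "F \<subseteq> F0" "F' \<subseteq> F"
    and inv: "cascade_inv F (alive_edges F \<inter> UNIV \<times> F' - out_edges (set (queue \<sigma>))) \<sigma>"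
  shows "counts (alive_edges F') \<sigma> \<and> distinct (queue \<sigma>) \<and> set (queue \<sigma>) = alive F - alive F'"
proof -
  define P where "P = alive_edges F \<inter> UNIV \<times> F' - out_edges (set (queue \<sigma>))"
  have queue: "distinct (queue \<sigma>)" "set (queue \<sigma>) = {(w, y) \<in> alive F. \<sigma> ''count'' (w * n + y) = 0}"
    using inv by (simp_all add: cascade_inv_def)
  have P: "P = {(w, x, y). w \<le> n \<and> (x, y) \<in> F' \<and> \<sigma> ''count'' (w * n + x) > 0}"
  proof -
    have "(w, x, y) \<in> P \<longleftrightarrow> w \<le> n \<and> (x, y) \<in> F' \<and> \<sigma> ''count'' (w * n + x) > 0" for w x y
      using cascade_inv_alive[OF inv F(1), of w x] F F0_edge[of x y] F0_subset queue(2)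
      by (auto simp: P_def alive_edges_def out_edges_def alive_def)
    then show ?thesis by auto
  qed
  have "counts P \<sigma>" using inv unfolding cascade_inv_def P_def by blast
  with F have marks: "counters_mark (alive F') \<sigma>" unfolding P by (intro counters_mark_alive) auto
  have "(w, x, y) \<in> P \<longleftrightarrow> (w, x, y) \<in> alive_edges F'" for w x y
    using counters_mark_zero[OF marks, of w x] F F0_edge[of x y] alive_bounds[of w x F']
    by (auto simp: P alive_edges_def)
  then have "P = alive_edges F'" by auto
  moreover have "set (queue \<sigma>) = alive F - alive F'"
    using counters_mark_zero[OF marks] alive_bounds by (auto simp: queue(2))
  ultimately show ?thesis using \<open>counts P \<sigma>\<close> queue(1) by simp
qed

lemma cascade_step_correct:
  assumes F: "F \<subseteq> F0" "F' \<subseteq> F"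
    and \<sigma>: "bounded_state W \<sigma>" "header \<sigma>" "bit_matrix ''forward'' F' \<sigma>"
      "\<sigma> ''w'' 0 = w" "\<sigma> ''x'' 0 = x" "\<sigma> ''y'' 0 = y"
    and edge: "(w, x) \<in> set (queue \<sigma>)" "(x, y) \<in> set as" "(w, x, y) \<notin> D"
  defines "P \<equiv> \<lambda>D. alive_edges F \<inter> UNIV \<times> F' - D"
  assumes inv: "cascade_inv F (P D) \<sigma>" "alive_edges F' \<subseteq> P D"
  shows "safe W cascade_step \<sigma> \<and> prefix (queue \<sigma>) (queue (effect cascade_step \<sigma>)) \<and>
    cascade_inv F (P (insert (w, x, y) D)) (effect cascade_step \<sigma>) \<and>
    alive_edges F' \<subseteq> P (insert (w, x, y) D)"
proof -
  have dead: "(w, x) \<in> alive F" "(w, x) \<notin> alive F'"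
    using cascade_inv_queue_dead[OF inv(1) F inv(2)] edge(1) by auto
  have bounds: "w \<le> n" "x < n" "y < n" using alive_bounds[OF dead(1)] edge_bounded[OF edge(2)] by simp_all
  have "\<sigma> ''forward'' (x * n + y) = of_bool ((x, y) \<in> F')"
    using \<sigma>(3) bounds by (simp add: bit_matrix_def)
  then have step: "effect cascade_step \<sigma> = (if (x, y) \<in> F' then effect decrement \<sigma> else \<sigma>)"
    "safe W cascade_step \<sigma> \<longleftrightarrow> (x, y) \<in> F' \<longrightarrow> safe W decrement \<sigma>"
    using \<sigma> bounds by (simp_all add: cascade_step_def header_def index_less_W bounded_stateD)
  have survivors: "alive_edges F' \<subseteq> P (insert (w, x, y) D)"
    using inv(2) dead(2) by (auto simp: P_def alive_edges_def)
  show ?thesis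
  proof (cases "(x, y) \<in> F'")
    case True
    then have "(w, x, y) \<in> P D" using dead(1) edge(3) F(2) by (auto simp: P_def alive_edges_def)
    with F(1) \<sigma> inv(1) have "safe W decrement \<sigma> \<and> prefix (queue \<sigma>) (queue (effect decrement \<sigma>)) \<and>
        cascade_inv F (P D - {(w, x, y)}) (effect decrement \<sigma>)"
      using decrement_correct[of F \<sigma> w y "P D" x] by simp
    moreover have "P (insert (w, x, y) D) = P D - {(w, x, y)}" by (auto simp: P_def)
    ultimately show ?thesis using True step survivors by simp
  next
    case False
    then have "P (insert (w, x, y) D) = P D" by (auto simp: P_def)
    with False step survivors inv(1) show ?thesis by simp
  qed
qed

lemma cascade_correct:
  assumes F: "F \<subseteq> F0" "F' \<subseteq> F"
  shows "triple W
    (\<lambda>\<sigma>. (header \<sigma> \<and> adjacency as \<sigma> \<and> bit_matrix ''forward'' F' \<sigma>) \<and>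
      cascade_inv F (alive_edges F \<inter> UNIV \<times> F') \<sigma>)
    cascade (9 + sum (weight (cost cascade_step)) (alive F - alive F'))
    (\<lambda>\<sigma>. counts (alive_edges F') \<sigma> \<and> distinct (queue \<sigma>) \<and> set (queue \<sigma>) = alive F - alive F')"
proof -
  define R where "R \<sigma> \<longleftrightarrow> header \<sigma> \<and> adjacency as \<sigma> \<and> bit_matrix ''forward'' F' \<sigma>" for \<sigma>
  define P where "P D = alive_edges F \<inter> UNIV \<times> F' - D" for D
  define Inv where "Inv D \<sigma> \<longleftrightarrow> cascade_inv F (P D) \<sigma> \<and> alive_edges F' \<subseteq> P D" for D \<sigma>
  interpret worklist_invariant n m s W as cascade_step "alive F - alive F'" R Inv
  proof
    show "preserved (worklist_control \<union> writes cascade_step) R"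
      unfolding R_def by (intro preserved_intros) (simp_all add: worklist_control_def)
    show "preserved worklist_control (Inv D)" for D
      unfolding Inv_def by (intro preserved_intros) (simp_all add: worklist_control_def)
    show "distinct (queue \<sigma>) \<and> set (queue \<sigma>) \<subseteq> alive F - alive F'" if "Inv D \<sigma>" for D \<sigma>
      using that cascade_inv_queue_dead[of F "P D" \<sigma>, OF _ F] by (simp add: Inv_def cascade_inv_def)
    show "safe W cascade_step \<sigma> \<and> prefix (queue \<sigma>) (queue (effect cascade_step \<sigma>)) \<and>
        Inv (insert (w, x, y) D) (effect cascade_step \<sigma>)"
      if "bounded_state W \<sigma>" "R \<sigma>" "Inv D \<sigma>" "\<sigma> ''w'' 0 = w" "\<sigma> ''x'' 0 = x" "\<sigma> ''y'' 0 = y"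
        "(w, x) \<in> set (queue \<sigma>)" "(x, y) \<in> set as" "(w, x, y) \<notin> D" for D \<sigma> w x y
      using that cascade_step_correct[OF F, of \<sigma> w x y D] by (simp add: R_def Inv_def P_def)
  qed (use alive_subset in \<open>auto simp: R_def worklist_control_def\<close>)
  have "alive_edges F' \<subseteq> alive_edges F \<inter> UNIV \<times> F'"
    using alive_edges_mono[OF F(2)] by (auto simp: alive_edges_def)
  then have "Inv {} \<sigma> \<longleftrightarrow> cascade_inv F (alive_edges F \<inter> UNIV \<times> F') \<sigma>" for \<sigma>
    by (simp add: Inv_def P_def)
  moreover have "counts (alive_edges F') \<sigma> \<and> distinct (queue \<sigma>) \<and> set (queue \<sigma>) = alive F - alive F'"
    if "Inv (out_edges (set (queue \<sigma>))) \<sigma>" for \<sigma>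
    using that cascade_inv_end[OF F] by (simp add: Inv_def P_def)
  ultimately show ?thesis unfolding cascade_def
    by (intro triple_conseq[OF worklist_correct]) (simp_all add: R_def)
qed


subsection \<open>Repairing the tree\<close>

definition parent_ok :: "nat rel \<Rightarrow> nat set \<Rightarrow> nat \<Rightarrow> state \<Rightarrow> bool" where
  "parent_ok E S v \<sigma> \<longleftrightarrow> \<sigma> ''parent'' v < n \<and>
     (v \<noteq> s \<and> (n, v) \<in> alive E \<longrightarrow> idom_among s E S (\<sigma> ''parent'' v) v)"

definition tree_ok :: "nat rel \<Rightarrow> state \<Rightarrow> bool" where
  "tree_ok E \<sigma> \<longleftrightarrow> (\<forall>v<n. (\<sigma> ''in_tree'' v \<noteq> 0 \<longleftrightarrow> (n, v) \<in> alive E) \<and> parent_ok E {..<n} v \<sigma>)"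

text \<open>The tree after only the pairs outside \<open>A\<close> have been taken into account.\<close>

definition tree_inv :: "nat rel \<Rightarrow> (nat \<times> nat) set \<Rightarrow> state \<Rightarrow> bool" where
  "tree_inv E A \<sigma> \<longleftrightarrow> (\<forall>v<n. (\<sigma> ''in_tree'' v \<noteq> 0 \<longleftrightarrow> (n, v) \<in> A) \<and>
     parent_ok E {w. w < n \<and> (w, v) \<notin> A} v \<sigma>)"

lemma preserved_tree_ok [preserved_intros]:
  "''in_tree'' \<notin> X \<Longrightarrow> ''parent'' \<notin> X \<Longrightarrow> preserved X (tree_ok E)"
  by (simp add: preserved_def agree_def tree_ok_def parent_ok_def)

lemma preserved_tree_inv [preserved_intros]:
  "''in_tree'' \<notin> X \<Longrightarrow> ''parent'' \<notin> X \<Longrightarrow> preserved X (tree_inv E A)"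
  by (simp add: preserved_def agree_def tree_inv_def parent_ok_def)

lemma tree_ok_iff_tree_inv: "tree_ok E \<sigma> \<longleftrightarrow> tree_inv E (alive E) \<sigma>"
proof -
  have "idom_among s E {..<n} p v \<longleftrightarrow> idom_among s E {w. w < n \<and> (w, v) \<notin> alive E} p v" if "v < n" for p v
    using that by (auto simp: idom_among_def alive_def)
  then show ?thesis by (auto simp: tree_ok_def tree_inv_def parent_ok_def)
qed

lemma tree_inv_antimono:
  assumes "tree_ok E \<sigma>" "E' \<subseteq> E"
  shows "tree_inv E' (alive E) \<sigma>"
proof -
  have "parent_ok E' {w. w < n \<and> (w, v) \<notin> alive E} v \<sigma>" if "v < n" for v
    unfolding parent_ok_def
  proof (intro conjI impI)
    have parent: "parent_ok E {..<n} v \<sigma>" using assms(1) that by (simp add: tree_ok_def)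
    then show "\<sigma> ''parent'' v < n" by (simp add: parent_ok_def)
    assume "v \<noteq> s \<and> (n, v) \<in> alive E'"
    with parent alive_mono[OF assms(2)] have "idom_among s E {..<n} (\<sigma> ''parent'' v) v"
      by (auto simp: parent_ok_def)
    then show "idom_among s E' {w. w < n \<and> (w, v) \<notin> alive E} (\<sigma> ''parent'' v) v"
      using that by (rule_tac idom_among_antimono[OF _ assms(2)]) (auto simp: alive_def)
  qed
  with assms(1) show ?thesis by (simp add: tree_inv_def tree_ok_def)
qed

lemma tree_ok_cong: "avoids s E' = avoids s E \<Longrightarrow> tree_ok E' = tree_ok E"
  by (simp add: tree_ok_def parent_ok_def idom_among_def alive_def fun_eq_iff)

lemma reparent_correct:
  assumes E: "E \<subseteq> set as" and \<sigma>: "bounded_state W \<sigma>" "header \<sigma>" "counters_mark (alive E) \<sigma>"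
    and w: "\<sigma> ''w'' 0 = w" "w < n" and x: "\<sigma> ''x'' 0 = x" "x < n"
    and dead: "w \<noteq> x" "(w, x) \<notin> alive E" and ok: "parent_ok E S x \<sigma>"
  obtains p where "safe W reparent \<sigma>" "effect reparent \<sigma> = store \<sigma> ''parent'' x p"
    "parent_ok E (insert w S) x (effect reparent \<sigma>)"
proof
  define q where "q = \<sigma> ''parent'' x"
  define p where "p = (if avoids s E q w then q else w)"
  have "q < n" using ok by (simp add: parent_ok_def q_def)
  then have count: "\<sigma> ''count'' (q * n + w) = 0 \<longleftrightarrow> \<not> avoids s E q w"
    using counters_mark_zero[OF \<sigma>(3), of q w] w(2) by (simp add: alive_def)
  show effect: "effect reparent \<sigma> = store \<sigma> ''parent'' x p"
    using \<sigma>(2) w(1) x(1) count by (simp add: reparent_def header_def store_def p_def q_def)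
  show "safe W reparent \<sigma>"
    using \<sigma> w x \<open>q < n\<close> by (simp add: reparent_def header_def index_less_W bounded_stateD q_def)
  have "idom_among s E (insert w S) p x" if "x \<noteq> s" "(n, x) \<in> alive E"
    unfolding p_def using that ok dead w(2) x(2) reachable_iff_alive[OF E x(2)]
    by (intro idom_among_insert) (auto simp: parent_ok_def alive_def q_def)
  then show "parent_ok E (insert w S) x (effect reparent \<sigma>)"
    using \<open>q < n\<close> w(2) by (simp add: effect parent_ok_def store_apply p_def)
qed

lemma reattach_step_correct:
  assumes E: "E \<subseteq> set as" and \<sigma>: "bounded_state W \<sigma>" "header \<sigma>" "counters_mark (alive E) \<sigma>"
    and i: "\<sigma> ''i'' 0 = i" "i < length (queue \<sigma>)" "queue \<sigma> ! i = (w, x)"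
    and wx: "w \<le> n" "x < n" "w \<noteq> x" "(w, x) \<notin> alive E" and inv: "tree_inv E A \<sigma>"
  shows "safe W reattach_step \<sigma> \<and> tree_inv E (A - {(w, x)}) (effect reattach_step \<sigma>)"
proof -
  define \<rho> where "\<rho> = store (store \<sigma> ''w'' 0 w) ''x'' 0 x"
  have queue: "\<sigma> ''queue_copy'' i = w" "\<sigma> ''queue_vertex'' i = x" using i by (simp_all add: nth_queue)
  have "bounded_state W \<rho>" unfolding \<rho>_def
    using \<sigma>(1) wx(1,2) by (intro bounded_state_store) (simp_all add: index_less_W)
  moreover have "header \<rho>" "counters_mark (alive E) \<rho>" "\<rho> ''w'' 0 = w" "\<rho> ''x'' 0 = x"
    "tree_inv E A \<rho>"
    using \<sigma>(2,3) inv unfolding \<rho>_def header_def counters_mark_def tree_inv_def parent_ok_def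
    by (simp_all add: store_apply)
  ultimately have \<rho>: "bounded_state W \<rho>" "header \<rho>" "counters_mark (alive E) \<rho>" "\<rho> ''w'' 0 = w"
    "\<rho> ''x'' 0 = x" "tree_inv E A \<rho>" by simp_all
  have step: "effect reattach_step \<sigma> = (if w = n then store \<rho> ''in_tree'' x 0 else effect reparent \<rho>)"
    "safe W reattach_step \<sigma> \<longleftrightarrow> (w \<noteq> n \<longrightarrow> safe W reparent \<rho>)"
    using \<sigma>(1,2) \<rho>(1) i(1) queue wx(1,2) bounded_stateD[OF \<sigma>(1), of "''i''" 0]
    by (simp_all add: reattach_step_def header_def \<rho>_def store_apply index_less_W bounded_stateD)
  show ?thesis
  proof (cases "w = n")
    case True
    have "{w'. w' < n \<and> (w', v) \<notin> A - {(w, x)}} = {w'. w' < n \<and> (w', v) \<notin> A}" for v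
      using True by auto
    then have "tree_inv E (A - {(w, x)}) (store \<rho> ''in_tree'' x 0)"
      using \<rho>(6) True by (auto simp: tree_inv_def parent_ok_def store_apply)
    with True show ?thesis by (simp add: step)
  next
    case False
    with wx(1) have "w < n" by simp
    have "parent_ok E {w. w < n \<and> (w, x) \<notin> A} x \<rho>" using \<rho>(6) wx(2) by (simp add: tree_inv_def)
    with E \<rho>(1-4) \<open>w < n\<close> \<rho>(5) wx(2-4) obtain p where p: "safe W reparent \<rho>"
      "effect reparent \<rho> = store \<rho> ''parent'' x p"
      "parent_ok E (insert w {w. w < n \<and> (w, x) \<notin> A}) x (effect reparent \<rho>)"
      by (rule reparent_correct)
    have "{w'. w' < n \<and> (w', v) \<notin> A - {(w, x)}} =
        (if v = x then insert w {w. w < n \<and> (w, x) \<notin> A} else {w. w < n \<and> (w, v) \<notin> A})" for v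
      using \<open>w < n\<close> by auto
    then have "tree_inv E (A - {(w, x)}) (effect reparent \<rho>)"
      using \<rho>(6) p(2,3) \<open>w < n\<close> by (auto simp: tree_inv_def parent_ok_def store_apply)
    with False p(1) show ?thesis by (simp add: step)
  qed
qed

lemma reattach_queue_correct:
  assumes E: "E' \<subseteq> E" "E \<subseteq> set as" and q: "distinct q" "set q = alive E - alive E'"
  shows "triple W
    (\<lambda>\<sigma>. (header \<sigma> \<and> counters_mark (alive E') \<sigma> \<and> queue \<sigma> = q) \<and> tree_inv E' (alive E) \<sigma>)
    reattach ((cost reattach_step + 12) * (length q + 1)) (tree_ok E')"
proof -
  define R where "R \<sigma> \<longleftrightarrow> header \<sigma> \<and> counters_mark (alive E') \<sigma> \<and> queue \<sigma> = q" for \<sigma>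
  define I where "I k = tree_inv E' (alive E - set (take k q))" for k
  have loop: "triple W (\<lambda>\<sigma>. R \<sigma> \<and> I 0 \<sigma>) reattach
      ((cost reattach_step + expr_cost (Var ''queue_len'') + 10) * (length q + 1))
      (\<lambda>\<sigma>. R \<sigma> \<and> I (length q) \<sigma>)"
    unfolding reattach_def
  proof (rule triple_For_loop_free)
    have "length q \<le> card ({..n} \<times> {..<n})"
      unfolding distinct_card[OF q(1), symmetric] q(2) using alive_subset by (intro card_mono) auto
    then show "length q < W" using index_less_W(7) by (simp add: card_cartesian_product)
    show "preserved (insert ''i'' (writes reattach_step)) R"
      unfolding R_def by (intro preserved_intros) simp_all
    show "preserved {''i''} (I k)" for k unfolding I_def by (intro preserved_intros) simp_all
    show "expr_fits W (Var ''queue_len'') \<sigma> \<and> expr_val (Var ''queue_len'') \<sigma> = length q"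
      if "bounded_state W \<sigma>" "R \<sigma>" for \<sigma>
      using that by (auto simp: R_def bounded_stateD)
  next
    fix k \<sigma>
    assume k: "k < length q" and \<sigma>: "bounded_state W \<sigma>" "R \<sigma>" "I k \<sigma>" "\<sigma> ''i'' 0 = k"
    obtain w x where wx: "q ! k = (w, x)" by fastforce
    with k q(2) have mem: "(w, x) \<in> alive E" "(w, x) \<notin> alive E'" using nth_mem by fastforce+
    then have bounds: "w \<le> n" "x < n" "w \<noteq> x" by (auto simp: alive_def)
    have "alive E - set (take (Suc k) q) = alive E - set (take k q) - {(w, x)}"
      using k wx by (auto simp: take_Suc_conv_app_nth)
    then show "safe W reattach_step \<sigma> \<and> I (Suc k) (effect reattach_step \<sigma>)"
      using reattach_step_correct[of E' \<sigma> k w x] \<sigma> k wx bounds mem(2) E by (auto simp: R_def I_def)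
  qed simp_all
  have "I (length q) = tree_ok E'"
    using q(2) alive_mono[OF E(1)] by (simp add: I_def fun_eq_iff tree_ok_iff_tree_inv double_diff)
  then show ?thesis by (intro triple_conseq[OF loop]) (simp_all add: R_def I_def)
qed

lemma reattach_correct:
  assumes E: "E' \<subseteq> E" "E \<subseteq> set as"
  shows "triple W
    (\<lambda>\<sigma>. (header \<sigma> \<and> counters_mark (alive E') \<sigma> \<and> distinct (queue \<sigma>) \<and>
      set (queue \<sigma>) = alive E - alive E') \<and> tree_ok E \<sigma>)
    reattach ((cost reattach_step + 12) * (card (alive E - alive E') + 1)) (tree_ok E')"
  unfolding triple_def
proof (intro allI impI)
  fix \<sigma> assume "bounded_state W \<sigma>" and \<sigma>: "(header \<sigma> \<and> counters_mark (alive E') \<sigma> \<and>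
    distinct (queue \<sigma>) \<and> set (queue \<sigma>) = alive E - alive E') \<and> tree_ok E \<sigma>"
  then have "length (queue \<sigma>) = card (alive E - alive E')" by (metis distinct_card)
  with reattach_queue_correct[OF E, of "queue \<sigma>"] tree_inv_antimono[OF _ E(1)] \<open>bounded_state W \<sigma>\<close> \<sigma>
  show "\<exists>t \<tau>. exec W reattach \<sigma> t \<tau> \<and>
      t \<le> (cost reattach_step + 12) * (card (alive E - alive E') + 1) \<and> tree_ok E' \<tau>"
    by (auto elim!: tripleE)
qed


subsection \<open>The update\<close>

definition maintained :: "nat rel \<Rightarrow> state \<Rightarrow> bool" where
  "maintained E \<sigma> \<longleftrightarrow> header \<sigma> \<and> adjacency as \<sigma> \<and> bit_matrix ''forward'' (E \<inter> F0) \<sigma> \<and>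
     counts (alive_edges (E \<inter> F0)) \<sigma> \<and> tree_ok E \<sigma>"

definition death_cost :: "nat \<times> nat \<Rightarrow> nat" where
  "death_cost p = weight (cost cascade_step) p + (cost reattach_step + 12)"

definition potential :: "nat rel \<Rightarrow> nat" where
  "potential E = sum death_cost (alive E)"

lemma potential_diff:
  "E' \<subseteq> E \<Longrightarrow> sum death_cost (alive E - alive E') + potential E' = potential E"
  unfolding potential_def by (simp add: sum.subset_diff[OF alive_mono])

lemma preserved_maintained [preserved_intros]:
  assumes "X \<inter> {''n'', ''m'', ''s'', ''deg'', ''adj'', ''forward'', ''count'', ''in_tree'', ''parent''} = {}"
  shows "preserved X (maintained E)"
proof -
  have "preserved X (\<lambda>\<sigma>. header \<sigma> \<and> adjacency as \<sigma> \<and> bit_matrix ''forward'' (E \<inter> F0) \<sigma> \<and>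
      counts (alive_edges (E \<inter> F0)) \<sigma> \<and> tree_ok E \<sigma>)"
    using assms by (intro preserved_intros) auto
  then show ?thesis by (simp add: maintained_def[abs_def])
qed

lemma unmark_correct:
  assumes "u < n" "v < n"
  shows "triple W
    (\<lambda>\<sigma>. header \<sigma> \<and> \<sigma> ''del_tail'' 0 = u \<and> \<sigma> ''del_head'' 0 = v \<and> bit_matrix ''forward'' F \<sigma>)
    unmark (cost unmark) (\<lambda>\<sigma>. \<sigma> ''y'' 0 = v \<and> bit_matrix ''forward'' (F - {(u, v)}) \<sigma>)"
proof (rule triple_loop_free)
  fix \<sigma>
  assume \<sigma>: "header \<sigma> \<and> \<sigma> ''del_tail'' 0 = u \<and> \<sigma> ''del_head'' 0 = v \<and> bit_matrix ''forward'' F \<sigma>"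
  then have "effect unmark \<sigma> ''forward'' = (\<sigma> ''forward'')(u * n + v := 0)"
    by (simp add: unmark_def header_def store_apply)
  with \<sigma> have "bit_matrix ''forward'' (F - {(u, v)}) (effect unmark \<sigma>)"
    using assms(2) by (intro bit_matrix_remove) simp_all
  with \<sigma> assms show "safe W unmark \<sigma> \<and> effect unmark \<sigma> ''y'' 0 = v \<and>
      bit_matrix ''forward'' (F - {(u, v)}) (effect unmark \<sigma>)"
    by (simp add: unmark_def header_def store_apply index_less_W)
qed

lemma cascade_reattach_correct:
  assumes E: "E \<subseteq> set as" "E' \<subseteq> E"
  shows "triple W
    (\<lambda>\<sigma>. header \<sigma> \<and> adjacency as \<sigma> \<and> bit_matrix ''forward'' (E' \<inter> F0) \<sigma> \<and> tree_ok E \<sigma> \<and>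
      cascade_inv (E \<inter> F0) (alive_edges (E \<inter> F0) \<inter> UNIV \<times> (E' \<inter> F0)) \<sigma>)
    (Seq cascade reattach)
    ((9 + sum (weight (cost cascade_step)) (alive E - alive E')) +
      (cost reattach_step + 12) * (card (alive E - alive E') + 1))
    (maintained E')"
proof (rule triple_Seq)
  define layout where "layout \<sigma> \<longleftrightarrow> header \<sigma> \<and> adjacency as \<sigma> \<and> bit_matrix ''forward'' (E' \<inter> F0) \<sigma>" for \<sigma>
  have F: "E \<inter> F0 \<subseteq> F0" "E' \<inter> F0 \<subseteq> E \<inter> F0" using E(2) by auto
  have alive: "alive (E \<inter> F0) = alive E" "alive (E' \<inter> F0) = alive E'"
    using E by (simp_all add: alive_Int_F0)
  have "preserved (writes cascade) (\<lambda>\<sigma>. layout \<sigma> \<and> tree_ok E \<sigma>)"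
    unfolding layout_def
    by (intro preserved_intros) (simp_all add: cascade_def writes_worklist worklist_control_def)
  with cascade_correct[OF F, unfolded alive]
  show "triple W
      (\<lambda>\<sigma>. header \<sigma> \<and> adjacency as \<sigma> \<and> bit_matrix ''forward'' (E' \<inter> F0) \<sigma> \<and> tree_ok E \<sigma> \<and>
        cascade_inv (E \<inter> F0) (alive_edges (E \<inter> F0) \<inter> UNIV \<times> (E' \<inter> F0)) \<sigma>)
      cascade (9 + sum (weight (cost cascade_step)) (alive E - alive E'))
      (\<lambda>\<sigma>. layout \<sigma> \<and> tree_ok E \<sigma> \<and> counts (alive_edges (E' \<inter> F0)) \<sigma> \<and> distinct (queue \<sigma>) \<and>
        set (queue \<sigma>) = alive E - alive E')"
    by (rule triple_frame) (simp_all add: layout_def)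
  have "counters_mark (alive E') \<sigma>" if "counts (alive_edges (E' \<inter> F0)) \<sigma>" for \<sigma>
    using counts_alive_edges[OF _ that] F0_subset alive(2) by auto
  moreover have "preserved (writes reattach) (\<lambda>\<sigma>. layout \<sigma> \<and> counts (alive_edges (E' \<inter> F0)) \<sigma>)"
    unfolding layout_def by (intro preserved_intros) (simp_all add: reattach_def)
  ultimately show "triple W
      (\<lambda>\<sigma>. layout \<sigma> \<and> tree_ok E \<sigma> \<and> counts (alive_edges (E' \<inter> F0)) \<sigma> \<and> distinct (queue \<sigma>) \<and>
        set (queue \<sigma>) = alive E - alive E')
      reattach ((cost reattach_step + 12) * (card (alive E - alive E') + 1)) (maintained E')"
    by (intro triple_frame[OF reattach_correct[OF E(2,1)]]) (simp_all add: layout_def maintained_def)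
qed

lemma delete_forward_edge_correct:
  assumes E: "E \<subseteq> set as" and uv: "(u, v) \<in> E \<inter> F0"
  shows "triple W
    (\<lambda>\<sigma>. maintained E \<sigma> \<and> \<sigma> ''del_tail'' 0 = u \<and> \<sigma> ''del_head'' 0 = v \<and> \<sigma> ''queue_len'' 0 = 0)
    (Seq unmark (Seq seed (Seq cascade reattach)))
    (cost unmark + ((cost seed_step + 14) * (n + 2) +
      ((9 + sum (weight (cost cascade_step)) (alive E - alive (E - {(u, v)}))) +
       (cost reattach_step + 12) * (card (alive E - alive (E - {(u, v)})) + 1))))
    (maintained (E - {(u, v)}))"
proof (rule triple_Seq[OF _ triple_Seq[OF _ cascade_reattach_correct]])
  define F where "F = E \<inter> F0"
  define layout where "layout \<sigma> \<longleftrightarrow> header \<sigma> \<and> adjacency as \<sigma> \<and> tree_ok E \<sigma>" for \<sigma>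
  have F: "F \<subseteq> F0" "F - {(u, v)} = (E - {(u, v)}) \<inter> F0" by (auto simp: F_def)
  have uv_bounds: "u < n" "v < n" using uv F0_edge by blast+
  have "preserved (writes unmark) (\<lambda>\<sigma>. layout \<sigma> \<and> \<sigma> ''del_tail'' 0 = u \<and> cascade_inv F (alive_edges F) \<sigma>)"
    unfolding layout_def by (intro preserved_intros) (simp_all add: unmark_def)
  with unmark_correct[OF uv_bounds, of F] show "triple W
      (\<lambda>\<sigma>. maintained E \<sigma> \<and> \<sigma> ''del_tail'' 0 = u \<and> \<sigma> ''del_head'' 0 = v \<and> \<sigma> ''queue_len'' 0 = 0)
      unmark (cost unmark)
      (\<lambda>\<sigma>. (layout \<sigma> \<and> \<sigma> ''del_tail'' 0 = u \<and> cascade_inv F (alive_edges F) \<sigma>) \<and>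
        \<sigma> ''y'' 0 = v \<and> bit_matrix ''forward'' (F - {(u, v)}) \<sigma>)"
    by (rule triple_frame)
      (use cascade_inv_init[OF F(1)] in \<open>simp_all add: maintained_def layout_def F_def\<close>)
  have "preserved (writes seed) (\<lambda>\<sigma>. layout \<sigma> \<and> bit_matrix ''forward'' (F - {(u, v)}) \<sigma>)"
    unfolding layout_def by (intro preserved_intros) (simp_all add: seed_def)
  with seed_correct[OF F(1) uv[folded F_def]] show "triple W
      (\<lambda>\<sigma>. (layout \<sigma> \<and> \<sigma> ''del_tail'' 0 = u \<and> cascade_inv F (alive_edges F) \<sigma>) \<and>
        \<sigma> ''y'' 0 = v \<and> bit_matrix ''forward'' (F - {(u, v)}) \<sigma>)
      seed ((cost seed_step + 14) * (n + 2))
      (\<lambda>\<sigma>. header \<sigma> \<and> adjacency as \<sigma> \<and> bit_matrix ''forward'' ((E - {(u, v)}) \<inter> F0) \<sigma> \<and>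
        tree_ok E \<sigma> \<and>
        cascade_inv (E \<inter> F0) (alive_edges (E \<inter> F0) \<inter> UNIV \<times> ((E - {(u, v)}) \<inter> F0)) \<sigma>)"
    by (rule triple_frame) (simp_all add: layout_def F(2)[symmetric] F_def[symmetric])
qed (use E in auto)

lemma maintained_delete_backward_edge:
  assumes E: "E \<subseteq> set as" and e: "e \<notin> E \<inter> F0" and "maintained E \<sigma>"
  shows "maintained (E - {e}) \<sigma>"
proof -
  have F: "(E - {e}) \<inter> F0 = E \<inter> F0" using e by auto
  have "avoids s (E - {e}) w v = avoids s E w v" for w v
    using avoids_Int_forward_edges[OF E, of s w v]
      avoids_Int_forward_edges[of "E - {e}" "set as" s w v] E by (simp add: F subset_iff)
  then have "tree_ok (E - {e}) = tree_ok E" by (intro tree_ok_cong ext)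
  with assms(3) show ?thesis by (simp add: maintained_def F)
qed

lemma delete_edge_correct:
  assumes E: "E \<subseteq> set as" and uv: "u < n" "v < n"
  shows "triple W
    (\<lambda>\<sigma>. maintained E \<sigma> \<and> \<sigma> ''del_tail'' 0 = u \<and> \<sigma> ''del_head'' 0 = v \<and> \<sigma> ''queue_len'' 0 = 0)
    (If marked_forward (Seq unmark (Seq seed (Seq cascade reattach))) Skip)
    (1 + cond_cost marked_forward + (cost unmark + ((cost seed_step + 14) * (n + 2) +
      ((9 + sum (weight (cost cascade_step)) (alive E - alive (E - {(u, v)}))) +
       (cost reattach_step + 12) * (card (alive E - alive (E - {(u, v)})) + 1)))))
    (maintained (E - {(u, v)}))"
    (is "triple W ?P _ (_ + ?T) ?Q")
proof (rule triple_If)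
  have forward: "\<sigma> ''n'' 0 = n" "\<sigma> ''forward'' (u * n + v) = of_bool ((u, v) \<in> E \<inter> F0)"
    "\<sigma> ''del_tail'' 0 = u" "\<sigma> ''del_head'' 0 = v" if "?P \<sigma>" for \<sigma>
    using that uv by (simp_all add: maintained_def header_def bit_matrix_def)
  have marked: "cond_val marked_forward \<sigma> \<longleftrightarrow> (u, v) \<in> E \<inter> F0" if "?P \<sigma>" for \<sigma>
    using forward[OF that] by (simp add: marked_forward_def)
  show "cond_fits W marked_forward \<sigma>" if "?P \<sigma>" for \<sigma>
    using forward[OF that] uv by (simp add: marked_forward_def index_less_W)
  show "triple W (\<lambda>\<sigma>. ?P \<sigma> \<and> cond_val marked_forward \<sigma>)
      (Seq unmark (Seq seed (Seq cascade reattach))) ?T ?Q"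
  proof (rule triple_assume)
    show "(u, v) \<in> E \<inter> F0" if "?P \<sigma> \<and> cond_val marked_forward \<sigma>" for \<sigma> using that marked by blast
    assume "(u, v) \<in> E \<inter> F0"
    from delete_forward_edge_correct[OF E this]
    show "triple W (\<lambda>\<sigma>. ?P \<sigma> \<and> cond_val marked_forward \<sigma>)
        (Seq unmark (Seq seed (Seq cascade reattach))) ?T ?Q"
      by (rule triple_conseq) simp_all
  qed
  have "triple W (\<lambda>\<sigma>. ?P \<sigma> \<and> \<not> cond_val marked_forward \<sigma>) Skip (cost Skip) ?Q"
    using maintained_delete_backward_edge[OF E] marked by (intro triple_loop_free) auto
  then show "triple W (\<lambda>\<sigma>. ?P \<sigma> \<and> \<not> cond_val marked_forward \<sigma>) Skip ?T ?Q"
    by (rule triple_conseq) simp_all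
qed

theorem update_correct:
  assumes E: "E \<subseteq> set as" and uv: "u < n" "v < n"
  shows "triple W (\<lambda>\<sigma>. maintained E \<sigma> \<and> \<sigma> ''del_tail'' 0 = u \<and> \<sigma> ''del_head'' 0 = v) update
    (sum death_cost (alive E - alive (E - {(u, v)})) + update_cost * (n + 1))
    (maintained (E - {(u, v)}))"
proof -
  have "preserved {''queue_len''}
      (\<lambda>\<sigma>. maintained E \<sigma> \<and> \<sigma> ''del_tail'' 0 = u \<and> \<sigma> ''del_head'' 0 = v)"
    by (intro preserved_intros) simp_all
  then have "triple W (\<lambda>\<sigma>. maintained E \<sigma> \<and> \<sigma> ''del_tail'' 0 = u \<and> \<sigma> ''del_head'' 0 = v)
      (Put ''queue_len'' (Const 0)) 3
      (\<lambda>\<sigma>. (maintained E \<sigma> \<and> \<sigma> ''del_tail'' 0 = u \<and> \<sigma> ''del_head'' 0 = v) \<and> \<sigma> ''queue_len'' 0 = 0)"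
    by (intro triple_Put_Const) simp_all
  note triple_Seq[OF this[unfolded conj_assoc] delete_edge_correct[OF E uv]]
  then show ?thesis unfolding update_def
    by (rule triple_conseq) (simp_all add: unmark_def marked_forward_def death_cost_def[abs_def]
        update_cost_def sum.distrib algebra_simps)
qed

end


section \<open>Initialisation\<close>

abbreviation edge_tail :: expr where
  "edge_tail \<equiv> Cell ''tail'' (Var ''i'')"

abbreviation edge_head :: expr where
  "edge_head \<equiv> Cell ''head'' (Var ''i'')"

definition adjacency_step :: com where
  "adjacency_step =
     Seq (Assign ''adj'' (Bin Plus (Bin Times edge_tail (Var ''m'')) (Cell ''deg'' edge_tail)) edge_head)
         (Assign ''deg'' edge_tail (Bin Plus (Cell ''deg'' edge_tail) (Const 1)))"

definition build_adjacency :: com where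
  "build_adjacency = For ''i'' (Var ''m'') adjacency_step"

definition search_step :: com where
  "search_step =
     If (Conj (Neg (Equal (Var ''y'') (Var ''w'')))
              (Equal (Cell ''reach'' (index (Var ''w'') (Var ''y''))) (Const 0)))
       (Seq (Assign ''reach'' (index (Var ''w'') (Var ''y'')) (Const 1)) push)
       Skip"

definition search_seed :: com where
  "search_seed = Seq (Put ''y'' (Var ''s'')) (For ''w'' copies search_step)"

definition search :: com where
  "search = Seq search_seed (worklist search_step)"

definition forward_step :: com where
  "forward_step = Assign ''forward'' (index edge_tail edge_head) (Cell ''reach'' (index edge_head edge_tail))"

definition mark_forward :: com where
  "mark_forward = For ''i'' (Var ''m'') forward_step"

definition count_start_step :: com where
  "count_start_step =
     If (Equal (Var ''w'') (Var ''s'')) Skip (Assign ''count'' (index (Var ''w'') (Var ''s'')) (Const 1))"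

definition count_start :: com where
  "count_start = For ''w'' copies count_start_step"

definition count_step :: com where
  "count_step =
     If (Conj (Equal (Cell ''forward'' (index edge_tail edge_head)) (Const 1))
        (Conj (Equal (Cell ''reach'' (index (Var ''w'') edge_tail)) (Const 1))
              (Neg (Equal edge_head (Var ''w'')))))
       (Assign ''count'' (index (Var ''w'') edge_head)
          (Bin Plus (Cell ''count'' (index (Var ''w'') edge_head)) (Const 1)))
       Skip"

definition count_row :: com where
  "count_row = For ''i'' (Var ''m'') count_step"

definition count_edges :: com where
  "count_edges = Seq count_start (For ''w'' copies count_row)"

definition tree_step :: com where
  "tree_step =
     If (Conj (Neg (Equal (Var ''w'') (Var ''x'')))
              (Equal (Cell ''count'' (index (Var ''w'') (Var ''x''))) (Const 0)))
       reparent Skip"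

definition tree_row :: com where
  "tree_row = Seq (Assign ''parent'' (Var ''x'') (Var ''s'')) (For ''w'' (Var ''n'') tree_step)"

definition load_in_tree :: com where
  "load_in_tree = Assign ''in_tree'' (Var ''x'') (Cell ''count'' (index (Var ''n'') (Var ''x'')))"

definition tree_vertex :: com where
  "tree_vertex = Seq load_in_tree (If (Equal (Cell ''in_tree'' (Var ''x'')) (Const 0)) Skip tree_row)"

definition build_tree :: com where
  "build_tree = For ''x'' (Var ''n'') tree_vertex"

definition initialise :: com where
  "initialise =
     Seq (Seq build_adjacency (Seq search mark_forward)) (Seq count_edges build_tree)"

lemma writes_initialise_steps [simp]:
  "writes adjacency_step = {''adj'', ''deg''}"
  "writes search_step = {''reach'', ''queue_copy'', ''queue_vertex'', ''queue_len''}"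
  "writes forward_step = {''forward''}"
  "writes count_start_step = {''count''}"
  "writes count_step = {''count''}"
  "writes count_row = {''i'', ''count''}"
  "writes tree_step = {''parent''}"
  "writes tree_row = {''w'', ''parent''}"
  "writes tree_vertex = {''in_tree'', ''w'', ''parent''}"
  by (auto simp: adjacency_step_def search_step_def forward_step_def count_start_step_def count_step_def
      count_row_def tree_step_def tree_row_def tree_vertex_def load_in_tree_def)

definition zeroed :: "vname \<Rightarrow> state \<Rightarrow> bool" where
  "zeroed x \<sigma> \<longleftrightarrow> (\<forall>i. \<sigma> x i = 0)"

lemma preserved_zeroed [preserved_intros]: "x \<notin> X \<Longrightarrow> preserved X (zeroed x)"
  by (simp add: preserved_def agree_def zeroed_def)

context flow_graph_input
begin

subsection \<open>Adjacency lists and reachability\<close>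

lemma take_Suc_edges: "k < m \<Longrightarrow> take (Suc k) as = take k as @ [as ! k]"
  using length_edges by (simp add: take_Suc_conv_app_nth)

lemma edge_arrays_nth:
  "edge_arrays \<sigma> \<Longrightarrow> k < m \<Longrightarrow> as ! k = (a, b) \<Longrightarrow> \<sigma> ''tail'' k = a \<and> \<sigma> ''head'' k = b"
  by (metis Pair_inject edge_arrays_def)

lemma edge_nth_cases:
  assumes "k < m"
  obtains a b where "as ! k = (a, b)" "a < n" "b < n" "(a, b) \<in> set as" "(a, b) \<notin> set (take k as)"
proof -
  obtain a b where ab: "as ! k = (a, b)" by fastforce
  then have "(a, b) \<in> set as" using assms length_edges by (metis nth_mem)
  moreover have "distinct (take k as @ [as ! k])"
    using distinct_take[OF distinct_edges, of "Suc k"] take_Suc_edges[OF assms] by simp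
  ultimately show thesis using that[OF ab] ab edge_bounded by simp
qed

lemma adjacency_step_correct:
  assumes "k < m" and \<sigma>: "header \<sigma>" "edge_arrays \<sigma>" "adjacency (take k as) \<sigma>" "\<sigma> ''i'' 0 = k"
  shows "safe W adjacency_step \<sigma> \<and> adjacency (take (Suc k) as) (effect adjacency_step \<sigma>)"
proof -
  obtain a b where ab: "as ! k = (a, b)" "a < n" "b < n" using assms(1) by (rule edge_nth_cases)
  define l where "l = length (successors (take k as) a)"
  have edge: "\<sigma> ''tail'' k = a" "\<sigma> ''head'' k = b" using edge_arrays_nth[OF \<sigma>(2) assms(1) ab(1)] by simp_all
  have deg: "\<sigma> ''deg'' a = l" using \<sigma>(3) ab(2) by (simp add: adjacency_def l_def)
  have l_le: "length (successors (take k as) u) \<le> k" for u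
    using length_successors_le[of "take k as" u] by simp
  have "l < m" using l_le[of a] assms(1) by (simp add: l_def)
  have effect: "effect adjacency_step \<sigma> ''deg'' = (\<sigma> ''deg'')(a := Suc l)"
    "effect adjacency_step \<sigma> ''adj'' = (\<sigma> ''adj'')(a * m + l := b)"
    using \<sigma>(1,4) edge deg by (simp_all add: adjacency_step_def header_def store_apply)
  have "adjacency (take (Suc k) as) (effect adjacency_step \<sigma>)"
    unfolding adjacency_def
  proof (intro allI impI conjI)
    fix u assume u: "u < n"
    then have old: "\<sigma> ''deg'' u = length (successors (take k as) u)"
      "\<And>j. j < length (successors (take k as) u) \<Longrightarrow> \<sigma> ''adj'' (u * m + j) = successors (take k as) u ! j"
      using \<sigma>(3) by (simp_all add: adjacency_def)
    have successors: "successors (take (Suc k) as) u = successors (take k as) u @ (if a = u then [b] else [])"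
      using ab(1) by (simp add: take_Suc_edges[OF assms(1)])
    show "effect adjacency_step \<sigma> ''deg'' u = length (successors (take (Suc k) as) u)"
      using old(1) successors by (simp add: effect l_def)
    fix j assume j: "j < length (successors (take (Suc k) as) u)"
    then have "j < m" using length_successors_le[of "take (Suc k) as" u] assms(1) by simp
    then show "effect adjacency_step \<sigma> ''adj'' (u * m + j) = successors (take (Suc k) as) u ! j"
      using j old(2) successors code_eq_iff[OF _ \<open>l < m\<close>, of j u a]
      by (auto simp: effect l_def nth_append less_Suc_eq split: if_splits)
  qed
  moreover have "safe W adjacency_step \<sigma>"
    using \<sigma>(1,4) edge deg ab(2,3) \<open>l < m\<close> assms(1)
    by (simp add: adjacency_step_def header_def store_apply index_less_W)
  ultimately show ?thesis by simp
qed

lemma build_adjacency_correct: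
  "triple W (\<lambda>\<sigma>. (header \<sigma> \<and> edge_arrays \<sigma>) \<and> zeroed ''deg'' \<sigma>) build_adjacency
    ((cost adjacency_step + 12) * (m + 1)) (adjacency as)"
proof -
  have loop: "triple W (\<lambda>\<sigma>. (header \<sigma> \<and> edge_arrays \<sigma>) \<and> adjacency (take 0 as) \<sigma>) build_adjacency
      ((cost adjacency_step + expr_cost (Var ''m'') + 10) * (m + 1))
      (\<lambda>\<sigma>. (header \<sigma> \<and> edge_arrays \<sigma>) \<and> adjacency (take m as) \<sigma>)"
    unfolding build_adjacency_def
  proof (rule triple_For_loop_free)
    show "preserved (insert ''i'' (writes adjacency_step)) (\<lambda>\<sigma>. header \<sigma> \<and> edge_arrays \<sigma>)"
      by (intro preserved_intros) simp_all
    show "preserved {''i''} (adjacency (take k as))" for k by (intro preserved_intros) simp_all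
  qed (use adjacency_step_correct in \<open>simp_all add: header_def\<close>)
  show ?thesis
    by (rule triple_conseq[OF loop]) (simp_all add: adjacency_def zeroed_def length_edges)
qed

definition search_inv :: "state \<Rightarrow> bool" where
  "search_inv \<sigma> \<longleftrightarrow> distinct (queue \<sigma>) \<and> set (queue \<sigma>) \<subseteq> alive (set as) \<and>
     bit_matrix ''reach'' (set (queue \<sigma>)) \<sigma>"

definition all_seeded :: "nat \<Rightarrow> state \<Rightarrow> bool" where
  "all_seeded k \<sigma> \<longleftrightarrow> (\<forall>w<k. w \<noteq> s \<longrightarrow> (w, s) \<in> set (queue \<sigma>))"

lemma preserved_search_inv [preserved_intros]:
  assumes "''reach'' \<notin> X" "''queue_copy'' \<notin> X" "''queue_vertex'' \<notin> X" "''queue_len'' \<notin> X"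
  shows "preserved X search_inv"
  unfolding preserved_def
proof (intro allI impI)
  fix \<sigma> \<tau> assume inv: "search_inv \<sigma>" and agree: "agree X \<sigma> \<tau>"
  have "queue \<tau> = queue \<sigma>" "\<tau> ''reach'' = \<sigma> ''reach''"
    using queue_cong[OF agree] agreeD[OF agree] assms by simp_all
  with inv show "search_inv \<tau>" by (simp add: search_inv_def bit_matrix_def)
qed

lemma preserved_all_seeded [preserved_intros]:
  "''queue_copy'' \<notin> X \<Longrightarrow> ''queue_vertex'' \<notin> X \<Longrightarrow> ''queue_len'' \<notin> X \<Longrightarrow> preserved X (all_seeded k)"
  by (simp add: preserved_def queue_cong all_seeded_def)

lemma search_step_correct:
  assumes \<sigma>: "bounded_state W \<sigma>" "header \<sigma>" "\<sigma> ''w'' 0 = w" "\<sigma> ''y'' 0 = y" "w \<le> n" "y < n"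
    and inv: "search_inv \<sigma>" and alive: "y \<noteq> w \<Longrightarrow> (w, y) \<in> alive (set as)"
  shows "safe W search_step \<sigma> \<and> search_inv (effect search_step \<sigma>) \<and>
    prefix (queue \<sigma>) (queue (effect search_step \<sigma>)) \<and>
    (y \<noteq> w \<longrightarrow> (w, y) \<in> set (queue (effect search_step \<sigma>)))"
proof -
  define new where "new \<longleftrightarrow> y \<noteq> w \<and> (w, y) \<notin> set (queue \<sigma>)"
  define \<rho> where "\<rho> = store \<sigma> ''reach'' (w * n + y) 1"
  have queue_inv: "distinct (queue \<sigma>)" "set (queue \<sigma>) \<subseteq> alive (set as)"
    "bit_matrix ''reach'' (set (queue \<sigma>)) \<sigma>" using inv by (simp_all add: search_inv_def)
  then have len: "\<sigma> ''queue_len'' 0 + 1 < W" using alive_subset by (intro queue_len_less) blast+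
  have "agree {''reach''} \<sigma> \<rho>" by (simp add: \<rho>_def agree_store)
  then have "queue \<rho> = queue \<sigma>" by (rule queue_cong) simp_all
  then have queue_\<rho>: "queue (effect push \<rho>) = queue \<sigma> @ [(w, y)]"
    using \<sigma>(3,4) by (simp add: queue_push \<rho>_def store_apply)
  have "safe W push \<rho>"
    using \<sigma>(1) len unfolding \<rho>_def by (intro safe_push bounded_state_store) (simp_all add: store_apply)
  moreover have "\<sigma> ''reach'' (w * n + y) = of_bool ((w, y) \<in> set (queue \<sigma>))"
    using queue_inv(3) \<sigma>(5,6) by (simp add: bit_matrix_def)
  ultimately have step: "safe W search_step \<sigma>" "effect search_step \<sigma> = (if new then effect push \<rho> else \<sigma>)"
    using \<sigma> by (simp_all add: search_step_def header_def index_less_W new_def \<rho>_def)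
  show ?thesis
  proof (cases new)
    case True
    have "effect push \<rho> ''reach'' = \<rho> ''reach''" by (rule agreeD[OF agree_effect]) simp
    then have "bit_matrix ''reach'' (insert (w, y) (set (queue \<sigma>))) (effect push \<rho>)"
      using queue_inv(3) \<sigma>(6) by (intro bit_matrix_insert) (simp_all add: \<rho>_def store_apply)
    then have "search_inv (effect push \<rho>)"
      using queue_inv(1,2) True alive by (simp add: search_inv_def queue_\<rho> new_def)
    with True step show ?thesis by (simp add: queue_\<rho>)
  next
    case False
    with step inv show ?thesis by (auto simp: new_def)
  qed
qed

lemma search_seed_correct:
  "triple W (\<lambda>\<sigma>. header \<sigma> \<and> zeroed ''reach'' \<sigma> \<and> \<sigma> ''queue_len'' 0 = 0) search_seed
    (4 + (cost search_step + 14) * (n + 2)) (\<lambda>\<sigma>. search_inv \<sigma> \<and> all_seeded (n + 1) \<sigma>)"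
proof -
  define R where "R \<sigma> \<longleftrightarrow> header \<sigma> \<and> \<sigma> ''y'' 0 = s" for \<sigma>
  define I where "I k \<sigma> \<longleftrightarrow> search_inv \<sigma> \<and> all_seeded k \<sigma>" for k \<sigma>
  have "triple W (\<lambda>\<sigma>. header \<sigma> \<and> zeroed ''reach'' \<sigma> \<and> \<sigma> ''queue_len'' 0 = 0)
      (Put ''y'' (Var ''s'')) (cost (Put ''y'' (Var ''s''))) (\<lambda>\<sigma>. R \<sigma> \<and> I 0 \<sigma>)"
    by (rule triple_loop_free)
      (simp add: R_def I_def header_def zeroed_def search_inv_def all_seeded_def bit_matrix_def
        queue_def store_apply)
  moreover have "triple W (\<lambda>\<sigma>. R \<sigma> \<and> I 0 \<sigma>) (For ''w'' copies search_step)
      ((cost search_step + expr_cost copies + 10) * ((n + 1) + 1)) (\<lambda>\<sigma>. R \<sigma> \<and> I (n + 1) \<sigma>)"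
  proof (rule triple_For_loop_free)
    show "preserved (insert ''w'' (writes search_step)) R"
      unfolding R_def by (intro preserved_intros) simp_all
    show "preserved {''w''} (I k)" for k unfolding I_def by (intro preserved_intros) simp_all
    show "expr_fits W copies \<sigma> \<and> expr_val copies \<sigma> = n + 1" if "R \<sigma>" for \<sigma>
      using that by (simp add: R_def header_def)
  next
    fix w \<sigma>
    assume w: "w < n + 1" and \<sigma>: "bounded_state W \<sigma>" "R \<sigma>" "I w \<sigma>" "\<sigma> ''w'' 0 = w"
    have "safe W search_step \<sigma> \<and> search_inv (effect search_step \<sigma>) \<and>
        prefix (queue \<sigma>) (queue (effect search_step \<sigma>)) \<and>
        (s \<noteq> w \<longrightarrow> (w, s) \<in> set (queue (effect search_step \<sigma>)))"
      using w \<sigma> start by (intro search_step_correct) (auto simp: R_def I_def alive_def)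
    moreover from this have "set (queue \<sigma>) \<subseteq> set (queue (effect search_step \<sigma>))"
      by (blast dest: set_mono_prefix)
    ultimately show "safe W search_step \<sigma> \<and> I (Suc w) (effect search_step \<sigma>)"
      using \<sigma>(3) by (auto simp: I_def all_seeded_def less_Suc_eq)
  qed simp_all
  ultimately have "triple W (\<lambda>\<sigma>. header \<sigma> \<and> zeroed ''reach'' \<sigma> \<and> \<sigma> ''queue_len'' 0 = 0) search_seed
      (cost (Put ''y'' (Var ''s'')) + (cost search_step + expr_cost copies + 10) * ((n + 1) + 1))
      (\<lambda>\<sigma>. R \<sigma> \<and> I (n + 1) \<sigma>)"
    unfolding search_seed_def by (rule triple_Seq)
  then show ?thesis by (rule triple_conseq) (simp_all add: I_def)
qed

lemma search_closed:
  assumes "search_inv \<sigma>" "all_seeded (n + 1) \<sigma>"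
    and closed: "\<And>w x y. (w, x) \<in> set (queue \<sigma>) \<Longrightarrow> (x, y) \<in> set as \<Longrightarrow> y \<noteq> w \<Longrightarrow> (w, y) \<in> set (queue \<sigma>)"
  shows "bit_matrix ''reach'' (alive (set as)) \<sigma>"
proof -
  have "(w, y) \<in> set (queue \<sigma>)" if "w \<le> n" "avoids s (set as) w y" for w y
    using that(2)
  proof (induction rule: avoids_induct)
    case start
    then show ?case using assms(2) that(1) by (simp add: all_seeded_def)
  next
    case (step x y)
    then show ?case using closed by blast
  qed
  then have "alive (set as) \<subseteq> set (queue \<sigma>)" by (auto simp: alive_def)
  then have "set (queue \<sigma>) = alive (set as)" using assms(1) by (simp add: search_inv_def subset_antisym)
  with assms(1) show ?thesis by (simp add: search_inv_def)
qed

definition searched :: "(nat \<times> nat \<times> nat) set \<Rightarrow> state \<Rightarrow> bool" where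
  "searched D \<sigma> \<longleftrightarrow> search_inv \<sigma> \<and> all_seeded (n + 1) \<sigma> \<and>
     (\<forall>(w, x, y)\<in>D. y \<noteq> w \<longrightarrow> (w, y) \<in> set (queue \<sigma>))"

lemma preserved_searched:
  assumes "''reach'' \<notin> X" "''queue_copy'' \<notin> X" "''queue_vertex'' \<notin> X" "''queue_len'' \<notin> X"
  shows "preserved X (searched D)"
proof -
  have "preserved X (\<lambda>\<sigma>. \<forall>(w, x, y)\<in>D. y \<noteq> w \<longrightarrow> (w, y) \<in> set (queue \<sigma>))"
    using assms by (simp add: preserved_def queue_cong)
  with assms show ?thesis unfolding searched_def by (intro preserved_intros)
qed

lemma search_worklist_invariant:
  "worklist_invariant n m s W as search_step (alive (set as)) (\<lambda>\<sigma>. header \<sigma> \<and> adjacency as \<sigma>) searched"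
proof unfold_locales
  show "preserved (worklist_control \<union> writes search_step) (\<lambda>\<sigma>. header \<sigma> \<and> adjacency as \<sigma>)"
    by (intro preserved_intros) (simp_all add: worklist_control_def)
  show "preserved worklist_control (searched D)" for D
    by (intro preserved_searched) (simp_all add: worklist_control_def)
next
  fix D \<sigma> w x y
  assume \<sigma>: "bounded_state W \<sigma>" "header \<sigma> \<and> adjacency as \<sigma>" "searched D \<sigma>"
      "\<sigma> ''w'' 0 = w" "\<sigma> ''x'' 0 = x" "\<sigma> ''y'' 0 = y"
    and wx: "(w, x) \<in> set (queue \<sigma>)" and xy: "(x, y) \<in> set as"
  have "(w, x) \<in> alive (set as)" using \<sigma>(3) wx by (auto simp: searched_def search_inv_def)
  then have bounds: "w \<le> n" "y < n" and alive: "y \<noteq> w \<Longrightarrow> (w, y) \<in> alive (set as)"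
    using xy edge_bounded alive_bounds alive_step by blast+
  have step: "safe W search_step \<sigma> \<and> search_inv (effect search_step \<sigma>) \<and>
      prefix (queue \<sigma>) (queue (effect search_step \<sigma>)) \<and>
      (y \<noteq> w \<longrightarrow> (w, y) \<in> set (queue (effect search_step \<sigma>)))"
    using \<sigma> bounds alive by (intro search_step_correct) (simp_all add: searched_def)
  then have "set (queue \<sigma>) \<subseteq> set (queue (effect search_step \<sigma>))" by (blast dest: set_mono_prefix)
  with step show "safe W search_step \<sigma> \<and> prefix (queue \<sigma>) (queue (effect search_step \<sigma>)) \<and>
      searched (insert (w, x, y) D) (effect search_step \<sigma>)"
    using \<sigma>(3) by (auto simp: searched_def all_seeded_def)
qed (use alive_subset in \<open>auto simp: searched_def search_inv_def worklist_control_def\<close>)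

lemma search_correct:
  "triple W
    (\<lambda>\<sigma>. header \<sigma> \<and> adjacency as \<sigma> \<and> zeroed ''reach'' \<sigma> \<and> \<sigma> ''queue_len'' 0 = 0) search
    ((4 + (cost search_step + 14) * (n + 2)) + (9 + sum (weight (cost search_step)) (alive (set as))))
    (bit_matrix ''reach'' (alive (set as)))"
  unfolding search_def
proof (rule triple_Seq)
  have "preserved (writes search_seed) (\<lambda>\<sigma>. header \<sigma> \<and> adjacency as \<sigma>)"
    by (intro preserved_intros) (simp_all add: search_seed_def)
  with search_seed_correct
  show "triple W (\<lambda>\<sigma>. header \<sigma> \<and> adjacency as \<sigma> \<and> zeroed ''reach'' \<sigma> \<and> \<sigma> ''queue_len'' 0 = 0)
      search_seed (4 + (cost search_step + 14) * (n + 2))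
      (\<lambda>\<sigma>. (header \<sigma> \<and> adjacency as \<sigma>) \<and> searched {} \<sigma>)"
    by (rule triple_frame) (simp_all add: searched_def)
  interpret worklist_invariant n m s W as search_step "alive (set as)"
    "\<lambda>\<sigma>. header \<sigma> \<and> adjacency as \<sigma>" searched
    by (rule search_worklist_invariant)
  show "triple W (\<lambda>\<sigma>. (header \<sigma> \<and> adjacency as \<sigma>) \<and> searched {} \<sigma>) (worklist search_step)
      (9 + sum (weight (cost search_step)) (alive (set as))) (bit_matrix ''reach'' (alive (set as)))"
    using worklist_correct
  proof (rule triple_conseq)
    fix \<sigma> assume "(header \<sigma> \<and> adjacency as \<sigma>) \<and> searched (out_edges (set (queue \<sigma>))) \<sigma>"
    then show "bit_matrix ''reach'' (alive (set as)) \<sigma>"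
      by (intro search_closed) (auto simp: searched_def out_edges_def)
  qed simp_all
qed


subsection \<open>Forward edges and counters\<close>

lemma forward_step_correct:
  assumes "k < m" and \<sigma>: "header \<sigma>" "edge_arrays \<sigma>" "bit_matrix ''reach'' (alive (set as)) \<sigma>"
      "\<sigma> ''i'' 0 = k"
    and inv: "bit_matrix ''forward'' (set (take k as) \<inter> F0) \<sigma>"
  shows "safe W forward_step \<sigma> \<and>
    bit_matrix ''forward'' (set (take (Suc k) as) \<inter> F0) (effect forward_step \<sigma>)"
proof -
  obtain a b where ab: "as ! k = (a, b)" "a < n" "b < n" "(a, b) \<in> set as" "(a, b) \<notin> set (take k as)"
    using assms(1) by (rule edge_nth_cases)
  have edge: "\<sigma> ''tail'' k = a" "\<sigma> ''head'' k = b" using edge_arrays_nth[OF \<sigma>(2) assms(1) ab(1)] by simp_all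
  have reach: "\<sigma> ''reach'' (b * n + a) = of_bool ((a, b) \<in> F0)"
    using \<sigma>(3) ab by (simp add: bit_matrix_def alive_def forward_edges_def)
  have effect: "effect forward_step \<sigma> ''forward'' = (\<sigma> ''forward'')(a * n + b := of_bool ((a, b) \<in> F0))"
    using \<sigma>(1,4) edge reach by (simp add: forward_step_def header_def store_apply)
  have "bit_matrix ''forward'' (set (take (Suc k) as) \<inter> F0) (effect forward_step \<sigma>)"
  proof (cases "(a, b) \<in> F0")
    case True
    with inv effect ab(3)
    have "bit_matrix ''forward'' (insert (a, b) (set (take k as) \<inter> F0)) (effect forward_step \<sigma>)"
      by (intro bit_matrix_insert) simp_all
    with True ab(1) show ?thesis by (simp add: take_Suc_edges[OF assms(1)] Int_insert_left)
  next
    case False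
    with inv effect ab(3)
    have "bit_matrix ''forward'' (set (take k as) \<inter> F0 - {(a, b)}) (effect forward_step \<sigma>)"
      by (intro bit_matrix_remove) simp_all
    with False ab(1,5) show ?thesis by (simp add: take_Suc_edges[OF assms(1)] Int_insert_left)
  qed
  moreover have "safe W forward_step \<sigma>"
    using \<sigma>(1,4) edge ab(2,3) assms(1) reach by (simp add: forward_step_def header_def index_less_W)
  ultimately show ?thesis by simp
qed

lemma mark_forward_correct:
  "triple W
    (\<lambda>\<sigma>. (header \<sigma> \<and> edge_arrays \<sigma> \<and> bit_matrix ''reach'' (alive (set as)) \<sigma>) \<and> zeroed ''forward'' \<sigma>)
    mark_forward ((cost forward_step + 12) * (m + 1)) (bit_matrix ''forward'' F0)"
proof -
  define R where "R \<sigma> \<longleftrightarrow> header \<sigma> \<and> edge_arrays \<sigma> \<and> bit_matrix ''reach'' (alive (set as)) \<sigma>" for \<sigma>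
  define I where "I k = bit_matrix ''forward'' (set (take k as) \<inter> F0)" for k
  have loop: "triple W (\<lambda>\<sigma>. R \<sigma> \<and> I 0 \<sigma>) mark_forward
      ((cost forward_step + expr_cost (Var ''m'') + 10) * (m + 1)) (\<lambda>\<sigma>. R \<sigma> \<and> I m \<sigma>)"
    unfolding mark_forward_def
  proof (rule triple_For_loop_free)
    show "preserved (insert ''i'' (writes forward_step)) R"
      unfolding R_def by (intro preserved_intros) simp_all
    show "preserved {''i''} (I k)" for k unfolding I_def by (intro preserved_intros) simp_all
    show "safe W forward_step \<sigma> \<and> I (Suc k) (effect forward_step \<sigma>)"
      if "k < m" "R \<sigma>" "I k \<sigma>" "\<sigma> ''i'' 0 = k" for k \<sigma>
      using that forward_step_correct by (simp add: R_def I_def)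
  qed (simp_all add: R_def header_def)
  have "I 0 \<sigma> \<longleftrightarrow> bit_matrix ''forward'' {} \<sigma>" "I m \<sigma> \<longleftrightarrow> bit_matrix ''forward'' F0 \<sigma>" for \<sigma>
    using F0_subset by (simp_all add: I_def length_edges Int_absorb1)
  then show ?thesis
    by (intro triple_conseq[OF loop]) (simp_all add: R_def zeroed_def bit_matrix_def)
qed

lemma count_start_correct:
  "triple W (\<lambda>\<sigma>. header \<sigma> \<and> zeroed ''count'' \<sigma>) count_start ((cost count_start_step + 14) * (n + 2))
    (counts {})"
proof -
  define I where "I k \<sigma> \<longleftrightarrow> (\<forall>w\<le>n. \<forall>y<n. \<sigma> ''count'' (w * n + y) = (if w < k then in_count {} w y else 0))"
    for k and \<sigma> :: state
  have loop: "triple W (\<lambda>\<sigma>. header \<sigma> \<and> I 0 \<sigma>) count_start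
      ((cost count_start_step + expr_cost copies + 10) * ((n + 1) + 1)) (\<lambda>\<sigma>. header \<sigma> \<and> I (n + 1) \<sigma>)"
    unfolding count_start_def
  proof (rule triple_For_loop_free)
    show "preserved (insert ''w'' (writes count_start_step)) header" by (intro preserved_intros) simp_all
    show "preserved {''w''} (I k)" for k by (simp add: preserved_def agree_def I_def)
  next
    fix w \<sigma>
    assume w: "w < n + 1" and \<sigma>: "header \<sigma>" "I w \<sigma>" "\<sigma> ''w'' 0 = w"
    have effect: "effect count_start_step \<sigma> ''count'' (w' * n + y) =
        (if w \<noteq> s \<and> w' = w \<and> y = s then 1 else \<sigma> ''count'' (w' * n + y))" if "y < n" for w' y
      using \<sigma>(1,3) code_eq_iff[OF that start, of w' w]
      by (simp add: count_start_step_def header_def store_apply)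
    have "I (Suc w) (effect count_start_step \<sigma>)"
      using \<sigma>(2) by (auto simp: I_def effect in_count_def less_Suc_eq)
    moreover have "safe W count_start_step \<sigma>"
      using \<sigma>(1,3) w start by (simp add: count_start_step_def header_def index_less_W)
    ultimately show "safe W count_start_step \<sigma> \<and> I (Suc w) (effect count_start_step \<sigma>)" by simp
  qed (simp_all add: header_def)
  show ?thesis by (rule triple_conseq[OF loop]) (simp_all add: I_def zeroed_def counts_def)
qed

definition counting_input :: "state \<Rightarrow> bool" where
  "counting_input \<sigma> \<longleftrightarrow> header \<sigma> \<and> edge_arrays \<sigma> \<and> bit_matrix ''reach'' (alive (set as)) \<sigma> \<and>
     bit_matrix ''forward'' F0 \<sigma>"

lemma preserved_counting_input [preserved_intros]:
  assumes "X \<inter> {''n'', ''m'', ''s'', ''tail'', ''head'', ''reach'', ''forward''} = {}"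
  shows "preserved X counting_input"
proof -
  have "preserved X (\<lambda>\<sigma>. header \<sigma> \<and> edge_arrays \<sigma> \<and> bit_matrix ''reach'' (alive (set as)) \<sigma> \<and>
      bit_matrix ''forward'' F0 \<sigma>)"
    using assms by (intro preserved_intros) auto
  then show ?thesis by (simp add: counting_input_def[abs_def])
qed

lemma count_step_correct:
  assumes "k < m" "as ! k = (a, b)" and \<sigma>: "counting_input \<sigma>" "\<sigma> ''i'' 0 = k" "\<sigma> ''w'' 0 = w" "w \<le> n"
    and P: "counts P \<sigma>" "P \<subseteq> alive_edges F0" "(w, a, b) \<notin> P"
  shows "safe W count_step \<sigma> \<and> counts (P \<union> {(w, a, b)} \<inter> alive_edges F0) (effect count_step \<sigma>)"
proof -
  have ab: "a < n" "b < n" using assms(1,2) edge_nth_cases by (metis Pair_inject)+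
  have alive: "alive F0 = alive (set as)" using alive_Int_F0[of "set as"] F0_subset by (simp add: Int_absorb1)
  define hit where "hit \<longleftrightarrow> (w, a, b) \<in> alive_edges F0"
  define c where "c = in_count P w b"
  have header: "\<sigma> ''n'' 0 = n" using \<sigma>(1) by (simp add: counting_input_def header_def)
  have edge: "\<sigma> ''tail'' k = a" "\<sigma> ''head'' k = b"
    using edge_arrays_nth[OF _ assms(1,2)] \<sigma>(1) by (simp_all add: counting_input_def)
  have bits: "\<sigma> ''reach'' (w * n + a) = of_bool ((w, a) \<in> alive F0)"
    "\<sigma> ''forward'' (a * n + b) = of_bool ((a, b) \<in> F0)"
    using \<sigma>(1,4) ab by (simp_all add: counting_input_def bit_matrix_def alive)
  have count: "\<sigma> ''count'' (w * n + b) = c" using P(1) \<sigma>(4) ab by (simp add: counts_def c_def)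
  have "alive_edges F0 \<subseteq> {..n} \<times> {..<n} \<times> UNIV" using alive_bounds by (auto simp: alive_edges_def)
  then have "c \<le> n" using P(2) unfolding c_def by (intro in_count_le) blast
  then have "safe W count_step \<sigma>"
    using header edge bits count \<sigma>(2-4) ab assms(1) by (simp add: count_step_def index_less_W)
  moreover have "counts (P \<union> {(w, a, b)} \<inter> alive_edges F0) (effect count_step \<sigma>)"
  proof (cases hit)
    case True
    have "finite P" using P(2) F0_subset finite_alive_edges by (meson finite_subset)
    have "b \<noteq> s" using True F0_edge by (auto simp: hit_def alive_edges_def)
    have "effect count_step \<sigma> ''count'' =
        (if b \<noteq> w then (\<sigma> ''count'')(w * n + b := Suc c) else \<sigma> ''count'')"
      using True header edge bits count \<sigma>(2,3)
      by (simp add: count_step_def store_apply hit_def alive_edges_def)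
    then have "counts (insert (w, a, b) P) (effect count_step \<sigma>)"
      using P(1) code_eq_iff[OF _ ab(2)]
      by (auto simp: counts_def in_count_insert[OF \<open>finite P\<close> P(3) \<open>b \<noteq> s\<close>] c_def)
    with True show ?thesis by (simp add: hit_def)
  next
    case False
    then have "effect count_step \<sigma> = \<sigma>"
      using header edge bits \<sigma>(2,3) by (auto simp: count_step_def hit_def alive_edges_def)
    with False P(1) show ?thesis by (simp add: hit_def)
  qed
  ultimately show ?thesis by simp
qed

lemma count_row_correct:
  assumes "w \<le> n"
  shows "triple W
    (\<lambda>\<sigma>. (counting_input \<sigma> \<and> \<sigma> ''w'' 0 = w) \<and> counts (alive_edges F0 \<inter> {..<w} \<times> UNIV) \<sigma>)
    count_row ((cost count_step + 12) * (m + 1)) (counts (alive_edges F0 \<inter> {..<Suc w} \<times> UNIV))"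
proof -
  define P where "P k = alive_edges F0 \<inter> ({..<w} \<times> UNIV \<union> {w} \<times> set (take k as))" for k
  have loop: "triple W (\<lambda>\<sigma>. (counting_input \<sigma> \<and> \<sigma> ''w'' 0 = w) \<and> counts (P 0) \<sigma>) count_row
      ((cost count_step + expr_cost (Var ''m'') + 10) * (m + 1))
      (\<lambda>\<sigma>. (counting_input \<sigma> \<and> \<sigma> ''w'' 0 = w) \<and> counts (P m) \<sigma>)"
    unfolding count_row_def
  proof (rule triple_For_loop_free)
    show "preserved (insert ''i'' (writes count_step)) (\<lambda>\<sigma>. counting_input \<sigma> \<and> \<sigma> ''w'' 0 = w)"
      by (intro preserved_intros) simp_all
    show "preserved {''i''} (counts (P k))" for k by (intro preserved_intros) simp_all
  next
    fix k \<sigma>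
    assume k: "k < m" and \<sigma>: "counting_input \<sigma> \<and> \<sigma> ''w'' 0 = w" "counts (P k) \<sigma>" "\<sigma> ''i'' 0 = k"
    obtain a b where ab: "as ! k = (a, b)" "(a, b) \<notin> set (take k as)" using k by (rule edge_nth_cases)
    have "P (Suc k) = P k \<union> {(w, a, b)} \<inter> alive_edges F0"
      using ab(1) by (auto simp: P_def take_Suc_edges[OF k])
    moreover have "(w, a, b) \<notin> P k" using ab(2) by (simp add: P_def)
    ultimately show "safe W count_step \<sigma> \<and> counts (P (Suc k)) (effect count_step \<sigma>)"
      using count_step_correct[OF k ab(1), of \<sigma> w "P k"] \<sigma> assms by (simp add: P_def)
  qed (simp_all add: counting_input_def header_def)
  have "P 0 = alive_edges F0 \<inter> {..<w} \<times> UNIV" by (auto simp: P_def)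
  moreover have "P m = alive_edges F0 \<inter> {..<Suc w} \<times> UNIV"
    using F0_subset by (auto simp: P_def length_edges alive_edges_def less_Suc_eq)
  ultimately show ?thesis by (intro triple_conseq[OF loop]) simp_all
qed

lemma count_edges_correct:
  "triple W (\<lambda>\<sigma>. counting_input \<sigma> \<and> zeroed ''count'' \<sigma>) count_edges
    ((cost count_start_step + 14) * (n + 2) + ((cost count_step + 12) * (m + 1) + 14) * (n + 2))
    (counts (alive_edges F0))"
proof -
  define P where "P w = alive_edges F0 \<inter> {..<w} \<times> UNIV" for w
  define B where "B = (cost count_step + 12) * (m + 1)"
  have "triple W (\<lambda>\<sigma>. counting_input \<sigma> \<and> zeroed ''count'' \<sigma>) count_start
      ((cost count_start_step + 14) * (n + 2)) (\<lambda>\<sigma>. counting_input \<sigma> \<and> counts (P 0) \<sigma>)"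
    using count_start_correct
  proof (rule triple_frame[where R = counting_input])
    show "preserved (writes count_start) counting_input"
      by (intro preserved_intros) (simp add: count_start_def)
  qed (simp_all add: counting_input_def P_def)
  moreover have "triple W (\<lambda>\<sigma>. counting_input \<sigma> \<and> counts (P 0) \<sigma>) (For ''w'' copies count_row)
      ((\<Sum>w<n + 1. B + expr_cost copies + 10) + expr_cost copies + 10)
      (\<lambda>\<sigma>. counting_input \<sigma> \<and> counts (P (n + 1)) \<sigma>)"
  proof (rule triple_For)
    show "preserved (insert ''w'' (writes count_row)) counting_input" by (intro preserved_intros) simp
    show "preserved {''w''} (counts (P k))" for k by (intro preserved_intros) simp
    show "triple W (\<lambda>\<sigma>. counting_input \<sigma> \<and> counts (P w) \<sigma> \<and> \<sigma> ''w'' 0 = w) count_row B (counts (P (Suc w)))"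
      if "w < n + 1" for w
      unfolding B_def P_def by (rule triple_conseq[OF count_row_correct]) (use that in simp_all)
  qed (simp_all add: counting_input_def header_def)
  ultimately have loops: "triple W (\<lambda>\<sigma>. counting_input \<sigma> \<and> zeroed ''count'' \<sigma>) count_edges
      ((cost count_start_step + 14) * (n + 2) +
        ((\<Sum>w<n + 1. B + expr_cost copies + 10) + expr_cost copies + 10))
      (\<lambda>\<sigma>. counting_input \<sigma> \<and> counts (P (n + 1)) \<sigma>)"
    unfolding count_edges_def by (rule triple_Seq)
  have "P (n + 1) = alive_edges F0" by (auto simp: P_def alive_edges_def alive_def)
  then show ?thesis by (intro triple_conseq[OF loops]) (simp_all add: B_def algebra_simps)
qed


subsection \<open>The first tree\<close>

definition tree_upto :: "nat \<Rightarrow> state \<Rightarrow> bool" where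
  "tree_upto k \<sigma> \<longleftrightarrow> (\<forall>v<n. \<sigma> ''parent'' v < n) \<and>
     (\<forall>v<k. (\<sigma> ''in_tree'' v \<noteq> 0 \<longleftrightarrow> (n, v) \<in> alive (set as)) \<and> parent_ok (set as) {..<n} v \<sigma>)"

definition tree_input :: "state \<Rightarrow> bool" where
  "tree_input \<sigma> \<longleftrightarrow> header \<sigma> \<and> counters_mark (alive (set as)) \<sigma>"

lemma preserved_tree_input [preserved_intros]:
  assumes "X \<inter> {''n'', ''m'', ''s'', ''count''} = {}"
  shows "preserved X tree_input"
proof -
  have "preserved X (\<lambda>\<sigma>. header \<sigma> \<and> counters_mark (alive (set as)) \<sigma>)"
    using assms by (intro preserved_intros) auto
  then show ?thesis by (simp add: tree_input_def[abs_def])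
qed

lemma preserved_tree_upto [preserved_intros]:
  "''in_tree'' \<notin> X \<Longrightarrow> ''parent'' \<notin> X \<Longrightarrow> preserved X (tree_upto k)"
  by (simp add: preserved_def agree_def tree_upto_def parent_ok_def)

lemma preserved_parent_ok [preserved_intros]: "''parent'' \<notin> X \<Longrightarrow> preserved X (parent_ok E S v)"
  by (simp add: preserved_def agree_def parent_ok_def)

lemma tree_upto_store_parent:
  "tree_upto x \<sigma> \<Longrightarrow> p < n \<Longrightarrow> tree_upto x (store \<sigma> ''parent'' x p)"
  by (simp add: tree_upto_def parent_ok_def store_apply)

lemma tree_step_correct:
  assumes \<sigma>: "bounded_state W \<sigma>" "tree_input \<sigma>" "\<sigma> ''w'' 0 = w" "\<sigma> ''x'' 0 = x" "w < n" "x < n"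
    and inv: "tree_upto x \<sigma>" "parent_ok (set as) {..<w} x \<sigma>"
  shows "safe W tree_step \<sigma> \<and> tree_upto x (effect tree_step \<sigma>) \<and>
    parent_ok (set as) {..<Suc w} x (effect tree_step \<sigma>)"
proof -
  define hit where "hit \<longleftrightarrow> w \<noteq> x \<and> (w, x) \<notin> alive (set as)"
  have input: "header \<sigma>" "counters_mark (alive (set as)) \<sigma>" using \<sigma>(2) by (simp_all add: tree_input_def)
  then have step: "effect tree_step \<sigma> = (if hit then effect reparent \<sigma> else \<sigma>)"
    "safe W tree_step \<sigma> \<longleftrightarrow> (hit \<longrightarrow> safe W reparent \<sigma>)"
    using counters_mark_zero[OF input(2), of w x] \<sigma>
    by (simp_all add: tree_step_def header_def index_less_W bounded_stateD hit_def)
  show ?thesis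
  proof (cases hit)
    case True
    obtain p where p: "safe W reparent \<sigma>" "effect reparent \<sigma> = store \<sigma> ''parent'' x p"
      "parent_ok (set as) (insert w {..<w}) x (effect reparent \<sigma>)"
      using reparent_correct[OF subset_refl \<sigma>(1) input \<sigma>(3,5,4,6) _ _ inv(2)] True unfolding hit_def
      by blast
    then have "p < n" by (simp add: parent_ok_def store_apply)
    with p True step tree_upto_store_parent[OF inv(1)] show ?thesis by (simp add: lessThan_Suc)
  next
    case False
    then have "w = x \<or> avoids s (set as) w x" using \<sigma>(5,6) by (auto simp: hit_def alive_def)
    then have "parent_ok (set as) (insert w {..<w}) x \<sigma>"
      using inv(2) by (simp add: parent_ok_def idom_among_insert_trivial)
    with False step inv(1) show ?thesis by (simp add: lessThan_Suc)
  qed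
qed

lemma tree_row_correct:
  assumes "x < n"
  shows "triple W (\<lambda>\<sigma>. tree_input \<sigma> \<and> \<sigma> ''x'' 0 = x \<and> tree_upto x \<sigma>) tree_row
    (5 + (cost tree_step + 12) * (n + 1))
    (\<lambda>\<sigma>. tree_upto x \<sigma> \<and> parent_ok (set as) {..<n} x \<sigma>)"
proof -
  define R where "R \<sigma> \<longleftrightarrow> tree_input \<sigma> \<and> \<sigma> ''x'' 0 = x" for \<sigma>
  define I where "I k \<sigma> \<longleftrightarrow> tree_upto x \<sigma> \<and> parent_ok (set as) {..<k} x \<sigma>" for k \<sigma>
  define reset where "reset = Assign ''parent'' (Var ''x'') (Var ''s'')"
  have "triple W (\<lambda>\<sigma>. R \<sigma> \<and> tree_upto x \<sigma>) reset (cost reset) (\<lambda>\<sigma>. R \<sigma> \<and> I 0 \<sigma>)"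
  proof (rule triple_loop_free)
    fix \<sigma> assume \<sigma>: "R \<sigma> \<and> tree_upto x \<sigma>"
    then have "header \<sigma>" by (simp add: R_def tree_input_def)
    with \<sigma> have effect: "effect reset \<sigma> = store \<sigma> ''parent'' x s"
      by (simp add: reset_def R_def header_def)
    have "preserved {''parent''} R" unfolding R_def by (intro preserved_intros) simp_all
    then have "R (store \<sigma> ''parent'' x s)"
      using \<sigma> agree_store[of "''parent''"] by (blast dest: preservedD)
    moreover have "I 0 (store \<sigma> ''parent'' x s)"
      using \<sigma> start tree_upto_store_parent by (simp add: I_def parent_ok_def store_apply idom_among_empty)
    moreover have "safe W reset \<sigma>"
      using \<sigma> \<open>header \<sigma>\<close> assms by (simp add: reset_def R_def header_def index_less_W)
    ultimately show "safe W reset \<sigma> \<and> R (effect reset \<sigma>) \<and> I 0 (effect reset \<sigma>)" by (simp add: effect)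
  qed
  moreover have "triple W (\<lambda>\<sigma>. R \<sigma> \<and> I 0 \<sigma>) (For ''w'' (Var ''n'') tree_step)
      ((cost tree_step + expr_cost (Var ''n'') + 10) * (n + 1)) (\<lambda>\<sigma>. R \<sigma> \<and> I n \<sigma>)"
  proof (rule triple_For_loop_free)
    show "preserved (insert ''w'' (writes tree_step)) R"
      unfolding R_def by (intro preserved_intros) simp_all
    show "preserved {''w''} (I k)" for k unfolding I_def by (intro preserved_intros) simp_all
    show "safe W tree_step \<sigma> \<and> I (Suc w) (effect tree_step \<sigma>)"
      if "w < n" "bounded_state W \<sigma>" "R \<sigma>" "I w \<sigma>" "\<sigma> ''w'' 0 = w" for w \<sigma>
      using that assms tree_step_correct by (simp add: R_def I_def)
  qed (simp_all add: R_def tree_input_def header_def)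
  ultimately have "triple W (\<lambda>\<sigma>. R \<sigma> \<and> tree_upto x \<sigma>) tree_row
      (cost reset + (cost tree_step + expr_cost (Var ''n'') + 10) * (n + 1)) (\<lambda>\<sigma>. R \<sigma> \<and> I n \<sigma>)"
    unfolding tree_row_def reset_def[symmetric] by (rule triple_Seq)
  then show ?thesis by (rule triple_conseq) (simp_all add: R_def I_def reset_def)
qed

lemma load_in_tree_correct:
  assumes "x < n"
  shows "triple W (\<lambda>\<sigma>. tree_input \<sigma> \<and> tree_upto x \<sigma> \<and> \<sigma> ''x'' 0 = x) load_in_tree (cost load_in_tree)
    (\<lambda>\<sigma>. tree_input \<sigma> \<and> \<sigma> ''x'' 0 = x \<and> tree_upto x \<sigma> \<and> (\<sigma> ''in_tree'' x \<noteq> 0 \<longleftrightarrow> (n, x) \<in> alive (set as)))"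
proof (rule triple_loop_free)
  fix \<sigma>
  assume bounded: "bounded_state W \<sigma>" and \<sigma>: "tree_input \<sigma> \<and> tree_upto x \<sigma> \<and> \<sigma> ''x'' 0 = x"
  then have input: "header \<sigma>" "counters_mark (alive (set as)) \<sigma>" by (simp_all add: tree_input_def)
  let ?\<tau> = "effect load_in_tree \<sigma>"
  have "tree_input ?\<tau> \<and> ?\<tau> ''x'' 0 = x \<and> tree_upto x ?\<tau> \<and>
      (?\<tau> ''in_tree'' x \<noteq> 0 \<longleftrightarrow> (n, x) \<in> alive (set as))"
    using \<sigma> counters_mark_zero[OF input(2) _ assms, of n]
    by (simp add: load_in_tree_def tree_input_def header_def counters_mark_def tree_upto_def
        parent_ok_def store_apply)
  moreover have "safe W load_in_tree \<sigma>"
    using \<sigma> input(1) assms bounded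
    by (simp add: load_in_tree_def header_def index_less_W bounded_stateD)
  ultimately show "safe W load_in_tree \<sigma> \<and> tree_input ?\<tau> \<and> ?\<tau> ''x'' 0 = x \<and> tree_upto x ?\<tau> \<and>
      (?\<tau> ''in_tree'' x \<noteq> 0 \<longleftrightarrow> (n, x) \<in> alive (set as))" by simp
qed

lemma tree_vertex_correct:
  assumes "x < n"
  shows "triple W (\<lambda>\<sigma>. tree_input \<sigma> \<and> tree_upto x \<sigma> \<and> \<sigma> ''x'' 0 = x) tree_vertex
    (30 + (if (n, x) \<in> alive (set as) then (cost tree_step + 12) * (n + 1) else 0)) (tree_upto (Suc x))"
proof -
  define P where "P \<sigma> \<longleftrightarrow> tree_input \<sigma> \<and> \<sigma> ''x'' 0 = x \<and> tree_upto x \<sigma> \<and>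
    (\<sigma> ''in_tree'' x \<noteq> 0 \<longleftrightarrow> (n, x) \<in> alive (set as))" for \<sigma>
  define b where "b = Equal (Cell ''in_tree'' (Var ''x'')) (Const 0)"
  define T where "T = 5 + (if (n, x) \<in> alive (set as) then (cost tree_step + 12) * (n + 1) else 0)"
  have "triple W P (If b Skip tree_row) (1 + cond_cost b + T) (tree_upto (Suc x))"
  proof (rule triple_If)
    show "cond_fits W b \<sigma>" if "bounded_state W \<sigma>" for \<sigma> using that by (simp add: b_def bounded_stateD)
    have "triple W (\<lambda>\<sigma>. P \<sigma> \<and> cond_val b \<sigma>) Skip (cost Skip) (tree_upto (Suc x))"
      using assms
      by (intro triple_loop_free) (auto simp: P_def b_def tree_upto_def parent_ok_def less_Suc_eq)
    then show "triple W (\<lambda>\<sigma>. P \<sigma> \<and> cond_val b \<sigma>) Skip T (tree_upto (Suc x))"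
      by (rule triple_conseq) (simp_all add: T_def)
    show "triple W (\<lambda>\<sigma>. P \<sigma> \<and> \<not> cond_val b \<sigma>) tree_row T (tree_upto (Suc x))"
    proof (rule triple_assume)
      show "(n, x) \<in> alive (set as)" if "P \<sigma> \<and> \<not> cond_val b \<sigma>" for \<sigma>
        using that by (auto simp: P_def b_def)
      assume alive: "(n, x) \<in> alive (set as)"
      have "preserved (writes tree_row) (\<lambda>\<sigma>. \<sigma> ''in_tree'' x \<noteq> 0)"
        by (simp add: preserved_def agree_def)
      with tree_row_correct[OF assms]
      have "triple W (\<lambda>\<sigma>. P \<sigma> \<and> \<not> cond_val b \<sigma>) tree_row (5 + (cost tree_step + 12) * (n + 1))
          (tree_upto (Suc x))"
        by (rule triple_frame) (use alive in \<open>auto simp: P_def b_def tree_upto_def less_Suc_eq\<close>)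
      then show "triple W (\<lambda>\<sigma>. P \<sigma> \<and> \<not> cond_val b \<sigma>) tree_row T (tree_upto (Suc x))"
        using alive by (simp add: T_def)
    qed
  qed
  then have "triple W (\<lambda>\<sigma>. tree_input \<sigma> \<and> tree_upto x \<sigma> \<and> \<sigma> ''x'' 0 = x) tree_vertex
      (cost load_in_tree + (1 + cond_cost b + T)) (tree_upto (Suc x))"
    unfolding tree_vertex_def b_def[symmetric] P_def[abs_def]
    by (rule triple_Seq[OF load_in_tree_correct[OF assms]])
  then show ?thesis by (rule triple_conseq) (simp_all add: T_def load_in_tree_def b_def)
qed

lemma build_tree_correct:
  "triple W (\<lambda>\<sigma>. tree_input \<sigma> \<and> zeroed ''parent'' \<sigma>) build_tree
    ((cost tree_step + 100) * ((n + 1) * (m + 1))) (tree_ok (set as))"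
proof -
  define B where "B x = 30 + (if (n, x) \<in> alive (set as) then (cost tree_step + 12) * (n + 1) else 0)" for x
  have loop: "triple W (\<lambda>\<sigma>. tree_input \<sigma> \<and> tree_upto 0 \<sigma>) build_tree
      ((\<Sum>x<n. B x + expr_cost (Var ''n'') + 10) + expr_cost (Var ''n'') + 10)
      (\<lambda>\<sigma>. tree_input \<sigma> \<and> tree_upto n \<sigma>)"
    unfolding build_tree_def
  proof (rule triple_For)
    show "preserved (insert ''x'' (writes tree_vertex)) tree_input" by (intro preserved_intros) simp
    show "preserved {''x''} (tree_upto k)" for k by (intro preserved_intros) simp_all
    show "triple W (\<lambda>\<sigma>. tree_input \<sigma> \<and> tree_upto x \<sigma> \<and> \<sigma> ''x'' 0 = x) tree_vertex (B x) (tree_upto (Suc x))"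
      if "x < n" for x
      unfolding B_def using that by (rule tree_vertex_correct)
  qed (simp_all add: tree_input_def header_def)
  have "(\<Sum>x<n. B x + expr_cost (Var ''n'') + 10) + expr_cost (Var ''n'') + 10 \<le>
      (cost tree_step + 100) * ((n + 1) * (m + 1))"
  proof -
    have "(\<Sum>x<n. B x + expr_cost (Var ''n'') + 10) =
        42 * n + (cost tree_step + 12) * (n + 1) * card {x. x < n \<and> avoids s (set as) n x}"
    proof -
      have "{..<n} \<inter> {x. (n, x) \<in> alive (set as)} = {x. x < n \<and> avoids s (set as) n x}"
        by (auto simp: alive_def)
      then show ?thesis by (simp add: B_def sum.distrib sum.If_cases)
    qed
    also have "\<dots> \<le> 42 * n + (cost tree_step + 12) * (n + 1) * (m + 1)"
      using card_avoids_le[OF subset_refl] by (intro add_left_mono mult_le_mono2)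
    finally show ?thesis by (simp add: algebra_simps)
  qed
  then show ?thesis
    by (rule triple_conseq[OF loop, rotated])
      (use start in \<open>simp_all add: tree_upto_def zeroed_def tree_ok_def\<close>)
qed


subsection \<open>The initial state\<close>

lemma bounded_state_input: "bounded_state W (input_state n s as)"
proof -
  have "fst (as ! i) < W" "snd (as ! i) < W" if "i < length as" for i
    using edge_bounded[of "fst (as ! i)" "snd (as ! i)"] that by (simp_all add: index_less_W)
  then show ?thesis by (simp add: bounded_state_def input_state_def length_edges)
qed

definition input_ok :: "state \<Rightarrow> bool" where
  "input_ok \<sigma> \<longleftrightarrow> (header \<sigma> \<and> edge_arrays \<sigma>) \<and> zeroed ''deg'' \<sigma> \<and>
     (zeroed ''reach'' \<sigma> \<and> \<sigma> ''queue_len'' 0 = 0) \<and>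
     (zeroed ''forward'' \<sigma> \<and> zeroed ''count'' \<sigma> \<and> zeroed ''parent'' \<sigma>)"

lemma input_ok_input: "input_ok (input_state n s as)"
  by (simp add: input_ok_def header_def edge_arrays_def zeroed_def input_state_def length_edges)

lemma build_tree_maintained:
  "triple W (\<lambda>\<sigma>. (header \<sigma> \<and> adjacency as \<sigma> \<and> bit_matrix ''forward'' F0 \<sigma> \<and>
      counts (alive_edges F0) \<sigma>) \<and> zeroed ''parent'' \<sigma>)
    build_tree ((cost tree_step + 100) * ((n + 1) * (m + 1))) (maintained (set as))"
  using build_tree_correct
proof (rule triple_frame[where R = "\<lambda>\<sigma>. header \<sigma> \<and> adjacency as \<sigma> \<and>
    bit_matrix ''forward'' F0 \<sigma> \<and> counts (alive_edges F0) \<sigma>"])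
  show "preserved (writes build_tree) (\<lambda>\<sigma>. header \<sigma> \<and> adjacency as \<sigma> \<and>
      bit_matrix ''forward'' F0 \<sigma> \<and> counts (alive_edges F0) \<sigma>)"
    by (intro preserved_intros) (simp_all add: build_tree_def)
  have F0: "set as \<inter> F0 = F0" using F0_subset by blast
  have "counters_mark (alive (set as)) \<sigma>" if "counts (alive_edges F0) \<sigma>" for \<sigma>
    using counts_alive_edges[OF F0_subset that] alive_Int_F0[OF subset_refl] by (simp add: F0)
  then show "(tree_input \<sigma> \<and> zeroed ''parent'' \<sigma>) \<and> header \<sigma> \<and> adjacency as \<sigma> \<and>
      bit_matrix ''forward'' F0 \<sigma> \<and> counts (alive_edges F0) \<sigma>"
    if "(header \<sigma> \<and> adjacency as \<sigma> \<and> bit_matrix ''forward'' F0 \<sigma> \<and> counts (alive_edges F0) \<sigma>) \<and>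
      zeroed ''parent'' \<sigma>" for \<sigma>
    using that by (simp add: tree_input_def)
  show "maintained (set as) \<sigma>" if "tree_ok (set as) \<sigma>" "header \<sigma> \<and> adjacency as \<sigma> \<and>
      bit_matrix ''forward'' F0 \<sigma> \<and> counts (alive_edges F0) \<sigma>" for \<sigma>
    using that by (simp add: maintained_def F0)
qed

lemma count_edges_build_tree:
  "triple W (\<lambda>\<sigma>. counting_input \<sigma> \<and> adjacency as \<sigma> \<and> zeroed ''count'' \<sigma> \<and> zeroed ''parent'' \<sigma>)
    (Seq count_edges build_tree)
    (((cost count_start_step + 14) * (n + 2) + ((cost count_step + 12) * (m + 1) + 14) * (n + 2)) +
      (cost tree_step + 100) * ((n + 1) * (m + 1)))
    (maintained (set as))"
proof (rule triple_Seq[OF _ build_tree_maintained])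
  define R where "R \<sigma> \<longleftrightarrow> header \<sigma> \<and> adjacency as \<sigma> \<and> bit_matrix ''forward'' F0 \<sigma> \<and> zeroed ''parent'' \<sigma>"
    for \<sigma>
  have "preserved (writes count_edges) R"
    unfolding R_def by (intro preserved_intros) (simp_all add: count_edges_def count_start_def)
  with count_edges_correct
  show "triple W (\<lambda>\<sigma>. counting_input \<sigma> \<and> adjacency as \<sigma> \<and> zeroed ''count'' \<sigma> \<and> zeroed ''parent'' \<sigma>)
      count_edges
      ((cost count_start_step + 14) * (n + 2) + ((cost count_step + 12) * (m + 1) + 14) * (n + 2))
      (\<lambda>\<sigma>. (header \<sigma> \<and> adjacency as \<sigma> \<and> bit_matrix ''forward'' F0 \<sigma> \<and> counts (alive_edges F0) \<sigma>) \<and>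
        zeroed ''parent'' \<sigma>)"
    by (rule triple_frame) (simp_all add: R_def counting_input_def)
qed

lemma adjacency_search_forward:
  "triple W input_ok (Seq build_adjacency (Seq search mark_forward))
    ((cost adjacency_step + 12) * (m + 1) + (((4 + (cost search_step + 14) * (n + 2)) +
      (9 + sum (weight (cost search_step)) (alive (set as)))) + (cost forward_step + 12) * (m + 1)))
    (\<lambda>\<sigma>. counting_input \<sigma> \<and> adjacency as \<sigma> \<and> zeroed ''count'' \<sigma> \<and> zeroed ''parent'' \<sigma>)"
proof (rule triple_Seq[OF _ triple_Seq])
  define R where "R \<sigma> \<longleftrightarrow> (header \<sigma> \<and> edge_arrays \<sigma>) \<and> zeroed ''reach'' \<sigma> \<and> \<sigma> ''queue_len'' 0 = 0 \<and>
    zeroed ''forward'' \<sigma> \<and> zeroed ''count'' \<sigma> \<and> zeroed ''parent'' \<sigma>" for \<sigma>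
  have "preserved (writes build_adjacency) R"
    unfolding R_def by (intro preserved_intros) (simp_all add: build_adjacency_def)
  with build_adjacency_correct
  show "triple W input_ok build_adjacency ((cost adjacency_step + 12) * (m + 1))
      (\<lambda>\<sigma>. R \<sigma> \<and> adjacency as \<sigma>)"
    by (rule triple_frame) (simp_all add: R_def input_ok_def)
  define S where "S \<sigma> \<longleftrightarrow> (header \<sigma> \<and> edge_arrays \<sigma>) \<and> adjacency as \<sigma> \<and>
    zeroed ''forward'' \<sigma> \<and> zeroed ''count'' \<sigma> \<and> zeroed ''parent'' \<sigma>" for \<sigma>
  have "preserved (writes search) S"
    unfolding S_def by (intro preserved_intros)
      (simp_all add: search_def search_seed_def writes_worklist worklist_control_def)
  with search_correct
  show "triple W (\<lambda>\<sigma>. R \<sigma> \<and> adjacency as \<sigma>) search ((4 + (cost search_step + 14) * (n + 2)) +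
      (9 + sum (weight (cost search_step)) (alive (set as))))
      (\<lambda>\<sigma>. S \<sigma> \<and> bit_matrix ''reach'' (alive (set as)) \<sigma>)"
    by (rule triple_frame) (simp_all add: R_def S_def)
  have "preserved (writes mark_forward) (\<lambda>\<sigma>. (header \<sigma> \<and> edge_arrays \<sigma>) \<and> adjacency as \<sigma> \<and>
      bit_matrix ''reach'' (alive (set as)) \<sigma> \<and> zeroed ''count'' \<sigma> \<and> zeroed ''parent'' \<sigma>)"
    by (intro preserved_intros) (simp_all add: mark_forward_def)
  with mark_forward_correct
  show "triple W (\<lambda>\<sigma>. S \<sigma> \<and> bit_matrix ''reach'' (alive (set as)) \<sigma>) mark_forward
      ((cost forward_step + 12) * (m + 1))
      (\<lambda>\<sigma>. counting_input \<sigma> \<and> adjacency as \<sigma> \<and> zeroed ''count'' \<sigma> \<and> zeroed ''parent'' \<sigma>)"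
    by (rule triple_frame) (simp_all add: S_def counting_input_def)
qed

end

definition init_cost :: nat where
  "init_cost = cost adjacency_step + 4 * cost search_step + cost forward_step +
     2 * cost count_start_step + 2 * cost count_step + cost tree_step + 400"

definition total_cost :: nat where
  "total_cost = init_cost + 2 * cost cascade_step + cost reattach_step + update_cost + 200"

context flow_graph_input
begin

lemma initialise_correct:
  "triple W input_ok initialise (init_cost * ((n + 1) * (m + 1))) (maintained (set as))"
  unfolding initialise_def
proof (rule triple_conseq[OF triple_Seq[OF adjacency_search_forward count_edges_build_tree]])
  define X where "X = (n + 1) * (m + 1)"
  define a b c where "a = (cost search_step + 14) * (n + 2)"
    and "b = (cost count_start_step + 14) * (n + 2)"
    and "c = ((cost count_step + 12) * (m + 1) + 14) * (n + 2)"
  define S where "S = sum (weight (cost search_step)) (alive (set as))"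
  have X: "n + 2 \<le> 2 * X" "m + 1 \<le> X" "1 \<le> X" by (simp_all add: X_def)
  have edges: "(k + 12) * (m + 1) \<le> (k + 12) * X" for k using X(2) by (rule mult_le_mono2)
  have "a \<le> (cost search_step + 14) * (2 * X)" "b \<le> (cost count_start_step + 14) * (2 * X)"
    unfolding a_def b_def using X(1) by (rule mult_le_mono2)+
  moreover have "S \<le> (2 * cost search_step + 120) * X"
    using sum_weight_alive_le[OF subset_refl, of "cost search_step" 0] by (simp add: X_def S_def)
  moreover have "c \<le> (2 * cost count_step + 52) * X"
  proof -
    have "c \<le> ((cost count_step + 26) * (m + 1)) * (2 * (n + 1))"
      unfolding c_def by (intro mult_le_mono) (simp_all add: algebra_simps)
    then show ?thesis by (simp add: X_def algebra_simps)
  qed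
  ultimately have "(cost adjacency_step + 12) * (m + 1) + (4 + a + (9 + S) + (cost forward_step + 12) * (m + 1)) +
      (b + c + (cost tree_step + 100) * X) \<le> init_cost * X"
    using edges[of "cost adjacency_step"] edges[of "cost forward_step"] X(3)
    unfolding init_cost_def add_mult_distrib by linarith
  then show "(cost adjacency_step + 12) * (m + 1) + (4 + (cost search_step + 14) * (n + 2) +
      (9 + sum (weight (cost search_step)) (alive (set as))) + (cost forward_step + 12) * (m + 1)) +
      ((cost count_start_step + 14) * (n + 2) + ((cost count_step + 12) * (m + 1) + 14) * (n + 2) +
        (cost tree_step + 100) * ((n + 1) * (m + 1)))
    \<le> init_cost * ((n + 1) * (m + 1))"
    unfolding a_def b_def c_def S_def X_def .
qed


section \<open>The total running time\<close>

lemma stored_tree_correct: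
  assumes "flow_graph G s" "pverts G = {..<n}" "parcs G = E" and E: "E \<subseteq> set as"
    and tree: "tree_ok E \<sigma>"
  shows "stored_tree n s \<sigma> = dominator_tree G s"
proof -
  interpret flow_graph G s by fact
  have reachable: "v < n \<and> \<sigma> ''in_tree'' v \<noteq> 0 \<longleftrightarrow> (s, v) \<in> E\<^sup>*" for v
  proof -
    have "v < n" if "(s, v) \<in> E\<^sup>*"
      using that assms(2,3) reachable_iff_rtrancl reachable_in_verts(2)[of s v] by auto
    then show ?thesis using tree reachable_iff_alive[OF E] by (auto simp: tree_ok_def)
  qed
  have "dominator_tree G s = \<lparr>pverts = {v. v < n \<and> \<sigma> ''in_tree'' v \<noteq> 0},
      parcs = {(\<sigma> ''parent'' v, v) |v. v \<in> {v. v < n \<and> \<sigma> ''in_tree'' v \<noteq> 0} \<and> v \<noteq> s}\<rparr>"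
  proof (rule dominator_tree_eqI)
    show "v \<in> {v. v < n \<and> \<sigma> ''in_tree'' v \<noteq> 0} \<longleftrightarrow> (s, v) \<in> (parcs G)\<^sup>*" for v
      using reachable assms(3) by simp
    show "idom_among s (parcs G) (pverts G) (\<sigma> ''parent'' v) v"
      if "v \<in> {v. v < n \<and> \<sigma> ''in_tree'' v \<noteq> 0}" "v \<noteq> s" for v
      using that tree assms(2,3) by (auto simp: tree_ok_def parent_ok_def)
  qed
  then show ?thesis by (auto simp: stored_tree_def)
qed

lemma maintains_correct:
  assumes "maintained E \<sigma>" "bounded_state W \<sigma>" "E \<subseteq> set as" "set es \<subseteq> {..<n} \<times> {..<n}"
    "flow_graph G s" "pverts G = {..<n}" "parcs G = E"
  shows "\<exists>t. maintains W update n G s \<sigma> es t \<and> t \<le> potential E + length es * (update_cost * (n + 1))"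
  using assms
proof (induction es arbitrary: E \<sigma> G)
  case Nil
  then show ?case using stored_tree_correct by (simp add: maintained_def)
next
  case (Cons e es)
  obtain u v where e: "e = (u, v)" and uv: "u < n" "v < n" using Cons.prems(4) by auto
  have "agree {''del_tail'', ''del_head''} \<sigma> (request e \<sigma>)"
    by (simp add: request_def agree_def store_apply)
  moreover have "preserved {''del_tail'', ''del_head''} (maintained E)" by (intro preserved_intros) simp
  ultimately have "maintained E (request e \<sigma>)" using Cons.prems(1) by (blast dest: preservedD)
  moreover have "bounded_state W (request e \<sigma>)"
    unfolding request_def using Cons.prems(2) uv e by (intro bounded_state_store) (auto intro: index_less_W)
  ultimately obtain t \<tau> where t: "exec W update (request e \<sigma>) t \<tau>"
    "t \<le> sum death_cost (alive E - alive (E - {e})) + update_cost * (n + 1)"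
    "bounded_state W \<tau>" "maintained (E - {e}) \<tau>"
    using update_correct[OF Cons.prems(3) uv] e
    by (elim tripleE[of W _ update]) (auto simp: request_def store_apply)
  interpret flow_graph G s by (rule Cons.prems(5))
  have "flow_graph (delete_edge G e) s" by (rule flow_graph_delete_edge)
  then obtain u where u: "maintains W update n (delete_edge G e) s \<tau> es u"
    "u \<le> potential (E - {e}) + length es * (update_cost * (n + 1))"
    using Cons.IH[OF t(4,3), of "delete_edge G e"] Cons.prems by (auto simp: delete_edge_def)
  have "maintains W update n G s \<sigma> (e # es) (t + u)"
    using stored_tree_correct[of G E \<sigma>] Cons.prems t(1) u(1) by (auto simp: maintained_def)
  moreover have "t + u \<le> potential E + length (e # es) * (update_cost * (n + 1))"
    using t(2) u(2) potential_diff[of "E - {e}" E] by simp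
  ultimately show ?case by blast
qed

lemma total_correct:
  assumes G: "flow_graph G s" "pverts G = {..<n}" "parcs G = set as"
    and es: "distinct es" "set es \<subseteq> set as"
  shows "\<exists>t0 \<sigma> t. exec W initialise (input_state n s as) t0 \<sigma> \<and> maintains W update n G s \<sigma> es t \<and>
    t0 + t \<le> total_cost * ((n + 1) * (m + 1))"
proof -
  define X where "X = (n + 1) * (m + 1)"
  obtain t0 \<sigma> where init: "exec W initialise (input_state n s as) t0 \<sigma>" "t0 \<le> init_cost * X"
    "bounded_state W \<sigma>" "maintained (set as) \<sigma>"
    unfolding X_def by (rule tripleE[OF initialise_correct, OF bounded_state_input input_ok_input])
  have "set es \<subseteq> {..<n} \<times> {..<n}" using es(2) edges_bounded by blast
  from maintains_correct[OF init(4,3) subset_refl this G] obtain t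
    where t: "maintains W update n G s \<sigma> es t"
      "t \<le> potential (set as) + length es * (update_cost * (n + 1))" by blast
  have "length es \<le> length as"
    unfolding distinct_card[OF es(1), symmetric] distinct_card[OF distinct_edges, symmetric]
    using es(2) by (intro card_mono) simp_all
  then have "length es * (update_cost * (n + 1)) \<le> (m + 1) * (update_cost * (n + 1))"
    using length_edges by (intro mult_le_mono1) simp
  moreover have "(m + 1) * (update_cost * (n + 1)) = update_cost * X" by (simp add: X_def algebra_simps)
  moreover have "potential (set as) \<le> (2 * cost cascade_step + 120 + (cost reattach_step + 12)) * X"
    unfolding potential_def death_cost_def[abs_def] X_def by (rule sum_weight_alive_le) simp
  ultimately have "t0 + t \<le> total_cost * X"
    using init(2) t(2) unfolding total_cost_def add_mult_distrib by linarith
  with init(1) t(1) show ?thesis unfolding X_def by blast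
qed

end

lemma word_size_bound:
  assumes "s < (n :: nat)"
  shows "(n + 2) * (n + m + 2) < (n + m + 1) ^ 5"
proof -
  define Y where "Y = n + m + 1"
  have Y: "2 \<le> Y" "n + 2 \<le> 2 * Y" "n + m + 2 \<le> 2 * Y" using assms by (simp_all add: Y_def)
  have "(n + 2) * (n + m + 2) \<le> (2 * Y) * (2 * Y)" using Y(2,3) by (rule mult_le_mono)
  also have "\<dots> \<le> (Y * Y) * (Y * Y)" using Y(1) by (intro mult_le_mono) auto
  also have "\<dots> = Y ^ 4" by (simp add: power4_eq_xxxx)
  also have "\<dots> < Y ^ 5" using Y(1) by (intro power_strict_increasing) auto
  finally show ?thesis by (simp add: Y_def)
qed

lemma flow_graph_input_reducible:
  assumes "flow_graph G s" "reducible G s" "pverts G = {..<n}" "card (parcs G) = m"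
    and "distinct as" "set as = parcs G"
  shows "flow_graph_input n m s ((n + m + 1) ^ 5) as"
proof -
  interpret flow_graph G s by fact
  show ?thesis
  proof unfold_locales
    show "s < n" using start_in_verts assms(3) by simp
    then show "(n + 2) * (n + m + 2) < (n + m + 1) ^ 5" by (rule word_size_bound)
    show "length as = m" using distinct_card[OF assms(5)] assms(4,6) by simp
    show "set as \<subseteq> {..<n} \<times> {..<n}" using assms(3,6) in_arcsD1 in_arcsD2 by auto
    show "distinct as" by (rule assms(5))
    show "acyclic (forward_edges s (set as))" using acyclic_forward_edges[OF assms(2)] assms(6) by simp
  qed
qed

theorem theorem4:
  shows "\<exists>(init :: com) (upd :: com) (C :: nat) (c :: nat).
    \<forall>(G :: nat pair_pre_digraph) (s :: nat) (n :: nat) (m :: nat)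
      (as :: (nat \<times> nat) list) (es :: (nat \<times> nat) list).
      flow_graph G s \<and> reducible G s \<and>
      pverts G = {..<n} \<and> card (parcs G) = m \<and>
      distinct as \<and> set as = parcs G \<and>
      distinct es \<and> set es \<subseteq> parcs G \<longrightarrow>
      (\<exists>t0 \<sigma> t. exec ((n + m + 1) ^ c) init (input_state n s as) t0 \<sigma> \<and>
        maintains ((n + m + 1) ^ c) upd n G s \<sigma> es t \<and>
        (m \<ge> 1 \<longrightarrow> t0 + t \<le> C * (m * n)))"
proof (rule exI[of _ initialise], rule exI[of _ update], rule exI[of _ "4 * total_cost"],
    rule exI[of _ 5], intro allI impI, elim conjE)
  fix G :: "nat pair_pre_digraph" and s n m :: nat and as es :: "(nat \<times> nat) list"
  assume G: "flow_graph G s" "reducible G s" "pverts G = {..<n}" "card (parcs G) = m"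
    and as: "distinct as" "set as = parcs G" and es: "distinct es" "set es \<subseteq> parcs G"
  interpret flow_graph_input n m s "(n + m + 1) ^ 5" as
    using G as by (rule flow_graph_input_reducible)
  obtain t0 \<sigma> t where run: "exec ((n + m + 1) ^ 5) initialise (input_state n s as) t0 \<sigma>"
      "maintains ((n + m + 1) ^ 5) update n G s \<sigma> es t"
    and time: "t0 + t \<le> total_cost * ((n + 1) * (m + 1))"
    using total_correct[OF G(1,3) as(2)[symmetric] es(1)] es(2) as(2) by auto
  have "t0 + t \<le> 4 * total_cost * (m * n)" if "m \<ge> 1"
  proof -
    have "(n + 1) * (m + 1) \<le> (2 * n) * (2 * m)" using start that by (intro mult_le_mono) auto
    then have "total_cost * ((n + 1) * (m + 1)) \<le> total_cost * ((2 * n) * (2 * m))"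
      by (rule mult_le_mono2)
    also have "\<dots> = 4 * total_cost * (m * n)" by simp
    finally show ?thesis using time by linarith
  qed
  with run show "\<exists>t0 \<sigma> t. exec ((n + m + 1) ^ 5) initialise (input_state n s as) t0 \<sigma> \<and>
      maintains ((n + m + 1) ^ 5) update n G s \<sigma> es t \<and> (m \<ge> 1 \<longrightarrow> t0 + t \<le> 4 * total_cost * (m * n))"
    by blast
qed

end
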